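(* Let $M\subset\mathbb R^3$ be a $C^2$ surface and $q\in M$. Assume that the Gaussian curvature of $M$ is negative at every point of $M$ other than $q$. Then the $\frac12\mathbb Z$-valued Poincar\'e-Hopf index at $q$ of either distribution (line field) of principal directions on $M-\{q\}$ is non-positive.
   Context: Since the Gaussian curvature is negative on $M-\{q\}$, the two principal curvatures are distinct there, so the two distributions of principal directions are continuous line fields (possibly non-orientable) on $M-\{q\}$. The Poincar\'e-Hopf index at $q$ of a continuous line field $\eta$ defined on a punctured neighborhood of $q$ in an oriented surface is defined as follows: choose an orthonormal frame $\{e_1,e_2\}$ on a neighborhood $U$ of $q$, a Jordan curve around $q$ in $U$ with positive parametrization $\gamma:[0,1]\to U$, and a continuous function $\theta:[0,1]\to\mathbb R$ such that $\cos\theta(t)e_1+\sin\theta(t)e_2$ spans $\eta(\gamma(t))$ for all $t$; the index is $(\theta(1)-\theta(0))/(2\pi)\in\frac12\mathbb Z$. *)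

theory Defs
  imports "HOL-Analysis.Analysis" "HOL-Complex_Analysis.Complex_Analysis"
begin

definition C2_on :: "complex set \<Rightarrow> (complex \<Rightarrow> 'a::real_normed_vector) \<Rightarrow> bool" where
  "C2_on V f \<longleftrightarrow>
     (\<exists>D D2. (\<forall>z\<in>V. (f has_derivative blinfun_apply (D z)) (at z)) \<and>
             (\<forall>z\<in>V. (D has_derivative blinfun_apply (D2 z)) (at z)) \<and>
             continuous_on V D2)"

definition pd :: "(complex \<Rightarrow> 'a::real_normed_vector) \<Rightarrow> complex \<Rightarrow> complex \<Rightarrow> 'a" where
  "pd f w z = vector_derivative (\<lambda>t::real. f (z + of_real t * w)) (at 0)"

definition phi_u :: "(complex \<Rightarrow> real^3) \<Rightarrow> complex \<Rightarrow> real^3" where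
  "phi_u \<phi> z = pd \<phi> 1 z"
definition phi_v :: "(complex \<Rightarrow> real^3) \<Rightarrow> complex \<Rightarrow> real^3" where
  "phi_v \<phi> z = pd \<phi> \<i> z"
definition phi_uu :: "(complex \<Rightarrow> real^3) \<Rightarrow> complex \<Rightarrow> real^3" where
  "phi_uu \<phi> z = pd (pd \<phi> 1) 1 z"
definition phi_uv :: "(complex \<Rightarrow> real^3) \<Rightarrow> complex \<Rightarrow> real^3" where
  "phi_uv \<phi> z = pd (pd \<phi> 1) \<i> z"
definition phi_vv :: "(complex \<Rightarrow> real^3) \<Rightarrow> complex \<Rightarrow> real^3" where
  "phi_vv \<phi> z = pd (pd \<phi> \<i>) \<i> z"

definition chart :: "(real^3) set \<Rightarrow> complex set \<Rightarrow> (complex \<Rightarrow> real^3) \<Rightarrow> bool" where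
  "chart M V \<phi> \<longleftrightarrow>
     open V \<and> C2_on V \<phi> \<and> \<phi> ` V \<subseteq> M \<and> openin (top_of_set M) (\<phi> ` V) \<and>
     inj_on \<phi> V \<and> homeomorphism V (\<phi> ` V) \<phi> (inv_into V \<phi>) \<and>
     (\<forall>z\<in>V. cross3 (phi_u \<phi> z) (phi_v \<phi> z) \<noteq> 0)"

definition C2_surface :: "(real^3) set \<Rightarrow> bool" where
  "C2_surface M \<longleftrightarrow> (\<forall>p\<in>M. \<exists>V \<phi>. chart M V \<phi> \<and> p \<in> \<phi> ` V)"

definition unit_normal :: "(complex \<Rightarrow> real^3) \<Rightarrow> complex \<Rightarrow> real^3" where
  "unit_normal \<phi> z = (1 / norm (cross3 (phi_u \<phi> z) (phi_v \<phi> z))) *\<^sub>R cross3 (phi_u \<phi> z) (phi_v \<phi> z)"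

definition fE where "fE \<phi> z = phi_u \<phi> z \<bullet> phi_u \<phi> z"
definition fF where "fF \<phi> z = phi_u \<phi> z \<bullet> phi_v \<phi> z"
definition fG where "fG \<phi> z = phi_v \<phi> z \<bullet> phi_v \<phi> z"
definition sL where "sL \<phi> z = phi_uu \<phi> z \<bullet> unit_normal \<phi> z"
definition sM where "sM \<phi> z = phi_uv \<phi> z \<bullet> unit_normal \<phi> z"
definition sN where "sN \<phi> z = phi_vv \<phi> z \<bullet> unit_normal \<phi> z"

definition gauss_curv_chart :: "(complex \<Rightarrow> real^3) \<Rightarrow> complex \<Rightarrow> real" where
  "gauss_curv_chart \<phi> z =
     (sL \<phi> z * sN \<phi> z - (sM \<phi> z)^2) / (fE \<phi> z * fG \<phi> z - (fF \<phi> z)^2)"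

text \<open>k is the Gaussian curvature of M at p (computed in some chart around p;
  this value is chart independent).\<close>
definition has_gauss_curvature :: "(real^3) set \<Rightarrow> real^3 \<Rightarrow> real \<Rightarrow> bool" where
  "has_gauss_curvature M p k \<longleftrightarrow>
     (\<exists>V \<phi> z. chart M V \<phi> \<and> z \<in> V \<and> \<phi> z = p \<and> gauss_curv_chart \<phi> z = k)"

text \<open>w = a phi_u + b phi_v is a principal direction at phi z: it is an eigenvector of the shape
  operator, whose matrix in the basis (phi_u, phi_v) is I^{-1} II, i.e. II(a,b) = kappa I(a,b).\<close>
definition principal_dir_chart :: "(complex \<Rightarrow> real^3) \<Rightarrow> complex \<Rightarrow> real^3 \<Rightarrow> bool" where
  "principal_dir_chart \<phi> z w \<longleftrightarrow> w \<noteq> 0 \<and>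
     (\<exists>a b \<kappa>. w = a *\<^sub>R phi_u \<phi> z + b *\<^sub>R phi_v \<phi> z \<and>
        sL \<phi> z * a + sM \<phi> z * b = \<kappa> * (fE \<phi> z * a + fF \<phi> z * b) \<and>
        sM \<phi> z * a + sN \<phi> z * b = \<kappa> * (fF \<phi> z * a + fG \<phi> z * b))"

definition principal_dir :: "(real^3) set \<Rightarrow> real^3 \<Rightarrow> real^3 \<Rightarrow> bool" where
  "principal_dir M p w \<longleftrightarrow>
     (\<exists>V \<phi> z. chart M V \<phi> \<and> z \<in> V \<and> \<phi> z = p \<and> principal_dir_chart \<phi> z w)"

definition continuous_line_field :: "(real^3) set \<Rightarrow> (real^3 \<Rightarrow> (real^3) set) \<Rightarrow> bool" where
  "continuous_line_field S \<eta> \<longleftrightarrow>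
     (\<forall>p\<in>S. \<exists>W v. open W \<and> p \<in> W \<and> continuous_on (W \<inter> S) v \<and>
        (\<forall>x\<in>W \<inter> S. v x \<noteq> 0 \<and> \<eta> x = span {v x}))"

definition principal_line_field :: "(real^3) set \<Rightarrow> (real^3) set \<Rightarrow> (real^3 \<Rightarrow> (real^3) set) \<Rightarrow> bool" where
  "principal_line_field M S \<eta> \<longleftrightarrow> continuous_line_field S \<eta> \<and>
     (\<forall>p\<in>S. \<exists>w. principal_dir M p w \<and> \<eta> p = span {w})"

text \<open>k is (a value of) the Poincare-Hopf index at q of the line field eta: computed as in the
  paper from a positively oriented orthonormal tangent frame (e1,e2) on a neighbourhood U of q,
  a positively parametrized Jordan curve around q in U (orientation taken from a chart
  containing U), and a continuous angle function theta.\<close>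
definition ph_index :: "(real^3) set \<Rightarrow> real^3 \<Rightarrow> (real^3 \<Rightarrow> (real^3) set) \<Rightarrow> real \<Rightarrow> bool" where
  "ph_index M q \<eta> k \<longleftrightarrow>
    (\<exists>V \<phi> U e1 e2 c z0 \<theta>.
       chart M V \<phi> \<and> open U \<and> q \<in> U \<and> U \<inter> M \<subseteq> \<phi> ` V \<and>
       continuous_on (U \<inter> M) e1 \<and> continuous_on (U \<inter> M) e2 \<and>
       (\<forall>z\<in>V. \<phi> z \<in> U \<longrightarrow>
          norm (e1 (\<phi> z)) = 1 \<and> norm (e2 (\<phi> z)) = 1 \<and> e1 (\<phi> z) \<bullet> e2 (\<phi> z) = 0 \<and>
          e1 (\<phi> z) \<in> span {phi_u \<phi> z, phi_v \<phi> z} \<and>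
          e2 (\<phi> z) \<in> span {phi_u \<phi> z, phi_v \<phi> z} \<and>
          cross3 (e1 (\<phi> z)) (e2 (\<phi> z)) \<bullet> cross3 (phi_u \<phi> z) (phi_v \<phi> z) > 0) \<and>
       simple_path c \<and> pathfinish c = pathstart c \<and>
       path_image c \<union> inside (path_image c) \<subseteq> V \<and>
       \<phi> ` (path_image c \<union> inside (path_image c)) \<subseteq> U \<and>
       z0 \<in> V \<and> \<phi> z0 = q \<and> z0 \<in> inside (path_image c) \<and> winding_number c z0 = 1 \<and>
       continuous_on {0..1} \<theta> \<and>
       (\<forall>t\<in>{0..1}. \<eta> (\<phi> (c t)) =
           span {cos (\<theta> t) *\<^sub>R e1 (\<phi> (c t)) + sin (\<theta> t) *\<^sub>R e2 (\<phi> (c t))}) \<and>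
       k = (\<theta> 1 - \<theta> 0) / (2 * pi))"

end

theory Submission
  imports Defs
begin

text \<open>Near q the surface has a gradient map g (central projection of the normal to the tangent plane
  at q), whose Jacobian has the sign of the Gaussian curvature. Twice the index of a principal line field
  is the number of turns of the trace-free part of the second fundamental form, hence that of the
  partial derivative of g in the first coordinate, because the trace-free part dominates an indefinite form.
  After a reflection g preserves orientation off q. Its zeros are then isolated, it turns n \<ge> 1 times
  around q, and since the gradient of |g|^2 turns once around the minimum q, the partial derivative of the
  reflected map turns n - 1 \<ge> 0 times. Undoing the reflection gives index (1 - n) / 2 \<le> 0.\<close>

subsection \<open>Turns of a closed curve about the origin\<close>

text \<open>The surface is only C^2, so g is only C^1. Its differential at q may vanish, no leading
  homogeneous term describes g there, and zeros of g could a priori accumulate at q. The arguments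
  about g therefore use degree and the sign of the Jacobian away from q. Likewise the gradient of
  |g|^2 is merely continuous, so its flow lines need not be unique, and the surroundings of the
  minimum are explored by discrete steps instead of a flow.

  The coordinate basis, the basis adapted to g and the orthonormal frame are compared through a
  single number \<tau> in the upper half plane. The quadratic expressions belonging to different
  bases are joined by segments that miss 0 because the second fundamental form is indefinite.

  A line field fixes its angle only up to pi and does not say which principal curvature it belongs
  to. It thus determines the trace-free part only up to a real factor of unknown sign. Squares are
  compared, so that four times the index equals twice a turning number.\<close>

definition turns :: "(real \<Rightarrow> complex) \<Rightarrow> real \<Rightarrow> bool" where
  "turns f n \<longleftrightarrow> (\<exists>l. continuous_on {0..1} l \<and> (\<forall>t\<in>{0..1}. f t = exp (l t)) \<and>
     l 1 - l 0 = of_real (2 * pi * n) * \<i>)"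

definition circ :: "real \<Rightarrow> real \<Rightarrow> complex" where
  "circ r t = of_real r * exp (of_real (2 * pi * t) * \<i>)"

text \<open>Two logarithms of one curve differ by a continuous function with values in the discrete
  set of multiples of 2 pi i, hence by a constant. This is how turning numbers computed in two ways
  are equated.\<close>

lemma turns_unique:
  assumes "turns f m" "turns f n"
  shows "m = n"
proof -
  obtain k where k: "continuous_on {0..1} k" "\<forall>t\<in>{0..1}. f t = exp (k t)"
     "k 1 - k 0 = of_real (2 * pi * m) * \<i>"
    using assms(1) unfolding turns_def by blast
  obtain l where l: "continuous_on {0..1} l" "\<forall>t\<in>{0..1}. f t = exp (l t)"
     "l 1 - l 0 = of_real (2 * pi * n) * \<i>"
    using assms(2) unfolding turns_def by blast
  define h where "h = (\<lambda>t. k t - l t)"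
  have disc: "\<exists>j::int. h t = of_int j * (of_real (2 * pi) * \<i>)" if "t \<in> {0..1}" for t
  proof -
    have "exp (h t) = 1"
      unfolding h_def using k(2) l(2) that by (simp add: exp_diff)
    then obtain j where "Re (h t) = 0 \<and> Im (h t) = of_int (2 * j) * pi"
      unfolding exp_eq_1 by blast
    then have "h t = of_int j * (of_real (2 * pi) * \<i>)"
      by (simp add: complex_eq_iff)
    then show ?thesis by blast
  qed
  have "h constant_on {0..1}"
  proof (rule continuous_discrete_range_constant)
    show "connected {0..1::real}" by simp
    show "continuous_on {0..1} h"
      unfolding h_def using k l by (intro continuous_intros)
    show "\<exists>e>0. \<forall>y. y \<in> {0..1} \<and> h y \<noteq> h x \<longrightarrow> e \<le> norm (h y - h x)"
      if x: "x \<in> {0..1}" for x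
    proof (intro exI[of _ "2 * pi"] conjI allI impI)
      fix y assume y: "y \<in> {0..1} \<and> h y \<noteq> h x"
      obtain i where i: "h x = of_int i * (of_real (2 * pi) * \<i>)" using disc[OF x] by blast
      obtain j where j: "h y = of_int j * (of_real (2 * pi) * \<i>)" using disc y by blast
      have "h y - h x = of_int (j - i) * (of_real (2 * pi) * \<i>)"
        unfolding i j by (simp add: algebra_simps)
      then have "norm (h y - h x) = real_of_int \<bar>j - i\<bar> * (2 * pi)"
        by (simp only: norm_mult norm_of_int norm_of_real norm_ii) simp
      moreover have "\<bar>j - i\<bar> \<ge> 1" using i j y by auto
      then have "real_of_int \<bar>j - i\<bar> \<ge> 1" by linarith
      ultimately show "2 * pi \<le> norm (h y - h x)"
        using mult_right_mono[of 1 "real_of_int \<bar>j - i\<bar>" "2 * pi"] by simp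
    qed auto
  qed
  then obtain c where c: "\<And>x. x \<in> {0..1} \<Longrightarrow> h x = c" unfolding constant_on_def by blast
  have "h 1 = h 0" using c[of 0] c[of 1] by simp
  then have "k 1 - k 0 = l 1 - l 0" unfolding h_def by (simp add: algebra_simps)
  then have "of_real (2 * pi * m) * \<i> = of_real (2 * pi * n) * \<i>" using k(3) l(3) by simp
  then have "complex_of_real (2 * pi * m) = of_real (2 * pi * n)" by simp
  then have "2 * pi * m = 2 * pi * n" by (simp only: of_real_eq_iff)
  then show ?thesis by simp
qed

text \<open>Since f closes up, the end values of its logarithm differ by a period. Integrality is
  what later permits division by the matching power \<open>powi\<close>.\<close>

lemma turns_exists:
  assumes "continuous_on {0..1} f" "\<And>t. t \<in> {0..1} \<Longrightarrow> f t \<noteq> 0" "f 0 = f 1"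
  obtains n :: int where "turns f n"
proof -
  obtain l where l: "continuous_on {0..1} l" "\<And>t. t \<in> {0..1} \<Longrightarrow> f t = exp (l t)"
    using continuous_logarithm_on_contractible[OF assms(1) convex_imp_contractible] assms(2)
    by (metis convex_real_interval(5))
  have "exp (l 1 - l 0) = 1"
    using l(2)[of 0] l(2)[of 1] assms(3) by (simp add: exp_diff)
  then obtain n where "Re (l 1 - l 0) = 0 \<and> Im (l 1 - l 0) = of_int (2 * n) * pi"
    unfolding exp_eq_1 by blast
  then have "l 1 - l 0 = of_real (2 * pi * n) * \<i>"
    by (simp add: complex_eq_iff)
  then show ?thesis using l that unfolding turns_def by blast
qed

lemma turns_nonzero: "turns f n \<Longrightarrow> t \<in> {0..1} \<Longrightarrow> f t \<noteq> 0"
  unfolding turns_def by auto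

lemma turns_cong:
  assumes "turns f n" "\<And>t. t \<in> {0..1} \<Longrightarrow> f t = g t"
  shows "turns g n"
  using assms unfolding turns_def by auto

lemma turns_mult:
  assumes "turns f m" "turns g n"
  shows "turns (\<lambda>t. f t * g t) (m + n)"
proof -
  obtain k where k: "continuous_on {0..1} k" "\<forall>t\<in>{0..1}. f t = exp (k t)"
     "k 1 - k 0 = of_real (2 * pi * m) * \<i>"
    using assms(1) unfolding turns_def by blast
  obtain l where l: "continuous_on {0..1} l" "\<forall>t\<in>{0..1}. g t = exp (l t)"
     "l 1 - l 0 = of_real (2 * pi * n) * \<i>"
    using assms(2) unfolding turns_def by blast
  show ?thesis unfolding turns_def
  proof (intro exI[of _ "\<lambda>t. k t + l t"] conjI)
    show "continuous_on {0..1} (\<lambda>t. k t + l t)" using k l by (intro continuous_intros)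
    have "(k 1 + l 1) - (k 0 + l 0) = (k 1 - k 0) + (l 1 - l 0)" by simp
    then show "(k 1 + l 1) - (k 0 + l 0) = of_real (2 * pi * (m + n)) * \<i>"
      unfolding k(3) l(3) by (simp add: algebra_simps)
  qed (use k l in \<open>auto simp: exp_add\<close>)
qed

lemma turns_inverse:
  assumes "turns f m"
  shows "turns (\<lambda>t. inverse (f t)) (- m)"
proof -
  obtain k where k: "continuous_on {0..1} k" "\<forall>t\<in>{0..1}. f t = exp (k t)"
     "k 1 - k 0 = of_real (2 * pi * m) * \<i>"
    using assms(1) unfolding turns_def by blast
  show ?thesis unfolding turns_def
  proof (intro exI[of _ "\<lambda>t. - k t"] conjI)
    show "continuous_on {0..1} (\<lambda>t. - k t)" using k by (intro continuous_intros)
    have "- k 1 - (- k 0) = - (k 1 - k 0)" by simp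
    then show "- k 1 - (- k 0) = of_real (2 * pi * (- m)) * \<i>"
      unfolding k(3) by simp
  qed (use k in \<open>auto simp: exp_minus\<close>)
qed

lemma turns_divide:
  assumes "turns f m" "turns g n"
  shows "turns (\<lambda>t. f t / g t) (m - n)"
  using turns_mult[OF assms(1) turns_inverse[OF assms(2)]] by (simp add: field_simps)

lemma turns_cnj:
  assumes "turns f m"
  shows "turns (\<lambda>t. cnj (f t)) (- m)"
proof -
  obtain k where k: "continuous_on {0..1} k" "\<forall>t\<in>{0..1}. f t = exp (k t)"
     "k 1 - k 0 = of_real (2 * pi * m) * \<i>"
    using assms(1) unfolding turns_def by blast
  show ?thesis unfolding turns_def
  proof (intro exI[of _ "\<lambda>t. cnj (k t)"] conjI)
    show "continuous_on {0..1} (\<lambda>t. cnj (k t))" using k by (intro continuous_intros)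
    have "cnj (k 1) - cnj (k 0) = cnj (k 1 - k 0)" by simp
    then show "cnj (k 1) - cnj (k 0) = of_real (2 * pi * (- m)) * \<i>"
      unfolding k(3) by simp
  qed (use k in \<open>auto simp: exp_cnj\<close>)
qed

lemma turns_power:
  assumes "turns f m"
  shows "turns (\<lambda>t. f t ^ j) (real j * m)"
proof (induction j)
  case 0
  show ?case unfolding turns_def by (intro exI[of _ "\<lambda>t. 0"]) auto
next
  case (Suc j)
  show ?case using turns_mult[OF assms Suc] by (simp add: algebra_simps)
qed

lemma turns_power_int:
  assumes "turns f m"
  shows "turns (\<lambda>t. f t powi j) (of_int j * m)"
proof (cases "j \<ge> 0")
  case True
  then show ?thesis using turns_power[OF assms, of "nat j"]
    by (simp add: power_int_def)
next
  case False
  then show ?thesis using turns_power[OF turns_inverse[OF assms], of "nat (- j)"]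
    by (simp add: power_int_def)
qed

lemma turns_exp:
  assumes "continuous_on {0..1} l" "l 0 = l 1"
  shows "turns (\<lambda>t. exp (l t)) 0"
  using assms unfolding turns_def by (intro exI[of _ l]) auto

lemma turns_const: "a \<noteq> 0 \<Longrightarrow> turns (\<lambda>t. a) 0"
  using turns_exp[of "\<lambda>t. Ln a"] by simp

lemma turns_circ:
  assumes "r \<noteq> 0"
  shows "turns (circ r) 1"
proof -
  have "turns (\<lambda>t. exp (of_real (2 * pi * t) * \<i>)) 1"
    unfolding turns_def
    by (intro exI[of _ "\<lambda>t. of_real (2 * pi * t) * \<i>"]) (auto intro!: continuous_intros)
  from turns_mult[OF turns_const this, of "of_real r"] assms show ?thesis
    unfolding circ_def by simp
qed

section \<open>The round circle as a closed curve\<close>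

lemma norm_circ [simp]: "norm (circ r t) = \<bar>r\<bar>"
proof -
  have "circ r t = of_real r * exp (\<i> * of_real (2 * pi * t))"
    unfolding circ_def by (simp add: mult_ac)
  then show ?thesis by (simp only: norm_mult norm_exp_i_times norm_of_real mult_1_right)
qed

lemma circ_eq_0_iff [simp]: "circ r t = 0 \<longleftrightarrow> r = 0"
  by (metis norm_circ abs_eq_0 norm_eq_zero)

lemma continuous_on_circ [continuous_intros]: "continuous_on S (circ r)"
  unfolding circ_def by (intro continuous_intros)

lemma circ_closed: "circ r 0 = circ r 1"
proof -
  have "exp (of_real (2 * pi) * \<i>) = 1" using exp_two_pi_i by (simp only: of_real_mult of_real_numeral)
  then show ?thesis unfolding circ_def by simp
qed

lemma circ_surj:
  assumes "norm z = r"
  obtains t where "t \<in> {0..1}" "circ r t = z"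
proof -
  define t where "t = Arg2pi z / (2 * pi)"
  have "t \<in> {0..1}" unfolding t_def using Arg2pi_ge_0[of z] Arg2pi_lt_2pi[of z] by simp
  moreover have "circ r t = z"
    using Arg2pi_eq[of z] assms unfolding circ_def t_def by (simp add: mult.commute)
  ultimately show ?thesis using that by blast
qed

section \<open>Homotopy criteria for equal turning numbers\<close>

text \<open>The quotient condition says that the segment from f t to g t misses 0.\<close>
lemma turns_linear:
  assumes f: "continuous_on {0..1} f" "f 0 = f 1" and g: "turns g n" "continuous_on {0..1} g" "g 0 = g 1"
    and nz: "\<And>t. t \<in> {0..1} \<Longrightarrow> f t / g t \<notin> \<real>\<^sub>\<le>\<^sub>0"
  shows "turns f n"
proof -
  have g0: "g t \<noteq> 0" if "t \<in> {0..1}" for t using turns_nonzero[OF g(1) that] .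
  have q0: "f t / g t \<noteq> 0" if "t \<in> {0..1}" for t
  proof
    assume "f t / g t = 0"
    with nz[OF that] show False by simp
  qed
  have "continuous_on {0..1} (\<lambda>t. Ln (f t / g t))"
    by (rule continuous_on_Ln'[OF continuous_on_divide[OF f(1) g(2)] nz]) (use g0 in auto)
  then have "turns (\<lambda>t. exp (Ln (f t / g t))) 0"
    by (rule turns_exp) (use f g in auto)
  from turns_mult[OF this g(1)] have "turns (\<lambda>t. exp (Ln (f t / g t)) * g t) n" by simp
  then show ?thesis
    by (rule turns_cong) (use q0 g0 in auto)
qed

lemma not_nonpos_RealsI_Re: "Re z > 0 \<Longrightarrow> z \<notin> \<real>\<^sub>\<le>\<^sub>0"
  by (auto simp: complex_nonpos_Reals_iff)

lemma Re_divide_pos: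
  fixes z w :: complex
  assumes "norm (z - w) < norm w"
  shows "Re (z / w) > 0"
proof -
  have "w \<noteq> 0" using assms by auto
  then have "z / w = 1 + (z - w) / w" by (simp add: field_simps)
  then have "Re (z / w) = 1 + Re ((z - w) / w)" by simp
  moreover have "norm ((z - w) / w) < 1" using assms \<open>w \<noteq> 0\<close> by (simp add: norm_divide)
  then have "\<bar>Re ((z - w) / w)\<bar> < 1" using abs_Re_le_cmod le_less_trans by blast
  ultimately show ?thesis by linarith
qed

text \<open>Rouche's leash: f stays closer to g than g is to 0, so f / g lies in the right half
  plane.\<close>

lemma turns_near:
  assumes "continuous_on {0..1} f" "f 0 = f 1" "turns g n" "continuous_on {0..1} g" "g 0 = g 1"
    and "\<And>t. t \<in> {0..1} \<Longrightarrow> norm (f t - g t) < norm (g t)"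
  shows "turns f n"
  by (rule turns_linear[OF assms(1-5)]) (use assms(6) in \<open>auto intro!: not_nonpos_RealsI_Re Re_divide_pos\<close>)

lemma continuous_on_circ_compose:
  assumes "continuous_on S f" "\<And>z. norm z = r \<Longrightarrow> z \<in> S" "r > 0"
  shows "continuous_on {0..1} (\<lambda>t. f (circ r t))"
proof (rule continuous_on_compose2[OF assms(1) continuous_on_circ])
  show "circ r ` {0..1} \<subseteq> S"
  proof
    fix z assume "z \<in> circ r ` {0..1}"
    then have "norm z = r" using assms(3) by auto
    then show "z \<in> S" by (rule assms(2))
  qed
qed

text \<open>A zero-free function on a disc has a logarithm on the whole disc, and its restriction to
  the boundary circle closes up.\<close>

lemma turns_on_cball:
  assumes "continuous_on (cball 0 r) f" "\<And>z. z \<in> cball 0 r \<Longrightarrow> f z \<noteq> 0" "r > 0"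
  shows "turns (\<lambda>t. f (circ r t)) 0"
proof -
  obtain l where l: "continuous_on (cball 0 r) l" "\<And>z. z \<in> cball 0 r \<Longrightarrow> f z = exp (l z)"
    using continuous_logarithm_on_cball[OF assms(1)] assms(2) by blast
  have "turns (\<lambda>t. exp (l (circ r t))) 0"
  proof (rule turns_exp)
    show "continuous_on {0..1} (\<lambda>t. l (circ r t))"
      by (rule continuous_on_circ_compose[OF l(1)]) (use assms(3) in auto)
    show "l (circ r 0) = l (circ r 1)" by (simp only: circ_closed)
  qed
  then show ?thesis
  proof (rule turns_cong)
    fix t :: real
    show "exp (l (circ r t)) = f (circ r t)" by (rule l(2)[symmetric]) (use assms(3) in simp)
  qed
qed

subsection \<open>Counting nondegenerate zeros\<close>

text \<open>A zero of local degree +1, expressed as approximation by a complex linear map with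
  relative error below 1. This covers orientation-preserving real differentials. It also survives
  multiplication by a continuous nonvanishing factor, so zeros can be divided out one after another
  without computing derivatives of quotients.\<close>

definition simple_zero :: "(complex \<Rightarrow> complex) \<Rightarrow> complex \<Rightarrow> bool" where
  "simple_zero g \<zeta> \<longleftrightarrow> (\<exists>a \<kappa>. a \<noteq> 0 \<and> 0 \<le> \<kappa> \<and> \<kappa> < 1 \<and>
     (\<forall>\<^sub>F z in nhds \<zeta>. norm (g z - a * (z - \<zeta>)) \<le> \<kappa> * norm a * norm (z - \<zeta>)))"

lemma simple_zero_mult:
  assumes "simple_zero g \<zeta>" "isCont u \<zeta>" "u \<zeta> \<noteq> 0"
  shows "simple_zero (\<lambda>z. u z * g z) \<zeta>"
proof -
  obtain a \<kappa> where a: "a \<noteq> 0" "0 \<le> \<kappa>" "\<kappa> < 1"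
    and ev: "\<forall>\<^sub>F z in nhds \<zeta>. norm (g z - a * (z - \<zeta>)) \<le> \<kappa> * norm a * norm (z - \<zeta>)"
    using assms(1) unfolding simple_zero_def by blast
  define e where "e = (1 - \<kappa>) / 4"
  have "e > 0" unfolding e_def using a by simp
  then have "e * norm (u \<zeta>) > 0" using assms(3) by simp
  moreover have "(u \<longlongrightarrow> u \<zeta>) (nhds \<zeta>)"
    using assms(2) by (simp add: continuous_at tendsto_at_iff_tendsto_nhds)
  ultimately have ev2: "\<forall>\<^sub>F z in nhds \<zeta>. dist (u z) (u \<zeta>) < e * norm (u \<zeta>)"
    using tendstoD by blast
  show ?thesis unfolding simple_zero_def
  proof (intro exI[of _ "a * u \<zeta>"] exI[of _ "(1 + \<kappa>) / 2"] conjI)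
    show "\<forall>\<^sub>F z in nhds \<zeta>. norm (u z * g z - a * u \<zeta> * (z - \<zeta>))
             \<le> (1 + \<kappa>) / 2 * norm (a * u \<zeta>) * norm (z - \<zeta>)"
      using ev ev2
    proof eventually_elim
      case (elim z)
      define h where "h = norm (z - \<zeta>)"
      have d: "norm (u z - u \<zeta>) \<le> e * norm (u \<zeta>)" using elim(2) by (simp add: dist_norm)
      have "norm (u z) \<le> norm (u \<zeta>) + norm (u z - u \<zeta>)"
        by (metis add_diff_cancel_left' add_diff_eq norm_triangle_ineq)
      then have uz: "norm (u z) \<le> (1 + e) * norm (u \<zeta>)" using d by (simp add: algebra_simps)
      have "u z * g z - a * u \<zeta> * (z - \<zeta>) = u z * (g z - a * (z - \<zeta>)) + a * (z - \<zeta>) * (u z - u \<zeta>)"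
        by (simp add: algebra_simps)
      also have "norm \<dots> \<le> norm (u z) * norm (g z - a * (z - \<zeta>)) + norm a * h * norm (u z - u \<zeta>)"
        unfolding h_def by (metis norm_triangle_ineq norm_mult)
      also have "\<dots> \<le> ((1 + e) * norm (u \<zeta>)) * (\<kappa> * norm a * h) + norm a * h * (e * norm (u \<zeta>))"
        unfolding h_def using d uz elim(1) \<open>e > 0\<close>
        by (intro add_mono mult_mono) auto
      also have "\<dots> = (\<kappa> * (1 + e) + e) * (norm (a * u \<zeta>) * h)"
        by (simp add: norm_mult algebra_simps)
      also have "\<dots> \<le> ((1 + \<kappa>) / 2) * (norm (a * u \<zeta>) * h)"
      proof (rule mult_right_mono)
        have "\<kappa> * e \<le> e" using a \<open>e > 0\<close> by simp
        then have "\<kappa> * (1 + e) + e \<le> \<kappa> + 2 * e" by (simp add: algebra_simps)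
        then show "\<kappa> * (1 + e) + e \<le> (1 + \<kappa>) / 2" unfolding e_def by (simp add: field_simps)
      qed (simp add: h_def)
      finally show ?case unfolding h_def by (simp add: mult_ac)
    qed
  qed (use a assms(3) in auto)
qed

lemma simple_zero_cong:
  assumes "simple_zero f \<zeta>" "\<forall>\<^sub>F z in nhds \<zeta>. f z = g z"
  shows "simple_zero g \<zeta>"
proof -
  obtain a \<kappa> where a: "a \<noteq> 0" "0 \<le> \<kappa>" "\<kappa> < 1"
    and ev: "\<forall>\<^sub>F z in nhds \<zeta>. norm (f z - a * (z - \<zeta>)) \<le> \<kappa> * norm a * norm (z - \<zeta>)"
    using assms(1) unfolding simple_zero_def by blast
  have "\<forall>\<^sub>F z in nhds \<zeta>. norm (g z - a * (z - \<zeta>)) \<le> \<kappa> * norm a * norm (z - \<zeta>)"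
    using ev assms(2) by eventually_elim simp
  then show ?thesis unfolding simple_zero_def using a by blast
qed

lemma simple_zero_isolated:
  assumes "simple_zero g \<zeta>"
  shows "\<forall>\<^sub>F z in at \<zeta>. g z \<noteq> 0"
proof -
  obtain a \<kappa> where a: "a \<noteq> 0" "0 \<le> \<kappa>" "\<kappa> < 1"
    and ev: "\<forall>\<^sub>F z in nhds \<zeta>. norm (g z - a * (z - \<zeta>)) \<le> \<kappa> * norm a * norm (z - \<zeta>)"
    using assms(1) unfolding simple_zero_def by blast
  have "\<forall>\<^sub>F z in at \<zeta>. norm (g z - a * (z - \<zeta>)) \<le> \<kappa> * norm a * norm (z - \<zeta>)"
    using ev unfolding eventually_at_filter by eventually_elim simp
  moreover have "\<forall>\<^sub>F z in at \<zeta>. z \<noteq> \<zeta>" by (simp add: eventually_at_filter)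
  ultimately show ?thesis
  proof eventually_elim
    case (elim z)
    show ?case
    proof
      assume "g z = 0"
      then have "1 * (norm a * norm (z - \<zeta>)) \<le> \<kappa> * (norm a * norm (z - \<zeta>))"
        using elim(1) by (simp add: norm_mult mult_ac)
      then have "1 \<le> \<kappa>" using a elim(2) by (subst (asm) mult_le_cancel_right) auto
      then show False using a by simp
    qed
  qed
qed

text \<open>The differential a h + b cnj h has Jacobian |a|^2 - |b|^2. The antilinear part is
  treated as an error: a remainder of relative size (|a| - |b|) / 2 leaves a total error of (|a| +
  |b|) / 2, still below |a|.\<close>

lemma simple_zero_derivative:
  assumes "(g has_derivative (\<lambda>h. a * h + b * cnj h)) (at \<zeta>)" "g \<zeta> = 0" "norm b < norm a"
  shows "simple_zero g \<zeta>"
proof -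
  have a: "norm a > 0" using assms(3) by (metis norm_ge_zero le_less_trans)
  define e where "e = (norm a - norm b) / 2"
  have e: "e > 0" unfolding e_def using assms(3) by simp
  obtain d where d: "d > 0" "\<And>y. norm (y - \<zeta>) < d \<Longrightarrow>
      norm (g y - g \<zeta> - (a * (y - \<zeta>) + b * cnj (y - \<zeta>))) \<le> e * norm (y - \<zeta>)"
    using assms(1) e unfolding has_derivative_at_alt by blast
  have "\<forall>\<^sub>F z in nhds \<zeta>. z \<in> ball \<zeta> d" using d by (intro eventually_nhds_in_open) auto
  then have ev: "\<forall>\<^sub>F z in nhds \<zeta>. norm (g z - a * (z - \<zeta>)) \<le> ((norm a + norm b) / 2 / norm a) * norm a * norm (z - \<zeta>)"
  proof eventually_elim
    case (elim z)
    then have "norm (g z - (a * (z - \<zeta>) + b * cnj (z - \<zeta>))) \<le> e * norm (z - \<zeta>)"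
      using d(2)[of z] assms(2) by (simp add: dist_norm norm_minus_commute)
    moreover have "norm (b * cnj (z - \<zeta>)) = norm b * norm (z - \<zeta>)"
      by (simp only: norm_mult complex_mod_cnj)
    ultimately have "norm (g z - a * (z - \<zeta>)) \<le> e * norm (z - \<zeta>) + norm b * norm (z - \<zeta>)"
      by (smt (verit, best) norm_triangle_ineq diff_add_cancel add_diff_eq diff_diff_add)
    also have "\<dots> = ((norm a + norm b) / 2) * norm (z - \<zeta>)" unfolding e_def by (simp add: field_simps)
    finally show ?case using a by simp
  qed
  show ?thesis unfolding simple_zero_def
    by (intro exI[of _ a] exI[of _ "(norm a + norm b) / 2 / norm a"] conjI ev)
       (use a assms(3) in \<open>auto simp: field_simps\<close>)
qed

text \<open>Dividing out one zero at a time; near the zero the quotient is only bounded, and is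
  interpolated with the constant a.\<close>
lemma turns_eq_card_zeros:
  fixes g :: "complex \<Rightarrow> complex"
  assumes "finite Z" "r > 0" "continuous_on (cball 0 r) g" "Z \<subseteq> ball 0 r"
    and "{z \<in> cball 0 r. g z = 0} = Z" "\<And>\<zeta>. \<zeta> \<in> Z \<Longrightarrow> simple_zero g \<zeta>"
  shows "turns (\<lambda>t. g (circ r t)) (real (card Z))"
  using assms
proof (induction Z arbitrary: g rule: finite_induct)
  case empty
  have "g z \<noteq> 0" if "z \<in> cball 0 r" for z using empty that by blast
  then show ?case using turns_on_cball[OF empty(2)] empty(1) by simp
next
  case (insert \<zeta> Z)
  note r = \<open>r > 0\<close>
  have z: "norm \<zeta> < r" using insert.prems by simp
  obtain a \<kappa> where a: "a \<noteq> 0" "0 \<le> \<kappa>" "\<kappa> < 1"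
    and ev: "\<forall>\<^sub>F z in nhds \<zeta>. norm (g z - a * (z - \<zeta>)) \<le> \<kappa> * norm a * norm (z - \<zeta>)"
    using insert.prems(5)[of \<zeta>] unfolding simple_zero_def by blast
  have "open (ball 0 r - Z)" using insert.hyps by (intro open_Diff finite_imp_closed) auto
  moreover have "\<zeta> \<in> ball 0 r - Z" using z insert.hyps by simp
  ultimately have "\<forall>\<^sub>F z in nhds \<zeta>. z \<in> ball 0 r - Z" by (rule eventually_nhds_in_open)
  with ev have "\<forall>\<^sub>F z in nhds \<zeta>. norm (g z - a * (z - \<zeta>)) \<le> \<kappa> * norm a * norm (z - \<zeta>) \<and> z \<in> ball 0 r - Z"
    by (rule eventually_conj)
  then obtain d0 where d0: "d0 > 0" "\<And>z. dist z \<zeta> < d0 \<Longrightarrow>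
     norm (g z - a * (z - \<zeta>)) \<le> \<kappa> * norm a * norm (z - \<zeta>) \<and> z \<in> ball 0 r - Z"
    unfolding eventually_nhds_metric by blast
  define d where "d = d0 / 2"
  have d: "d > 0" "\<And>z. norm (z - \<zeta>) \<le> d \<Longrightarrow>
     norm (g z - a * (z - \<zeta>)) \<le> \<kappa> * norm a * norm (z - \<zeta>) \<and> z \<in> ball 0 r - Z"
    using d0 unfolding d_def by (auto simp: dist_norm)
  define q where "q = (\<lambda>z. a + of_real (min 1 (norm (z - \<zeta>) / d)) * (g z / (z - \<zeta>) - a))"
  have q\<zeta>: "q \<zeta> = a" unfolding q_def using d by simp
  have near: "norm (g z / (z - \<zeta>) - a) \<le> \<kappa> * norm a" if "norm (z - \<zeta>) \<le> d" "z \<noteq> \<zeta>" for z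
  proof -
    have "g z / (z - \<zeta>) - a = (g z - a * (z - \<zeta>)) / (z - \<zeta>)" using that by (simp add: field_simps)
    then have "norm (g z / (z - \<zeta>) - a) = norm (g z - a * (z - \<zeta>)) / norm (z - \<zeta>)"
      by (simp add: norm_divide)
    also have "\<dots> \<le> \<kappa> * norm a" using d(2)[OF that(1)] that(2) by (simp add: divide_le_eq)
    finally show ?thesis .
  qed
  have far: "q z = g z / (z - \<zeta>)" if "norm (z - \<zeta>) \<ge> d" for z
    unfolding q_def using that d by (simp add: min_def divide_simps)
  have qle: "norm (q z - a) \<le> norm (z - \<zeta>) / d * (\<kappa> * norm a)" if "norm (z - \<zeta>) \<le> d" for z
  proof (cases "z = \<zeta>")
    case True then show ?thesis using q\<zeta> by simp
  next
    case False
    have "min 1 (norm (z - \<zeta>) / d) = norm (z - \<zeta>) / d" using that d by (simp add: min_def divide_simps)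
    then have "norm (q z - a) = norm (z - \<zeta>) / d * norm (g z / (z - \<zeta>) - a)"
      unfolding q_def using d(1) by (simp add: norm_mult norm_divide)
    also have "\<dots> \<le> norm (z - \<zeta>) / d * (\<kappa> * norm a)"
      using near[OF that False] d by (intro mult_left_mono) auto
    finally show ?thesis .
  qed
  \<comment> \<open>In this ball the weight is at most 1 and the bracket at most \<kappa> |a|, so q
    stays in a disc around a that misses 0: the interpolation creates no new zero.\<close>
  have qnz: "q z \<noteq> 0" if "norm (z - \<zeta>) \<le> d" for z
  proof
    assume "q z = 0"
    then have "norm a \<le> norm (z - \<zeta>) / d * (\<kappa> * norm a)" using qle[OF that] by simp
    also have "\<dots> \<le> 1 * (\<kappa> * norm a)" using that d a by (intro mult_right_mono) auto
    also have "\<dots> < norm a" using a by simp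
    finally show False by simp
  qed
  have contq: "continuous_on (cball 0 r) q"
    unfolding continuous_on_eq_continuous_within
  proof
    fix x :: complex assume x: "x \<in> cball 0 r"
    show "continuous (at x within cball 0 r) q"
    proof (cases "x = \<zeta>")
      case False
      have "continuous (at x within cball 0 r) g"
        using insert.prems(2) x by (simp add: continuous_on_eq_continuous_within)
      then show ?thesis unfolding q_def using False d
        by (intro continuous_intros) auto
    next
      case True
      have "(q \<longlongrightarrow> a) (at \<zeta>)"
      proof (rule Lim_transform_bound[where f = "\<lambda>z. q z - a" and g = "\<lambda>z. norm (z - \<zeta>) / d * (\<kappa> * norm a)", THEN LIM_zero_cancel])
        have "\<forall>\<^sub>F z in nhds \<zeta>. z \<in> ball \<zeta> d" using d by (intro eventually_nhds_in_open) auto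
        then have "\<forall>\<^sub>F z in at \<zeta>. z \<in> ball \<zeta> d" unfolding eventually_at_filter by eventually_elim simp
        then show "\<forall>\<^sub>F z in at \<zeta>. norm (q z - a) \<le> norm (norm (z - \<zeta>) / d * (\<kappa> * norm a))"
        proof eventually_elim
          case (elim z)
          then have "norm (z - \<zeta>) \<le> d" by (simp add: dist_norm norm_minus_commute)
          then show ?case unfolding real_norm_def using order.trans[OF qle abs_ge_self] by blast
        qed
        have "((\<lambda>z. norm (z - \<zeta>) / d * (\<kappa> * norm a)) \<longlongrightarrow> norm (\<zeta> - \<zeta>) / d * (\<kappa> * norm a)) (at \<zeta>)"
          using d by (intro tendsto_intros) auto
        then show "((\<lambda>z. norm (z - \<zeta>) / d * (\<kappa> * norm a)) \<longlongrightarrow> 0) (at \<zeta>)" by simp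
      qed
      then have "isCont q \<zeta>" using q\<zeta> by (simp add: isCont_def)
      then show ?thesis using True continuous_at_imp_continuous_at_within by blast
    qed
  qed
  have zq: "{z \<in> cball 0 r. q z = 0} = Z"
  proof (intro set_eqI iffI)
    fix z assume "z \<in> {z \<in> cball 0 r. q z = 0}"
    then have z': "z \<in> cball 0 r" "q z = 0" by auto
    then have "norm (z - \<zeta>) > d" using qnz[of z] by fastforce
    then have "z \<noteq> \<zeta>" "g z = 0" using far[of z] z' d by auto
    then show "z \<in> Z" using z' insert.prems(4) by blast
  next
    fix z assume z': "z \<in> Z"
    then have "norm (z - \<zeta>) > d" using d(2)[of z] by fastforce
    moreover have "z \<in> cball 0 r \<and> g z = 0" using z' insert.prems(4) by blast
    ultimately show "z \<in> {z \<in> cball 0 r. q z = 0}" using far[of z] by simp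
  qed
  have sq: "simple_zero q w" if w: "w \<in> Z" for w
  proof -
    have wd: "norm (w - \<zeta>) > d" using d(2)[of w] w by fastforce
    then have w\<zeta>: "w \<noteq> \<zeta>" using d by auto
    have "simple_zero (\<lambda>z. (1 / (z - \<zeta>)) * g z) w"
      using w w\<zeta> by (intro simple_zero_mult insert.prems(5)) (auto intro!: continuous_intros)
    moreover have "\<forall>\<^sub>F z in nhds w. (1 / (z - \<zeta>)) * g z = q z"
    proof -
      have "open (- cball \<zeta> d)" by auto
      moreover have "w \<in> - cball \<zeta> d" using wd by (simp add: dist_norm norm_minus_commute)
      ultimately have "\<forall>\<^sub>F z in nhds w. z \<in> - cball \<zeta> d" by (rule eventually_nhds_in_open)
      then show ?thesis
      proof eventually_elim
        case (elim z)
        then show ?case using far[of z] by (simp add: dist_norm norm_minus_commute)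
      qed
    qed
    ultimately show ?thesis by (rule simple_zero_cong)
  qed
  have t1: "turns (\<lambda>t. q (circ r t)) (real (card Z))"
    by (rule insert.IH) (use r contq insert.prems zq sq in auto)
  have t2: "turns (\<lambda>t. circ r t - \<zeta>) 1"
  proof (rule turns_near[OF _ _ turns_circ])
    show "continuous_on {0..1} (\<lambda>t. circ r t - \<zeta>)" by (intro continuous_intros)
    show "circ r 0 - \<zeta> = circ r 1 - \<zeta>" by (simp only: circ_closed)
    show "norm (circ r t - \<zeta> - circ r t) < norm (circ r t)" for t using z r by simp
  qed (use r in \<open>auto intro: continuous_on_circ circ_closed\<close>)
  have "turns (\<lambda>t. (circ r t - \<zeta>) * q (circ r t)) (1 + real (card Z))"
    by (rule turns_mult[OF t2 t1])
  then have "turns (\<lambda>t. g (circ r t)) (1 + real (card Z))"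
  proof (rule turns_cong)
    fix t
    have "norm (circ r t - \<zeta>) > d"
    proof (rule ccontr)
      assume "\<not> norm (circ r t - \<zeta>) > d"
      then have "circ r t \<in> ball 0 r" using d(2)[of "circ r t"] by auto
      then show False using r by simp
    qed
    then show "(circ r t - \<zeta>) * q (circ r t) = g (circ r t)" using far[of "circ r t"] d by auto
  qed
  then show ?case using insert.hyps by simp
qed

subsection \<open>The gradient around a strict minimum\<close>

text \<open>Explicit Euler steps S along - X push the circle into a small ball without ever returning to
  the starting level of p; hence z - S z, i.e. the direction of X, is joined
  to z itself by a chain of linear homotopies.\<close>
lemma turns_gradient_minimum:
  fixes p :: "complex \<Rightarrow> real" and X :: "complex \<Rightarrow> complex"
  assumes r: "0 < r" "r < R"
    and der: "\<And>z. z \<in> cball 0 R \<Longrightarrow> (p has_derivative (\<lambda>h. X z \<bullet> h)) (at z)"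
    and X: "continuous_on (cball 0 R) X" "\<And>z. z \<in> cball 0 R \<Longrightarrow> z \<noteq> 0 \<Longrightarrow> X z \<noteq> 0"
    and p0: "p 0 = 0" and ppos: "\<And>z. z \<in> cball 0 R \<Longrightarrow> z \<noteq> 0 \<Longrightarrow> p z > 0"
    and lev: "\<And>z w. norm z = r \<Longrightarrow> norm w = R \<Longrightarrow> p z < p w"
  shows "turns (\<lambda>t. X (circ r t)) 1"
proof -
  have contp: "continuous_on (cball 0 R) p"
    using der by (meson continuous_at_imp_continuous_on has_derivative_continuous)
  have nn: "p z \<ge> 0" if "z \<in> cball 0 R" for z using ppos[OF that] p0 by (cases "z = 0") auto
  have rne: "of_real r \<in> sphere (0::complex) r" using r by simp
  have Rne: "of_real R \<in> sphere (0::complex) R" using r by simp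
  obtain zm where zm: "norm zm = r" "\<And>z. norm z = r \<Longrightarrow> p z \<le> p zm"
  proof -
    have "compact (sphere (0::complex) r)" "sphere (0::complex) r \<noteq> {}" using rne by auto
    moreover have "continuous_on (sphere 0 r) p" by (rule continuous_on_subset[OF contp]) (use r in auto)
    ultimately obtain x where "x \<in> sphere 0 r" "\<forall>y\<in>sphere 0 r. p y \<le> p x"
      using continuous_attains_sup by blast
    then show ?thesis using that[of x] by simp
  qed
  define m where "m = p zm"
  have levR: "m < p w" if "norm w = R" for w using lev[OF zm(1) that] unfolding m_def .
  define A where "A = {z :: complex. r \<le> norm z \<and> norm z \<le> R}"
  have A: "compact A" "A \<subseteq> cball 0 R" "of_real r \<in> A"
  proof -
    have "A = cball 0 R - ball 0 r" unfolding A_def by auto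
    then show "compact A" by (simp add: compact_diff)
    show "A \<subseteq> cball 0 R" "of_real r \<in> A" unfolding A_def using r by auto
  qed
  obtain za where za: "za \<in> A" "\<And>z. z \<in> A \<Longrightarrow> p za \<le> p z"
    using continuous_attains_inf[OF A(1) _ continuous_on_subset[OF contp A(2)]] A(3) by blast
  \<comment> \<open>A third of the minimum over the annulus leaves room for two thresholds: below
    \<eta> the gradient has no lower bound, but one step raises p by at most \<eta>, so the point
    stays below 2 \<eta>, a level never reached on the annulus.\<close>
  define \<eta> where "\<eta> = p za / 3"
  have \<eta>: "\<eta> > 0" "\<And>z. z \<in> A \<Longrightarrow> 2 * \<eta> < p z"
  proof -
    have "p za > 0" by (rule ppos) (use za A r in \<open>auto simp: A_def\<close>)
    then show "\<eta> > 0" unfolding \<eta>_def by simp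
    show "2 * \<eta> < p z" if "z \<in> A" for z using za(2)[OF that] \<open>p za > 0\<close> unfolding \<eta>_def by simp
  qed
  \<comment> \<open>All iterates remain in this sublevel set. It keeps a distance \<rho> from the
    outer circle, where p exceeds m, so short steps cannot leave the disc.\<close>
  define C where "C = {z \<in> cball 0 R. p z \<le> m}"
  have Ccomp: "compact C"
    unfolding C_def using continuous_closed_preimage[OF contp closed_cball, of "{..m}"]
    by (simp add: compact_eq_bounded_closed vimage_def Int_def bounded_subset[OF bounded_cball[of 0 R]] subset_iff)
  have zmC: "zm \<in> C" unfolding C_def m_def using zm r by simp
  obtain zc where zc: "zc \<in> C" "\<And>z. z \<in> C \<Longrightarrow> norm z \<le> norm zc"
    using continuous_attains_sup[OF Ccomp, of norm] zmC continuous_on_norm_id by (metis empty_iff)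
  define \<rho> where "\<rho> = R - norm zc"
  have \<rho>: "\<rho> > 0" "\<And>z. z \<in> C \<Longrightarrow> norm z \<le> R - \<rho>"
  proof -
    have "norm zc \<noteq> R" using levR[of zc] zc(1) unfolding C_def by auto
    then show "\<rho> > 0" using zc(1) unfolding \<rho>_def C_def by auto
    show "norm z \<le> R - \<rho>" if "z \<in> C" for z using zc(2)[OF that] unfolding \<rho>_def by simp
  qed
  define K where "K = {z \<in> cball 0 R. \<eta> \<le> p z}"
  have Kcomp: "compact K"
    unfolding K_def using continuous_closed_preimage[OF contp closed_cball, of "{\<eta>..}"]
    by (simp add: compact_eq_bounded_closed vimage_def Int_def bounded_subset[OF bounded_cball[of 0 R]] subset_iff)
  have KA: "A \<subseteq> K" using A(2) \<eta> unfolding K_def by force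
  have K0: "0 \<notin> K" using p0 \<eta> unfolding K_def by simp
  have contnX: "continuous_on (cball 0 R) (\<lambda>z. norm (X z))" using X(1) by (intro continuous_intros)
  obtain zk where zk: "zk \<in> K" "\<And>z. z \<in> K \<Longrightarrow> norm (X zk) \<le> norm (X z)"
    using continuous_attains_inf[OF Kcomp, of "\<lambda>z. norm (X z)"] KA A(3)
      continuous_on_subset[OF contnX, of K] unfolding K_def by blast
  define c where "c = norm (X zk)"
  have c: "c > 0" "\<And>z. z \<in> K \<Longrightarrow> c \<le> norm (X z)"
  proof -
    have "zk \<noteq> 0" using zk(1) K0 by blast
    then have "X zk \<noteq> 0" using X(2)[of zk] zk(1) unfolding K_def by simp
    then show "c > 0" unfolding c_def by simp
    show "c \<le> norm (X z)" if "z \<in> K" for z using zk(2)[OF that] unfolding c_def .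
  qed
  have "bounded (X ` cball 0 R)"
    by (rule compact_imp_bounded[OF compact_continuous_image[OF X(1) compact_cball]])
  then obtain B where B: "B > 0" "\<And>z. z \<in> cball 0 R \<Longrightarrow> norm (X z) \<le> B"
    unfolding bounded_pos by blast
  have "uniformly_continuous_on (cball 0 R) X" using X(1) by (intro compact_uniformly_continuous) auto
  moreover have "c\<^sup>2 / (2 * B) > 0" using c B by simp
  ultimately obtain \<delta> where \<delta>: "\<delta> > 0"
    "\<And>z w. z \<in> cball 0 R \<Longrightarrow> w \<in> cball 0 R \<Longrightarrow> dist w z < \<delta> \<Longrightarrow> dist (X w) (X z) < c\<^sup>2 / (2 * B)"
    unfolding uniformly_continuous_on_def by metis
  \<comment> \<open>One bound per danger: \<rho> / B keeps a step inside the disc; \<delta> / (2 B)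
    makes X vary so little along a step that on K the value of p falls at rate at least c^2 / 2;
    \<eta> / B^2 limits the rise of p outside K.\<close>
  define h where "h = min (\<rho> / B) (min (\<delta> / (2 * B)) (\<eta> / B\<^sup>2))"
  have h: "h > 0" unfolding h_def using \<rho> \<delta> \<eta> B by simp
  have hB: "h * B \<le> \<rho>" "h * B < \<delta>" "h * B\<^sup>2 \<le> \<eta>"
  proof -
    have "h \<le> \<rho> / B" "h \<le> \<delta> / (2 * B)" "h \<le> \<eta> / B\<^sup>2" unfolding h_def by auto
    then show "h * B \<le> \<rho>" "h * B < \<delta>" "h * B\<^sup>2 \<le> \<eta>"
      using B \<delta>(1) by (simp_all add: le_divide_eq)
  qed
  \<comment> \<open>Partial steps \<tau> \<le> h are included because the linear homotopies below
    run through them.\<close>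
  have step: "z - of_real \<tau> * X z \<in> cball 0 R \<and>
      p (z - of_real \<tau> * X z) - p z \<le> \<tau> * B\<^sup>2 \<and>
      (z \<in> K \<longrightarrow> p (z - of_real \<tau> * X z) - p z \<le> - (\<tau> * (c\<^sup>2 / 2)))"
    if z: "z \<in> C" and \<tau>: "0 \<le> \<tau>" "\<tau> \<le> h" for z \<tau>
  proof -
    have zR: "z \<in> cball 0 R" using z unfolding C_def by simp
    have near: "norm (of_real s * X z) \<le> h * B" if "0 \<le> s" "s \<le> \<tau>" for s
      using that \<tau> B(2)[OF zR] h by (auto simp: norm_mult intro!: mult_mono)
    have inR: "z - of_real s * X z \<in> cball 0 R" if s: "0 \<le> s" "s \<le> \<tau>" for s
    proof -
      have "norm (z - of_real s * X z) \<le> norm z + norm (of_real s * X z)" by (rule norm_triangle_ineq4)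
      also have "\<dots> \<le> (R - \<rho>) + h * B" using \<rho>(2)[OF z] near[OF s] by (rule add_mono)
      also have "\<dots> \<le> R" using hB(1) by simp
      finally show ?thesis by simp
    qed
    have *: "\<exists>s. 0 \<le> s \<and> s \<le> \<tau> \<and> p (z - of_real \<tau> * X z) - p z = \<tau> * - (X (z - of_real s * X z) \<bullet> X z)"
    proof (cases "\<tau> = 0")
      case True then show ?thesis by (intro exI[of _ 0]) simp
    next
      case False
      then have "0 < \<tau>" using \<tau> by simp
      then have "\<exists>s>0. s < \<tau> \<and> p (z - of_real \<tau> * X z) - p (z - of_real 0 * X z) =
          (\<tau> - 0) * - (X (z - of_real s * X z) \<bullet> X z)"
      proof (rule MVT2)
        fix s assume s: "0 \<le> s" "s \<le> \<tau>"
        have "((\<lambda>s. z - of_real s * X z) has_derivative (\<lambda>k. - (of_real k * X z))) (at s)"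
          by (auto intro!: derivative_eq_intros)
        from has_derivative_compose[OF this der[OF inR[OF s]]]
        have "((\<lambda>s. p (z - of_real s * X z)) has_derivative (\<lambda>k. X (z - of_real s * X z) \<bullet> - (of_real k * X z))) (at s)" .
        moreover have "(\<lambda>k. X (z - of_real s * X z) \<bullet> - (of_real k * X z)) = (*) (- (X (z - of_real s * X z) \<bullet> X z))"
          by (rule ext) (simp add: scaleR_conv_of_real[symmetric])
        ultimately show "((\<lambda>s. p (z - of_real s * X z)) has_real_derivative - (X (z - of_real s * X z) \<bullet> X z)) (at s)"
          unfolding has_field_derivative_def by (simp only:)
      qed
      then obtain s where "s > 0" "s < \<tau>" "p (z - of_real \<tau> * X z) - p (z - of_real 0 * X z) =
          (\<tau> - 0) * - (X (z - of_real s * X z) \<bullet> X z)" by blast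
      then show ?thesis by (intro exI[of _ s]) simp
    qed
    then obtain s where s: "0 \<le> s" "s \<le> \<tau>"
      and eq: "p (z - of_real \<tau> * X z) - p z = \<tau> * - (X (z - of_real s * X z) \<bullet> X z)" by blast
    let ?\<xi> = "z - of_real s * X z"
    have "\<bar>X ?\<xi> \<bullet> X z\<bar> \<le> norm (X ?\<xi>) * norm (X z)" by (rule Cauchy_Schwarz_ineq2)
    also have "\<dots> \<le> B * B" using B inR[OF s] zR by (intro mult_mono) auto
    finally have "- (X ?\<xi> \<bullet> X z) \<le> B\<^sup>2" by (simp add: power2_eq_square)
    then have b1: "p (z - of_real \<tau> * X z) - p z \<le> \<tau> * B\<^sup>2"
      unfolding eq using \<tau> by (intro mult_left_mono)
    have b2: "p (z - of_real \<tau> * X z) - p z \<le> - (\<tau> * (c\<^sup>2 / 2))" if "z \<in> K"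
    proof -
      have "dist ?\<xi> z = norm (of_real s * X z)" by (simp add: dist_norm)
      also have "\<dots> < \<delta>" using near[OF s] hB(2) by linarith
      finally have "norm (X ?\<xi> - X z) \<le> c\<^sup>2 / (2 * B)"
        using \<delta>(2)[OF zR inR[OF s]] by (simp add: dist_norm)
      then have "norm (X ?\<xi> - X z) * norm (X z) \<le> c\<^sup>2 / (2 * B) * B"
        using B(2)[OF zR] c B by (intro mult_mono) auto
      then have "\<bar>(X ?\<xi> - X z) \<bullet> X z\<bar> \<le> c\<^sup>2 / 2"
        using Cauchy_Schwarz_ineq2[of "X ?\<xi> - X z" "X z"] B by simp
      moreover have "X ?\<xi> \<bullet> X z = (X ?\<xi> - X z) \<bullet> X z + (norm (X z))\<^sup>2"
        by (simp add: inner_diff_left power2_norm_eq_inner)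
      moreover have "c\<^sup>2 \<le> (norm (X z))\<^sup>2" using c(2)[OF that] c(1) by (intro power_mono) auto
      ultimately have "- (X ?\<xi> \<bullet> X z) \<le> - (c\<^sup>2 / 2)" by linarith
      then have "\<tau> * - (X ?\<xi> \<bullet> X z) \<le> \<tau> * - (c\<^sup>2 / 2)" using \<tau> by (intro mult_left_mono)
      then show ?thesis unfolding eq by simp
    qed
    show ?thesis using inR[of \<tau>] \<tau> b1 b2 by simp
  qed
  define S where "S = (\<lambda>z. z - of_real h * X z)"
  define c2 where "c2 = c\<^sup>2 / 2"
  have c2: "c2 > 0" unfolding c2_def using c by simp
  have \<tau>B: "\<tau> * B\<^sup>2 \<le> \<eta>" if "\<tau> \<le> h" for \<tau>
    using mult_right_mono[OF that, of "B\<^sup>2"] hB(3) by simp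
  \<comment> \<open>Either each of the j steps has lowered p by \<open>h * c2\<close>, or the orbit
    is trapped below 2 \<eta>. The trap persists: on K the value decreases, and off K it starts
    below \<eta>.\<close>
  have inv: "(S ^^ j) z \<in> C \<and> (p ((S ^^ j) z) \<le> p z - real j * h * c2 \<or> p ((S ^^ j) z) < 2 * \<eta>)"
    if z: "norm z = r" for z j
  proof (induction j)
    case 0
    show ?case using zm(2)[OF z] z r unfolding C_def m_def by simp
  next
    case (Suc j)
    let ?w = "(S ^^ j) z"
    have pz: "2 * \<eta> < p z" "p z \<le> m"
      using \<eta>(2)[of z] zm(2)[OF z] z r unfolding A_def m_def by auto
    have w: "?w \<in> C" using Suc by blast
    have wR: "?w \<in> cball 0 R" using w unfolding C_def by simp
    have st: "S ?w \<in> cball 0 R" "p (S ?w) - p ?w \<le> h * B\<^sup>2" "?w \<in> K \<Longrightarrow> p (S ?w) - p ?w \<le> - (h * c2)"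
      using step[OF w, of h] h unfolding S_def c2_def by auto
    have hc: "h * c2 > 0" using h c2 by simp
    have "p (S ?w) \<le> p z - real (Suc j) * h * c2 \<or> p (S ?w) < 2 * \<eta>"
    proof (cases "?w \<in> K")
      case True
      then show ?thesis using st(3) Suc hc by (auto simp: algebra_simps)
    next
      case False
      then have "p ?w < \<eta>" using wR unfolding K_def by auto
      then show ?thesis using st(2) hB(3) by simp
    qed
    moreover have "real (Suc j) * h * c2 \<ge> 0" using h c2 by simp
    ultimately have "p (S ?w) \<le> m" using pz by linarith
    then show ?case using st(1) \<open>_ \<or> p (S ?w) < _\<close> unfolding C_def by simp
  qed
  \<comment> \<open>The case j = 0 must be excluded: with \<tau> = 0 the point would be z
    itself.\<close>
  have strict: "p ((S ^^ j) z - of_real \<tau> * X ((S ^^ j) z)) < p z"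
    if z: "norm z = r" and \<tau>: "0 \<le> \<tau>" "\<tau> \<le> h" and j: "j > 0" for z j \<tau>
  proof -
    let ?w = "(S ^^ j) z"
    have pz: "2 * \<eta> < p z" using \<eta>(2)[of z] z r unfolding A_def by auto
    have w: "?w \<in> C" using inv[OF z] by blast
    have wR: "?w \<in> cball 0 R" using w unfolding C_def by simp
    have jh: "real j * h * c2 > 0" using j h c2 by simp
    have \<tau>c: "\<tau> * c2 \<ge> 0" using \<tau> c2 by simp
    show ?thesis
    proof (cases "?w \<in> K")
      case True
      then have "p (?w - of_real \<tau> * X ?w) \<le> p ?w - \<tau> * c2"
        using step[OF w \<tau>] unfolding c2_def by auto
      then show ?thesis using inv[OF z, of j] jh \<tau>c pz by linarith
    next
      case False
      then have "p ?w < \<eta>" using wR unfolding K_def by auto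
      moreover have "p (?w - of_real \<tau> * X ?w) - p ?w \<le> \<tau> * B\<^sup>2" using step[OF w \<tau>] by blast
      ultimately show ?thesis using \<tau>B[OF \<tau>(2)] pz by linarith
    qed
  qed
  \<comment> \<open>After N steps steady descent would make p negative, so the orbit is trapped,
    hence off the annulus and inside the small disc.\<close>
  obtain N :: nat where N: "m < real N * (h * c2)"
    using reals_Archimedean3[of "h * c2"] h c2 by (metis mult_pos_pos)
  have N0: "N > 0"
  proof (rule ccontr)
    assume "\<not> N > 0"
    then have "m < 0" using N by simp
    then show False using nn[of zm] zmC unfolding m_def C_def by simp
  qed
  have final: "norm ((S ^^ N) z) < r" if z: "norm z = r" for z
  proof (rule ccontr)
    assume *: "\<not> norm ((S ^^ N) z) < r"
    have wR: "(S ^^ N) z \<in> cball 0 R" using inv[OF z, of N] unfolding C_def by blast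
    then have "(S ^^ N) z \<in> A" using * unfolding A_def by simp
    then have "2 * \<eta> < p ((S ^^ N) z)" by (rule \<eta>(2))
    then have "p ((S ^^ N) z) \<le> p z - real N * h * c2" using inv[OF z, of N] by linarith
    moreover have "p z \<le> m" using zm(2)[OF z] unfolding m_def .
    ultimately have "p ((S ^^ N) z) < 0" using N by (simp add: mult.assoc)
    then show False using nn[OF wR] by simp
  qed
  have contS: "continuous_on {0..1} (\<lambda>t. (S ^^ j) (circ r t))" for j
  proof (induction j)
    case 0 show ?case by (simp add: continuous_on_circ)
  next
    case (Suc j)
    have "continuous_on {0..1} (\<lambda>t. X ((S ^^ j) (circ r t)))"
    proof (rule continuous_on_compose2[OF X(1) Suc])
      show "(\<lambda>t. (S ^^ j) (circ r t)) ` {0..1} \<subseteq> cball 0 R"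
        using inv[of "circ r _" j] r unfolding C_def by auto
    qed
    then have "continuous_on {0..1} (\<lambda>t. (S ^^ j) (circ r t) - of_real h * X ((S ^^ j) (circ r t)))"
      using Suc by (intro continuous_intros)
    then show ?case by (simp add: S_def)
  qed
  \<comment> \<open>\<open>W 1\<close> is h X along the circle, and \<open>W N\<close> differs from
    the circle by less than r, so it turns once. Consecutive terms differ by h X at the j-th
    iterate.\<close>
  define W where "W = (\<lambda>j t. circ r t - (S ^^ j) (circ r t))"
  have contW: "continuous_on {0..1} (W j)" for j
    unfolding W_def by (intro continuous_intros contS continuous_on_circ)
  have Wcl: "W j 0 = W j 1" for j unfolding W_def by (simp only: circ_closed)
  have WN: "turns (W N) 1"
  proof (rule turns_near[OF contW Wcl turns_circ continuous_on_circ circ_closed])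
    show "norm (W N t - circ r t) < norm (circ r t)" for t
      unfolding W_def using final[of "circ r t"] r by simp
  qed (use r in simp)
  have "turns (W j) 1" if "j \<le> N" "1 \<le> j" for j
    using that
  proof (induction rule: inc_induct)
    case base show ?case by (rule WN)
  next
    case (step j)
    have IH: "turns (W (Suc j)) 1" using step by simp
    show ?case
    proof (rule turns_linear[OF contW Wcl IH contW Wcl])
      fix t :: real assume t: "t \<in> {0..1}"
      let ?z = "circ r t" and ?w = "(S ^^ j) (circ r t)"
      have nz: "W (Suc j) t \<noteq> 0" using turns_nonzero[OF IH t] .
      show "W j t / W (Suc j) t \<notin> \<real>\<^sub>\<le>\<^sub>0"
      proof
        assume "W j t / W (Suc j) t \<in> \<real>\<^sub>\<le>\<^sub>0"
        then obtain x where x: "x \<le> 0" "W j t / W (Suc j) t = of_real x"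
          by (auto elim!: nonpos_Reals_cases)
        \<comment> \<open>A zero on the segment between consecutive terms would place z at the
          partial step \<tau> = y h / (1 + y) \<le> h from its j-th iterate, contradicting
          \<open>strict\<close>.\<close>
        define y where "y = - x"
        have y: "y \<ge> 0" unfolding y_def using x by simp
        have "W j t = - of_real y * W (Suc j) t" using x(2) nz unfolding y_def by (simp add: field_simps)
        then have "?z - ?w + of_real y * (?z - ?w + of_real h * X ?w) = 0"
          unfolding W_def S_def by (simp add: algebra_simps)
        then have e: "(1 + of_real y) * (?z - ?w) = - of_real (y * h) * X ?w"
          by (simp add: algebra_simps)
        have y1: "(1 + complex_of_real y) \<noteq> 0" using y
          by (metis add_nonneg_eq_0_iff of_real_1 of_real_add of_real_eq_0_iff zero_le_one zero_neq_one)
        have "?z - ?w = - of_real (y * h) * X ?w / (1 + of_real y)" using e y1 by (simp add: field_simps)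
        then have "?z = ?w - of_real (y * h / (1 + y)) * X ?w" by (simp add: field_simps)
        moreover have "p (?w - of_real (y * h / (1 + y)) * X ?w) < p ?z"
        proof (rule strict)
          show "0 \<le> y * h / (1 + y)" using y h by simp
          show "y * h / (1 + y) \<le> h" using y h by (simp add: divide_le_eq algebra_simps)
        qed (use step r in auto)
        ultimately show False by simp
      qed
    qed
  qed
  from this[of 1] N0 have "turns (W 1) 1" by simp
  from turns_divide[OF this turns_const[of "of_real h"]] h
  have "turns (\<lambda>t. W 1 t / of_real h) 1" by simp
  then show ?thesis by (rule turns_cong) (use h in \<open>simp add: W_def S_def\<close>)
qed

subsection \<open>Planar maps with a Jacobian of constant sign\<close>

lemma finite_discrete_preimage:
  fixes g :: "complex \<Rightarrow> complex"
  assumes "compact A" "continuous_on A g" "\<And>z. z \<in> A \<Longrightarrow> g z = y \<Longrightarrow> simple_zero (\<lambda>z. g z - y) z"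
  shows "finite {z \<in> A. g z = y}"
proof -
  let ?B = "{z \<in> A. g z = y}"
  have "closed (A \<inter> g -` {y})"
    by (rule continuous_closed_preimage[OF assms(2) compact_imp_closed[OF assms(1)]]) simp
  then have "compact (A \<inter> (A \<inter> g -` {y}))" by (rule compact_Int_closed[OF assms(1)])
  moreover have "A \<inter> (A \<inter> g -` {y}) = ?B" by auto
  ultimately have "compact ?B" by simp
  then have "finite (?B \<inter> ?B)"
  proof (rule finite_not_islimpt_in_compact)
    fix z assume z: "z \<in> ?B"
    have "\<forall>\<^sub>F w in at z. g w - y \<noteq> 0" using z by (intro simple_zero_isolated assms(3)) auto
    then have "\<forall>\<^sub>F w in at z. w \<notin> ?B" by eventually_elim auto
    then show "\<not> z islimpt ?B" by (simp add: islimpt_iff_eventually)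
  qed
  then show ?thesis by simp
qed

section \<open>Orientation-preserving plane maps that may degenerate at one point\<close>

context
  fixes g a b :: "complex \<Rightarrow> complex" and R :: real
  assumes R: "R > 0" and cont: "continuous_on (cball 0 R) g" and g0: "g 0 = 0"
    and der: "\<And>z. z \<in> cball 0 R \<Longrightarrow> z \<noteq> 0 \<Longrightarrow> (g has_derivative (\<lambda>h. a z * h + b z * cnj h)) (at z)"
    and pos: "\<And>z. z \<in> cball 0 R \<Longrightarrow> z \<noteq> 0 \<Longrightarrow> norm (b z) < norm (a z)"
begin

lemma simple_preimage:
  assumes "z \<in> cball 0 R" "z \<noteq> 0" "g z = y"
  shows "simple_zero (\<lambda>z. g z - y) z"
proof (rule simple_zero_derivative)
  show "((\<lambda>z. g z - y) has_derivative (\<lambda>h. a z * h + b z * cnj h)) (at z)"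
    using der[OF assms(1,2)] by (auto intro!: derivative_eq_intros)
qed (use pos[OF assms(1,2)] assms in auto)

text \<open>The differential may degenerate at 0, so preimages of a nonzero y are counted instead of
  zeros of g. None of them is 0, each is simple, and on the circle y is too small to affect the
  number of turns.\<close>

lemma turns_card_preimages:
  assumes r: "0 < r" "r \<le> R" and y: "y \<noteq> 0" "\<And>z. norm z = r \<Longrightarrow> norm y < norm (g z)"
  shows "finite {z \<in> cball 0 r. g z = y}"
    and "turns (\<lambda>t. g (circ r t)) (real (card {z \<in> cball 0 r. g z = y}))"
proof -
  let ?Z = "{z \<in> cball 0 r. g z = y}"
  have cr: "continuous_on (cball 0 r) g" by (rule continuous_on_subset[OF cont]) (use r in auto)
  have sz: "simple_zero (\<lambda>z. g z - y) z" if "z \<in> cball 0 r" "g z = y" for z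
    by (rule simple_preimage) (use that r y g0 in auto)
  show fin: "finite ?Z" by (rule finite_discrete_preimage[OF compact_cball cr sz])
  have "turns (\<lambda>t. g (circ r t) - y) (real (card ?Z))"
  proof (rule turns_eq_card_zeros[OF fin r(1)])
    show "continuous_on (cball 0 r) (\<lambda>z. g z - y)" using cr by (intro continuous_intros)
    show "?Z \<subseteq> ball 0 r"
    proof
      fix z assume z: "z \<in> ?Z"
      then have "norm z \<noteq> r" using y(2)[of z] by auto
      then show "z \<in> ball 0 r" using z by simp
    qed
  qed (use sz in auto)
  moreover have c: "continuous_on {0..1} (\<lambda>t. g (circ r t))"
    by (rule continuous_on_circ_compose[OF cr _ r(1)]) simp
  ultimately show "turns (\<lambda>t. g (circ r t)) (real (card ?Z))"
  proof (rule_tac turns_linear)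
    show "g (circ r 0) = g (circ r 1)" "g (circ r 0) - y = g (circ r 1) - y" by (simp_all only: circ_closed)
    show "continuous_on {0..1} (\<lambda>t. g (circ r t) - y)" using c by (intro continuous_intros)
    fix t :: real
    have "norm (g (circ r t) - y - g (circ r t)) < norm (g (circ r t))" using y(2)[of "circ r t"] r by simp
    then have "Re ((g (circ r t) - y) / g (circ r t)) > 0" by (rule Re_divide_pos)
    then have "(g (circ r t) - y) / g (circ r t) \<notin> \<real>\<^sub>\<le>\<^sub>0" by (rule not_nonpos_RealsI_Re)
    then show "g (circ r t) / (g (circ r t) - y) \<notin> \<real>\<^sub>\<le>\<^sub>0"
      using nonpos_Reals_inverse_I[of "g (circ r t) / (g (circ r t) - y)"] by (metis inverse_divide)
  qed
qed

text \<open>All preimages of a small y \<noteq> 0 count with sign +1, and each nonzero zero of g has one of them nearby.\<close>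
lemma zero_isolated:
  obtains r where "0 < r" "r \<le> R" "\<And>z. z \<in> cball 0 r \<Longrightarrow> z \<noteq> 0 \<Longrightarrow> g z \<noteq> 0"
proof -
  define Zs where "Zs = {z \<in> cball 0 R. z \<noteq> 0 \<and> g z = 0}"
  \<comment> \<open>On each compact annulus the zeros are isolated, hence finitely many. Countably
    many zeros cannot occupy all radii, so some circle is free of them.\<close>
  have "countable Zs"
  proof -
    have "finite {z \<in> cball 0 R - ball 0 (1 / real (Suc k)). g z = 0}" for k
    proof (rule finite_discrete_preimage)
      show "compact (cball 0 R - ball (0::complex) (1 / real (Suc k)))" by (simp add: compact_diff)
      show "continuous_on (cball 0 R - ball 0 (1 / real (Suc k))) g"
        by (rule continuous_on_subset[OF cont]) auto
      fix z assume "z \<in> cball 0 R - ball 0 (1 / real (Suc k))" "g z = 0"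
      then show "simple_zero (\<lambda>z. g z - 0) z" by (intro simple_preimage) auto
    qed
    then have "countable (\<Union>k. {z \<in> cball 0 R - ball 0 (1 / real (Suc k)). g z = 0})"
      by (intro countable_UN) (auto intro: countable_finite)
    moreover have "Zs \<subseteq> (\<Union>k. {z \<in> cball 0 R - ball 0 (1 / real (Suc k)). g z = 0})"
    proof
      fix z assume z: "z \<in> Zs"
      then have "norm z > 0" unfolding Zs_def by simp
      then obtain k where "inverse (real (Suc k)) < norm z" using reals_Archimedean by blast
      then have "z \<in> {z \<in> cball 0 R - ball 0 (1 / real (Suc k)). g z = 0}"
        using z unfolding Zs_def by (simp add: inverse_eq_divide)
      then show "z \<in> (\<Union>k. {z \<in> cball 0 R - ball 0 (1 / real (Suc k)). g z = 0})" by blast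
    qed
    ultimately show ?thesis by (rule countable_subset[rotated])
  qed
  then have "countable (norm ` Zs)" by simp
  moreover have "uncountable {0<..<R}" using R by (simp add: uncountable_open_interval)
  ultimately obtain r where r: "r \<in> {0<..<R}" "r \<notin> norm ` Zs"
    by (metis countable_subset subsetI)
  have r0: "0 < r" "r < R" using r by auto
  have nz: "g z \<noteq> 0" if "norm z = r" for z
  proof
    assume "g z = 0"
    then have "z \<in> Zs" using that r0 unfolding Zs_def by auto
    then show False using r(2) that by blast
  qed
  have cr: "continuous_on (cball 0 r) g" by (rule continuous_on_subset[OF cont]) (use r in auto)
  have "continuous_on (sphere 0 r) (\<lambda>z. norm (g z))"
    by (intro continuous_intros continuous_on_subset[OF cr]) auto
  moreover have "of_real r \<in> sphere (0::complex) r" using r0 by simp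
  ultimately obtain zm where zm: "zm \<in> sphere 0 r" "\<And>z. z \<in> sphere 0 r \<Longrightarrow> norm (g zm) \<le> norm (g z)"
    using continuous_attains_inf[OF compact_sphere, of 0 r "\<lambda>z. norm (g z)"] by blast
  define \<mu> where "\<mu> = norm (g zm)"
  have \<mu>: "\<mu> > 0" "\<And>z. norm z = r \<Longrightarrow> \<mu> \<le> norm (g z)"
    unfolding \<mu>_def using zm nz by auto
  obtain n0 :: int where n0: "turns (\<lambda>t. g (circ r t)) n0"
  proof (rule turns_exists)
    show "continuous_on {0..1} (\<lambda>t. g (circ r t))"
      by (rule continuous_on_circ_compose[OF cr]) (use r0 in auto)
    show "g (circ r 0) = g (circ r 1)" by (simp only: circ_closed)
    show "g (circ r t) \<noteq> 0" for t using nz[of "circ r t"] r0 by simp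
  qed
  define Z where "Z = {z \<in> cball 0 r. z \<noteq> 0 \<and> g z = 0}"
  \<comment> \<open>The value y below depends on F, but its number of preimages is always n0, the
    turning number on the chosen circle. This gives a bound uniform in F.\<close>
  have bd: "card F \<le> nat n0" if F: "F \<subseteq> Z" "finite F" for F
  proof -
    \<comment> \<open>Open Voronoi cells of F with 0 as an additional site: they are pairwise
      disjoint, so preimages found in different cells are distinct.\<close>
    define T where "T = (\<lambda>\<zeta>. ball 0 r \<inter> (\<Inter>\<zeta>'\<in>insert 0 F - {\<zeta>}. {w. dist w \<zeta> < dist w \<zeta>'}))"
    have Topen: "open (T \<zeta>)" for \<zeta>
      unfolding T_def using F(2)
      by (intro open_Int open_INT ballI open_Collect_less continuous_intros) auto
    have Fin: "\<zeta> \<in> T \<zeta>" "norm \<zeta> < r" "\<zeta> \<noteq> 0" "g \<zeta> = 0" if "\<zeta> \<in> F" for \<zeta>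
    proof -
      have z: "\<zeta> \<in> Z" using F that by blast
      then show "\<zeta> \<noteq> 0" "g \<zeta> = 0" unfolding Z_def by auto
      have "norm \<zeta> \<noteq> r" using nz z unfolding Z_def by blast
      then show "norm \<zeta> < r" using z unfolding Z_def by simp
      then show "\<zeta> \<in> T \<zeta>" unfolding T_def by auto
    qed
    have int: "0 \<in> interior (g ` T \<zeta>)" if \<zeta>: "\<zeta> \<in> F" for \<zeta>
    proof -
      have zR: "\<zeta> \<in> cball 0 R" using Fin(2)[OF \<zeta>] r0 by simp
      let ?d = "(norm (a \<zeta>))\<^sup>2 - (norm (b \<zeta>))\<^sup>2"
      have d: "?d > 0" using pos[OF zR Fin(3)[OF \<zeta>]]
        by (simp add: power_strict_mono)
      \<comment> \<open>The open mapping theorem used here asks for a right inverse of the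
        differential at the one point \<zeta>. For h \<mapsto> a h + b cnj h it is h \<mapsto> (cnj
        a h - b cnj h) / (|a|^2 - |b|^2).\<close>
      have "g \<zeta> \<in> interior (g ` T \<zeta>)"
      proof (rule sussmann_open_mapping[OF Topen _ Fin(1)[OF \<zeta>] der[OF zR Fin(3)[OF \<zeta>]]])
        show "continuous_on (T \<zeta>) g"
          by (rule continuous_on_subset[OF cr]) (auto simp: T_def)
        show "bounded_linear (\<lambda>h. (cnj (a \<zeta>) * h - b \<zeta> * cnj h) / of_real ?d)"
          by (intro bounded_linear_intros bounded_linear_cnj bounded_linear_divide[THEN bounded_linear_compose]
               bounded_linear_sub bounded_linear_mult_right bounded_linear_const_mult)
        have n2: "a \<zeta> * cnj (a \<zeta>) - b \<zeta> * cnj (b \<zeta>) = of_real ?d"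
          by (simp add: complex_norm_square[symmetric])
        show "(\<lambda>h. a \<zeta> * h + b \<zeta> * cnj h) \<circ> (\<lambda>h. (cnj (a \<zeta>) * h - b \<zeta> * cnj h) / of_real ?d) = id"
        proof
          fix h
          have "((\<lambda>h. a \<zeta> * h + b \<zeta> * cnj h) \<circ> (\<lambda>h. (cnj (a \<zeta>) * h - b \<zeta> * cnj h) / of_real ?d)) h
            = ((a \<zeta> * cnj (a \<zeta>) - b \<zeta> * cnj (b \<zeta>)) * h) / of_real ?d"
            by (simp add: add_divide_distrib[symmetric] algebra_simps)
          also have "\<dots> = id h" unfolding n2 id_apply
            by (rule nonzero_mult_div_cancel_left) (use d in \<open>simp only: of_real_eq_0_iff\<close>)
          finally show "((\<lambda>h. a \<zeta> * h + b \<zeta> * cnj h) \<circ> (\<lambda>h. (cnj (a \<zeta>) * h - b \<zeta> * cnj h) / of_real ?d)) h = id h" .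
        qed
        show "\<zeta> \<in> interior (T \<zeta>)" using Fin(1)[OF \<zeta>] Topen by (simp add: interior_open)
      qed simp
      then show ?thesis using Fin(4)[OF \<zeta>] by simp
    qed
    have "open (ball 0 \<mu> \<inter> (\<Inter>\<zeta>\<in>F. interior (g ` T \<zeta>)))" using F(2) by (intro open_Int open_INT) auto
    moreover have "0 \<in> ball 0 \<mu> \<inter> (\<Inter>\<zeta>\<in>F. interior (g ` T \<zeta>))" using int \<mu> by auto
    ultimately obtain e where e: "e > 0" "ball 0 e \<subseteq> ball 0 \<mu> \<inter> (\<Inter>\<zeta>\<in>F. interior (g ` T \<zeta>))"
      by (meson openE)
    \<comment> \<open>A nonzero value so small that every cell attains it and that it lies below |g|
      on the circle.\<close>
    define y where "y = complex_of_real (e / 2)"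
    have y0: "y \<noteq> 0" unfolding y_def using e by simp
    have "y \<in> ball 0 e" unfolding y_def using e by simp
    then have y: "norm y < \<mu>" "\<And>\<zeta>. \<zeta> \<in> F \<Longrightarrow> y \<in> g ` T \<zeta>"
      using e(2) interior_subset by fastforce+
    have ysph: "norm y < norm (g z)" if "norm z = r" for z using y(1) \<mu>(2)[OF that] by simp
    note cnt = turns_card_preimages[OF r0(1) less_imp_le[OF r0(2)] y0 ysph]
    have "\<forall>\<zeta>\<in>F. \<exists>w. w \<in> T \<zeta> \<and> g w = y" using y(2) by blast
    then obtain f where f: "\<And>\<zeta>. \<zeta> \<in> F \<Longrightarrow> f \<zeta> \<in> T \<zeta> \<and> g (f \<zeta>) = y" by metis
    have "inj_on f F"
    proof (rule inj_onI, rule ccontr)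
      fix u v assume uv: "u \<in> F" "v \<in> F" "f u = f v" "u \<noteq> v"
      have "f u \<in> T u" "f u \<in> T v" using f[OF uv(1)] f[OF uv(2)] uv(3) by auto
      then have "dist (f u) u < dist (f u) v" "dist (f u) v < dist (f u) u"
        using uv unfolding T_def by blast+
      then show False by simp
    qed
    then have "card F = card (f ` F)" by (simp add: card_image)
    also have "\<dots> \<le> card {z \<in> cball 0 r. g z = y}"
    proof (rule card_mono[OF cnt(1)])
      show "f ` F \<subseteq> {z \<in> cball 0 r. g z = y}"
      proof
        fix x assume "x \<in> f ` F"
        then obtain u where u: "u \<in> F" "x = f u" by blast
        then have "x \<in> ball 0 r" "g x = y" using f[OF u(1)] unfolding T_def by auto
        then show "x \<in> {z \<in> cball 0 r. g z = y}" by simp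
      qed
    qed
    also have "\<dots> = nat n0" using turns_unique[OF n0 cnt(2)] by simp
    finally show ?thesis .
  qed
  then have "finite Z" using finite_if_finite_subsets_card_bdd[of Z "nat n0"] by blast
  then obtain d where d: "d > 0" "\<And>z. z \<in> Z \<Longrightarrow> z \<noteq> 0 \<Longrightarrow> d \<le> dist 0 z"
    using finite_set_avoid[of Z 0] by blast
  show ?thesis
  proof
    show "0 < min r (d / 2)" "min r (d / 2) \<le> R" using d r0 by auto
    fix z :: complex assume z: "z \<in> cball 0 (min r (d / 2))" "z \<noteq> 0"
    show "g z \<noteq> 0"
    proof
      assume "g z = 0"
      then have "z \<in> Z" using z unfolding Z_def by simp
      then have "d \<le> norm z" using d(2)[of z] z by simp
      then show False using z d by simp
    qed
  qed
qed

end

text \<open>On a small circle let n be the number of turns of g, so n \<ge> 1 by counting preimages, and let X be the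
  gradient of |g|^2 / 2, that is g cnj a + cnj g b, where the first term dominates. X turns once
  because 0 is a minimum of |g|^2, hence a turns n - 1 times.\<close>
lemma turns_derivative_nonneg:
  fixes g a b :: "complex \<Rightarrow> complex"
  assumes R: "R > 0" and g0: "g 0 = 0"
    and der: "\<And>z. z \<in> cball 0 R \<Longrightarrow> (g has_derivative (\<lambda>h. a z * h + b z * cnj h)) (at z)"
    and ca: "continuous_on (cball 0 R) a" and cb: "continuous_on (cball 0 R) b"
    and pos: "\<And>z. z \<in> cball 0 R \<Longrightarrow> z \<noteq> 0 \<Longrightarrow> norm (b z) < norm (a z)"
  obtains r n where "0 < r" "r < R" "turns (\<lambda>t. a (circ r t)) n" "n \<ge> 0"
proof -
  have cont: "continuous_on (cball 0 R) g"
    using der by (meson continuous_at_imp_continuous_on has_derivative_continuous)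
  obtain R1 where R1: "0 < R1" "R1 \<le> R" and nz: "\<And>z. z \<in> cball 0 R1 \<Longrightarrow> z \<noteq> 0 \<Longrightarrow> g z \<noteq> 0"
    using zero_isolated[OF R cont g0 der pos] by blast
  have c1: "continuous_on (cball 0 R1) g" by (rule continuous_on_subset[OF cont]) (use R1 in auto)
  have sphere_min: "\<exists>\<mu>>0. \<forall>z. norm z = s \<longrightarrow> \<mu> \<le> norm (g z)" if s: "0 < s" "s \<le> R1" for s
  proof -
    have "continuous_on (sphere 0 s) (\<lambda>z. norm (g z))"
      by (intro continuous_intros continuous_on_subset[OF c1]) (use s in auto)
    moreover have "of_real s \<in> sphere (0::complex) s" using s by simp
    ultimately obtain zm where zm: "zm \<in> sphere 0 s" "\<And>z. z \<in> sphere 0 s \<Longrightarrow> norm (g zm) \<le> norm (g z)"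
      using continuous_attains_inf[OF compact_sphere, of 0 s "\<lambda>z. norm (g z)"] by blast
    have "g zm \<noteq> 0" by (rule nz) (use zm s in auto)
    then show ?thesis using zm by (intro exI[of _ "norm (g zm)"]) auto
  qed
  have small: "\<exists>d>0. \<forall>z. norm z < d \<longrightarrow> norm (g z) < \<mu>" if \<mu>: "\<mu> > 0" for \<mu>
  proof -
    have "isCont g 0" using der[of 0] R by (auto intro: has_derivative_continuous)
    then obtain d where "d > 0" "\<forall>z. dist z 0 < d \<longrightarrow> dist (g z) (g 0) < \<mu>"
      using \<mu> unfolding continuous_at_eps_delta by metis
    then show ?thesis using g0 by auto
  qed
  obtain \<mu>1 where \<mu>1: "\<mu>1 > 0" "\<And>z. norm z = R1 \<Longrightarrow> \<mu>1 \<le> norm (g z)" using sphere_min[of R1] R1 by blast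
  obtain d1 where d1: "d1 > 0" "\<And>z. norm z < d1 \<Longrightarrow> norm (g z) < \<mu>1" using small[OF \<mu>1(1)] by blast
  \<comment> \<open>Inside radius d1 the values |g| are below their minimum on the circle of radius
    R1; this is the level condition of the gradient lemma.\<close>
  define r where "r = min d1 R1 / 2"
  have r: "0 < r" "r < R1" "r < d1" unfolding r_def using d1 R1 by auto
  have cr: "continuous_on (cball 0 r) g" by (rule continuous_on_subset[OF c1]) (use r in auto)
  obtain \<mu> where \<mu>: "\<mu> > 0" "\<And>z. norm z = r \<Longrightarrow> \<mu> \<le> norm (g z)" using sphere_min[of r] r by fastforce
  obtain d where d: "d > 0" "\<And>z. norm z < d \<Longrightarrow> norm (g z) < \<mu>" using small[OF \<mu>(1)] by blast
  define s where "s = min d r / 2"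
  have s: "0 < s" "s < d" "s < r" unfolding s_def using d r by auto
  \<comment> \<open>Taking y as a value of g guarantees a preimage, hence n \<ge> 1; s is small
    enough for y to be below |g| on the circle.\<close>
  define y where "y = g (of_real s)"
  have y0: "y \<noteq> 0" unfolding y_def by (rule nz) (use s r in auto)
  have y: "norm y < norm (g z)" if "norm z = r" for z
  proof -
    have "norm y < \<mu>" unfolding y_def using d(2)[of "of_real s"] s by simp
    then show ?thesis using \<mu>(2)[OF that] by simp
  qed
  have r1: "r \<le> R" using r R1 by simp
  note cnt = turns_card_preimages[OF R cont g0 der pos r(1) r1 y0 y]
  define n where "n = card {z \<in> cball 0 r. g z = y}"
  have tg: "turns (\<lambda>t. g (circ r t)) (real n)" unfolding n_def by (rule cnt(2))
  have "of_real s \<in> {z \<in> cball 0 r. g z = y}" unfolding y_def using s by simp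
  then have n: "n \<ge> 1" unfolding n_def using card_gt_0_iff[of "{z \<in> cball 0 r. g z = y}"] cnt(1) by fastforce
  have cA: "continuous_on {0..1} (\<lambda>t. a (circ r t))" "continuous_on {0..1} (\<lambda>t. g (circ r t))"
    by (rule continuous_on_circ_compose[OF ca] continuous_on_circ_compose[OF cont]; use r r1 in auto)+
  obtain k :: int where k: "turns (\<lambda>t. a (circ r t)) k"
  proof (rule turns_exists[OF cA(1)])
    show "a (circ r 0) = a (circ r 1)" by (simp only: circ_closed)
    fix t :: real
    have "norm (circ r t) = r" using r by simp
    then have "circ r t \<in> cball 0 R" "circ r t \<noteq> 0" using r r1 by auto
    then show "a (circ r t) \<noteq> 0" using pos[of "circ r t"] by auto
  qed
  define X where "X = (\<lambda>z. 2 * (g z * cnj (a z) + cnj (g z) * b z))"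
  have sub: "cball 0 R1 \<subseteq> cball (0::complex) R" using R1 by auto
  have "turns (\<lambda>t. X (circ r t)) 1"
  proof (rule turns_gradient_minimum[OF r(1) r(2), where p = "\<lambda>z. g z \<bullet> g z"])
    fix z :: complex assume z: "z \<in> cball 0 R1"
    have "((\<lambda>z. g z \<bullet> g z) has_derivative (\<lambda>h. g z \<bullet> (a z * h + b z * cnj h) + (a z * h + b z * cnj h) \<bullet> g z)) (at z)"
      using der[of z] z sub by (intro has_derivative_inner) auto
    moreover have "(\<lambda>h. g z \<bullet> (a z * h + b z * cnj h) + (a z * h + b z * cnj h) \<bullet> g z) = (\<lambda>h. X z \<bullet> h)"
      unfolding X_def inner_complex_def by (rule ext) (simp add: algebra_simps)
    ultimately show "((\<lambda>z. g z \<bullet> g z) has_derivative (\<lambda>h. X z \<bullet> h)) (at z)" by simp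
    assume z0: "z \<noteq> 0"
    show "g z \<bullet> g z > 0" using nz[OF z z0] by simp
    show "X z \<noteq> 0"
    proof
      assume "X z = 0"
      then have "g z * cnj (a z) = - (cnj (g z) * b z)" unfolding X_def by (simp add: add_eq_0_iff2)
      then have "norm (g z * cnj (a z)) = norm (cnj (g z) * b z)" by simp
      then have "norm (g z) * norm (a z) = norm (g z) * norm (b z)" by (simp only: norm_mult complex_mod_cnj)
      then show False using nz[OF z z0] pos[of z] z sub z0 by auto
    qed
  next
    show "continuous_on (cball 0 R1) X" unfolding X_def
      by (intro continuous_intros c1 continuous_on_subset[OF ca sub] continuous_on_subset[OF cb sub])
    fix z w :: complex assume zw: "norm z = r" "norm w = R1"
    have "norm (g z) < norm (g w)" using d1(2)[of z] \<mu>1(2)[OF zw(2)] zw r by simp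
    then have "(norm (g z))\<^sup>2 < (norm (g w))\<^sup>2" by (intro power_strict_mono) auto
    then show "g z \<bullet> g z < g w \<bullet> g w" by (simp only: power2_norm_eq_inner)
  qed (use g0 in auto)
  \<comment> \<open>The remaining term 2 cnj g b is shorter than 2 g cnj a, whose turning number is
    n - k because conjugation reverses the turns of a.\<close>
  moreover have "turns (\<lambda>t. X (circ r t)) (real n - k)"
  proof (rule turns_near)
    have "turns (\<lambda>t. 2 * (g (circ r t) * cnj (a (circ r t)))) (0 + (real n + (- real_of_int k)))"
      by (intro turns_mult turns_const tg turns_cnj[OF k]) simp
    then show "turns (\<lambda>t. 2 * (g (circ r t) * cnj (a (circ r t)))) (real n - k)" by simp
    show "continuous_on {0..1} (\<lambda>t. 2 * (g (circ r t) * cnj (a (circ r t))))"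
      by (intro continuous_intros cA)
    have "continuous_on (cball 0 R) X" unfolding X_def by (intro continuous_intros cont ca cb)
    then show "continuous_on {0..1} (\<lambda>t. X (circ r t))"
      by (rule continuous_on_circ_compose) (use r r1 in auto)
    fix t :: real
    have z: "circ r t \<in> cball 0 R1" "circ r t \<noteq> 0" "circ r t \<in> cball 0 R"
      using r r1 by auto
    have "norm (X (circ r t) - 2 * (g (circ r t) * cnj (a (circ r t)))) = 2 * (norm (g (circ r t)) * norm (b (circ r t)))"
      unfolding X_def by (simp add: norm_mult)
    also have "\<dots> < 2 * (norm (g (circ r t)) * norm (a (circ r t)))"
      using nz[OF z(1,2)] pos[OF z(3,2)] by simp
    also have "\<dots> = norm (2 * (g (circ r t) * cnj (a (circ r t))))" by (simp add: norm_mult)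
    finally show "norm (X (circ r t) - 2 * (g (circ r t) * cnj (a (circ r t)))) < norm (2 * (g (circ r t) * cnj (a (circ r t))))" .
  qed (simp_all only: circ_closed)
  ultimately have "1 = real n - k" by (rule turns_unique)
  then have "real_of_int k \<ge> 0" using n by simp
  show ?thesis by (rule that[OF r(1) _ k]) (use r R1 \<open>real_of_int k \<ge> 0\<close> in auto)
qed

text \<open>The expression \<open>Im (cnj (G z 1) * G z \<i>)\<close> is the Jacobian of g. After
  translation and conjugation of g it becomes |a|^2 - |b|^2 up to sign, with a and b the linear and
  antilinear coefficients. The conjugated first partial derivative is a + b, which turns like a
  because |b| < |a|.\<close>

lemma turns_derivative_nonpos:
  fixes g :: "complex \<Rightarrow> complex" and G :: "complex \<Rightarrow> complex \<Rightarrow> complex"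
  assumes R: "R > 0"
    and der: "\<And>z. z \<in> cball z0 R \<Longrightarrow> (g has_derivative G z) (at z)"
    and c1: "continuous_on (cball z0 R) (\<lambda>z. G z 1)" and c2: "continuous_on (cball z0 R) (\<lambda>z. G z \<i>)"
    and neg: "\<And>z. z \<in> cball z0 R \<Longrightarrow> z \<noteq> z0 \<Longrightarrow> Im (cnj (G z 1) * G z \<i>) < 0"
  obtains r n where "0 < r" "r < R" "turns (\<lambda>t. G (z0 + circ r t) 1) n" "n \<le> 0"
proof -
  define f where "f = (\<lambda>w. cnj (g (z0 + w) - g z0))"
  define a where "a = (\<lambda>w. (cnj (G (z0 + w) 1) - \<i> * cnj (G (z0 + w) \<i>)) / 2)"
  define b where "b = (\<lambda>w. (cnj (G (z0 + w) 1) + \<i> * cnj (G (z0 + w) \<i>)) / 2)"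
  have inR: "z0 + w \<in> cball z0 R" if "w \<in> cball 0 R" for w using that by (simp add: dist_norm)
  have ct: "continuous_on (cball 0 R) (\<lambda>w. z0 + w)" by (intro continuous_intros)
  have c1': "continuous_on (cball 0 R) (\<lambda>w. G (z0 + w) 1)"
    by (rule continuous_on_compose2[OF c1 ct]) (use inR in auto)
  have c2': "continuous_on (cball 0 R) (\<lambda>w. G (z0 + w) \<i>)"
    by (rule continuous_on_compose2[OF c2 ct]) (use inR in auto)
  have bz: "norm (b w) < norm (a w)" if "w \<in> cball 0 R" "w \<noteq> 0" for w
  proof -
    have "(norm (a w))\<^sup>2 - (norm (b w))\<^sup>2 = - Im (cnj (G (z0 + w) 1) * G (z0 + w) \<i>)"
      unfolding a_def b_def cmod_power2 by (simp add: power2_eq_square field_simps)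
    also have "\<dots> > 0" using neg[OF inR[OF that(1)]] that(2) by simp
    finally have "(norm (b w))\<^sup>2 < (norm (a w))\<^sup>2" by simp
    then show ?thesis by (rule power_less_imp_less_base) simp
  qed
  obtain r n where r: "0 < r" "r < R" "turns (\<lambda>t. a (circ r t)) n" "n \<ge> 0"
  proof (rule turns_derivative_nonneg[OF R, of f a b])
    show "f 0 = 0" unfolding f_def by simp
    fix w :: complex assume w: "w \<in> cball 0 R"
    interpret bounded_linear "G (z0 + w)"
      using der[OF inR[OF w]] by (rule has_derivative_bounded_linear)
    have "((\<lambda>w. z0 + w) has_derivative (\<lambda>h. h)) (at w)" by (auto intro!: derivative_eq_intros)
    from has_derivative_compose[OF this der[OF inR[OF w]]]
    have "(f has_derivative (\<lambda>h. cnj (G (z0 + w) h))) (at w)"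
      unfolding f_def by (auto intro!: derivative_eq_intros)
    moreover have "(\<lambda>h. cnj (G (z0 + w) h)) = (\<lambda>h. a w * h + b w * cnj h)"
    proof
      fix h
      have "h = Re h *\<^sub>R 1 + Im h *\<^sub>R \<i>" by (simp add: complex_eq_iff)
      then have "G (z0 + w) h = Re h *\<^sub>R G (z0 + w) 1 + Im h *\<^sub>R G (z0 + w) \<i>"
        by (metis add scaleR)
      then show "cnj (G (z0 + w) h) = a w * h + b w * cnj h"
        unfolding a_def b_def by (simp add: complex_eq_iff field_simps)
    qed
    ultimately show "(f has_derivative (\<lambda>h. a w * h + b w * cnj h)) (at w)" by simp
    assume "w \<noteq> 0" then show "norm (b w) < norm (a w)" using bz w by blast
  next
    show "continuous_on (cball 0 R) a" "continuous_on (cball 0 R) b"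
      unfolding a_def b_def by (intro continuous_intros c1' c2'; simp)+
  qed blast
  have ab: "cnj (G (z0 + w) 1) - a w = b w" for w unfolding a_def b_def by (simp add: field_simps)
  have ca: "continuous_on (cball 0 R) a" unfolding a_def by (intro continuous_intros c1' c2') simp
  have "turns (\<lambda>t. cnj (G (z0 + circ r t) 1)) n"
  proof (rule turns_near[OF _ _ r(3)])
    show "continuous_on {0..1} (\<lambda>t. cnj (G (z0 + circ r t) 1))"
      by (intro continuous_intros continuous_on_circ_compose[OF c1']) (use r in auto)
    show "continuous_on {0..1} (\<lambda>t. a (circ r t))"
      by (intro continuous_on_circ_compose[OF ca]) (use r in auto)
    fix t :: real
    have "circ r t \<in> cball 0 R" "circ r t \<noteq> 0"
      using r by auto
    then show "norm (cnj (G (z0 + circ r t) 1) - a (circ r t)) < norm (a (circ r t))"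
      unfolding ab by (rule bz)
  qed (simp_all only: circ_closed)
  from turns_cnj[OF this] have "turns (\<lambda>t. G (z0 + circ r t) 1) (- n)" by simp
  then show ?thesis using that r by simp
qed

subsection \<open>Second derivatives\<close>

lemma curve_increment_bound:
  fixes f f' :: "real \<Rightarrow> 'a::real_normed_vector"
  assumes "0 \<le> T" "\<And>x. x \<in> {0..T} \<Longrightarrow> (f has_vector_derivative f' x) (at x)"
    and "\<And>x. x \<in> {0..T} \<Longrightarrow> norm (f' x - c) \<le> B"
  shows "norm (f T - f 0 - T *\<^sub>R c) \<le> B * T"
proof (cases "T = 0")
  case True then show ?thesis by simp
next
  case False
  define g where "g = (\<lambda>x. f x - x *\<^sub>R c)"
  have gd: "(g has_vector_derivative f' x - c) (at x)" if "x \<in> {0..T}" for x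
    unfolding g_def using assms(2)[OF that] by (auto intro!: derivative_eq_intros)
  have "norm (g T - g 0) \<le> B * T - B * 0"
  proof (rule differentiable_bound_general[where \<phi> = "\<lambda>x. B * x" and \<phi>' = "\<lambda>x. B" and f' = "\<lambda>x. f' x - c"])
    show "0 < T" using False assms(1) by simp
    show "continuous_on {0..T} g"
      using gd by (meson continuous_at_imp_continuous_on has_vector_derivative_continuous)
    show "continuous_on {0..T} (\<lambda>x. B * x)" by (intro continuous_intros)
    fix x assume x: "0 < x" "x < T"
    show "(g has_vector_derivative f' x - c) (at x)" using gd x by simp
    show "((\<lambda>x. B * x) has_vector_derivative B) (at x)" by (auto intro!: derivative_eq_intros)
    show "norm (f' x - c) \<le> B" using assms(3) x by simp
  qed
  then show ?thesis unfolding g_def by (simp add: algebra_simps)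
qed

lemma has_vector_derivative_along:
  fixes f :: "complex \<Rightarrow> 'a::real_normed_vector"
  assumes "(f has_derivative F) (at (z + of_real t * w))"
  shows "((\<lambda>t. f (z + of_real t * w)) has_vector_derivative F w) (at t)"
proof -
  interpret bounded_linear F using assms by (rule has_derivative_bounded_linear)
  have "((\<lambda>t. z + of_real t * w) has_derivative (\<lambda>k. of_real k * w)) (at t)"
    by (auto intro!: derivative_eq_intros)
  from has_derivative_compose[OF this assms]
  have "((\<lambda>t. f (z + of_real t * w)) has_derivative (\<lambda>k. F (of_real k * w))) (at t)" .
  then show ?thesis
    unfolding has_vector_derivative_def by (simp add: scaleR_conv_of_real[symmetric] scaleR)
qed

lemma pd_eq:
  assumes "(f has_derivative F) (at z)"
  shows "pd f w z = F w"
  unfolding pd_def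
  by (rule vector_derivative_at, rule has_vector_derivative_along) (use assms in simp)

context
  fixes f :: "complex \<Rightarrow> 'a::real_normed_vector" and D :: "complex \<Rightarrow> complex \<Rightarrow>\<^sub>L 'a"
    and D2 :: "complex \<Rightarrow>\<^sub>L complex \<Rightarrow>\<^sub>L 'a" and V :: "complex set" and z :: complex
  assumes V: "open V" "z \<in> V"
    and D: "\<And>x. x \<in> V \<Longrightarrow> (f has_derivative blinfun_apply (D x)) (at x)"
    and D2: "(D has_derivative blinfun_apply D2) (at z)"
begin

lemma linearise_derivative:
  assumes "e > 0"
  obtains d where "d > 0" "\<And>k. norm k < d \<Longrightarrow> z + k \<in> V"
    "\<And>k h. norm k < d \<Longrightarrow> norm (D (z + k) h - D z h - D2 k h) \<le> e * norm k * norm h"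
proof -
  obtain d1 where d1: "d1 > 0" "ball z d1 \<subseteq> V" using V by (meson openE)
  obtain d2 where d2: "d2 > 0" "\<And>y. norm (y - z) < d2 \<Longrightarrow> norm (D y - D z - D2 (y - z)) \<le> e * norm (y - z)"
    using D2 assms unfolding has_derivative_at_alt by blast
  show ?thesis
  proof
    show "min d1 d2 > 0" using d1 d2 by simp
    fix k :: complex assume k: "norm k < min d1 d2"
    show "z + k \<in> V" using k d1 by (auto simp: subset_iff dist_norm)
    fix h
    have "norm (D (z + k) - D z - D2 k) \<le> e * norm k" using d2(2)[of "z + k"] k by simp
    have "D (z + k) h - D z h - D2 k h = (D (z + k) - D z - D2 k) h"
      by (simp add: blinfun.diff_left)
    also have "norm \<dots> \<le> norm (D (z + k) - D z - D2 k) * norm h" by (rule norm_blinfun)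
    also have "\<dots> \<le> e * norm k * norm h"
      using d2(2)[of "z + k"] k by (intro mult_right_mono) auto
    finally show "norm (D (z + k) h - D z h - D2 k h) \<le> e * norm k * norm h" .
  qed
qed

lemma second_order_taylor:
  assumes "e > 0"
  obtains d where "d > 0"
    "\<And>h. norm h < d \<Longrightarrow> norm (f (z + h) - f z - D z h - (1/2) *\<^sub>R D2 h h) \<le> e * (norm h)\<^sup>2"
proof -
  obtain d where d: "d > 0" "\<And>k. norm k < d \<Longrightarrow> z + k \<in> V"
    "\<And>k h. norm k < d \<Longrightarrow> norm (D (z + k) h - D z h - D2 k h) \<le> e * norm k * norm h"
    using linearise_derivative[OF assms] by blast
  have "norm (f (z + h) - f z - D z h - (1/2) *\<^sub>R D2 h h) \<le> e * (norm h)\<^sup>2" if h: "norm h < d" for h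
  proof -
    \<comment> \<open>Removing the quadratic term leaves a curve with velocity within e |h|^2 of the
      constant \<open>D z h\<close>; the factor 1/2 comes from integrating t.\<close>
    define r where "r = (\<lambda>t::real. f (z + of_real t * h) - (t\<^sup>2 / 2) *\<^sub>R D2 h h)"
    have "norm (r 1 - r 0 - 1 *\<^sub>R D z h) \<le> e * (norm h)\<^sup>2 * 1"
    proof (rule curve_increment_bound[where f' = "\<lambda>t. D (z + of_real t * h) h - t *\<^sub>R D2 h h"])
      fix t :: real assume t: "t \<in> {0..1}"
      have "norm (of_real t * h) \<le> norm h" using t by (simp add: norm_mult mult_left_le_one_le)
      then have th: "norm (of_real t * h) < d" using h by simp
      have "((\<lambda>t. f (z + of_real t * h)) has_vector_derivative D (z + of_real t * h) h) (at t)"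
        by (rule has_vector_derivative_along, rule D, rule d(2)[OF th])
      then show "(r has_vector_derivative D (z + of_real t * h) h - t *\<^sub>R D2 h h) (at t)"
        unfolding r_def by (auto intro!: derivative_eq_intros)
      have "t *\<^sub>R D2 h h = D2 (of_real t * h) h"
        by (simp add: scaleR_conv_of_real[symmetric] blinfun.scaleR_right blinfun.scaleR_left)
      then have "norm (D (z + of_real t * h) h - t *\<^sub>R D2 h h - D z h)
          = norm (D (z + of_real t * h) h - D z h - D2 (of_real t * h) h)"
        by (simp add: algebra_simps)
      also have "\<dots> \<le> e * norm (of_real t * h) * norm h" by (rule d(3)[OF th])
      also have "\<dots> \<le> e * norm h * norm h"
        using \<open>norm (of_real t * h) \<le> norm h\<close> assms by (intro mult_right_mono mult_left_mono) auto
      finally show "norm (D (z + of_real t * h) h - t *\<^sub>R D2 h h - D z h) \<le> e * (norm h)\<^sup>2"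
        by (simp add: power2_eq_square mult.assoc)
    qed simp
    then show ?thesis unfolding r_def by (simp add: algebra_simps)
  qed
  then show ?thesis using that d(1) by blast
qed

text \<open>D is differentiated only at z. Along the two parallel segments in direction u, a
  distance t v apart, the difference of velocities is nearly t \<open>D2 v u\<close>; both are
  compared with the linearisation at z.\<close>

lemma second_difference_bound:
  assumes "e > 0"
  obtains d where "d > 0"
    "\<And>t. 0 \<le> t \<Longrightarrow> t < d \<Longrightarrow> norm (f (z + of_real t * u + of_real t * v) - f (z + of_real t * u)
        - (f (z + of_real t * v) - f z) - t\<^sup>2 *\<^sub>R D2 v u) \<le> 2 * e * (norm u + norm v) * norm u * t\<^sup>2"
proof -
  obtain d0 where d0: "d0 > 0" "\<And>k. norm k < d0 \<Longrightarrow> z + k \<in> V"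
    "\<And>k h. norm k < d0 \<Longrightarrow> norm (D (z + k) h - D z h - D2 k h) \<le> e * norm k * norm h"
    using linearise_derivative[OF assms] by blast
  define c where "c = norm u + norm v"
  have c: "c \<ge> 0" unfolding c_def by simp
  \<comment> \<open>Adding 1 covers the case u = v = 0.\<close>
  define d where "d = d0 / (c + 1)"
  have d: "d > 0" unfolding d_def using d0 c by simp
  have main: "norm (f (z + of_real t * u + of_real t * v) - f (z + of_real t * u)
        - (f (z + of_real t * v) - f z) - t\<^sup>2 *\<^sub>R D2 v u) \<le> 2 * e * c * norm u * t\<^sup>2"
    if t: "0 \<le> t" "t < d" for t
  proof -
    define r where "r = (\<lambda>s::real. f (z + of_real t * v + of_real s * u) - f (z + of_real s * u))"
    have tc: "t * c < d0"
    proof -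
      have "t * c \<le> t * (c + 1)" using t by (simp add: mult_left_mono)
      also have "\<dots> < d * (c + 1)" using t c by (intro mult_strict_right_mono) auto
      also have "\<dots> = d0" unfolding d_def using c by simp
      finally show ?thesis .
    qed
    have "norm (r t - r 0 - t *\<^sub>R (t *\<^sub>R D2 v u)) \<le> (2 * e * (t * c) * norm u) * t"
    proof (rule curve_increment_bound[where f' = "\<lambda>s. D (z + of_real t * v + of_real s * u) u - D (z + of_real s * u) u"])
      fix s :: real assume s: "s \<in> {0..t}"
      have su: "norm (of_real s * u) \<le> t * norm u" using s by (simp add: norm_mult mult_right_mono)
      have tv: "norm (of_real t * v) = t * norm v" using t by (simp add: norm_mult)
      have n1: "norm (of_real s * u) \<le> t * c" using su t unfolding c_def by (simp add: distrib_left add_increasing2)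
      have n2: "norm (of_real t * v + of_real s * u) \<le> t * c"
        using norm_triangle_ineq[of "of_real t * v" "of_real s * u"] su tv unfolding c_def by (simp add: distrib_left)
      have m: "norm (of_real s * u) < d0" "norm (of_real t * v + of_real s * u) < d0" using n1 n2 tc by auto
      have "((\<lambda>s. f (z + of_real t * v + of_real s * u)) has_vector_derivative D (z + of_real t * v + of_real s * u) u) (at s)"
        using d0(2)[OF m(2)] by (intro has_vector_derivative_along D) (simp add: add.assoc)
      moreover have "((\<lambda>s. f (z + of_real s * u)) has_vector_derivative D (z + of_real s * u) u) (at s)"
        using d0(2)[OF m(1)] by (intro has_vector_derivative_along D)
      ultimately show "(r has_vector_derivative D (z + of_real t * v + of_real s * u) u - D (z + of_real s * u) u) (at s)"
        unfolding r_def by (rule has_vector_derivative_diff)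
      let ?k = "of_real t * v + of_real s * u" and ?l = "of_real s * u"
      have "D2 ?k u - D2 ?l u = t *\<^sub>R D2 v u"
        by (simp add: scaleR_conv_of_real[symmetric] blinfun.scaleR_right blinfun.scaleR_left blinfun.add_right blinfun.add_left)
      then have "D (z + of_real t * v + of_real s * u) u - D (z + of_real s * u) u - t *\<^sub>R D2 v u =
         (D (z + ?k) u - D z u - D2 ?k u) - (D (z + ?l) u - D z u - D2 ?l u)"
        by (simp add: algebra_simps)
      also have "norm \<dots> \<le> e * norm ?k * norm u + e * norm ?l * norm u"
        by (rule order.trans[OF norm_triangle_ineq4 add_mono]) (intro d0(3) m)+
      also have "\<dots> \<le> e * (t * c) * norm u + e * (t * c) * norm u"
        using n1 n2 assms by (intro add_mono mult_right_mono mult_left_mono) auto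
      also have "\<dots> = 2 * e * (t * c) * norm u" by simp
      finally show "norm (D (z + of_real t * v + of_real s * u) u - D (z + of_real s * u) u - t *\<^sub>R D2 v u) \<le> 2 * e * (t * c) * norm u" .
    qed (use t in simp)
    then show ?thesis unfolding r_def by (simp add: power2_eq_square algebra_simps)
  qed
  show ?thesis by (rule that[OF d main[unfolded c_def]])
qed

text \<open>The same second difference, symmetric in u and v, approximates both t^2
  \<open>D2 v u\<close> and t^2 \<open>D2 u v\<close>.\<close>

lemma second_derivative_symmetric: "D2 u v = D2 v u"
proof (rule ccontr)
  assume ne: "D2 u v \<noteq> D2 v u"
  define c where "c = norm u + norm v"
  have c: "c \<ge> 0" "norm u \<le> c" "norm v \<le> c" unfolding c_def by auto
  define \<delta> where "\<delta> = norm (D2 u v - D2 v u)"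
  have \<delta>: "\<delta> > 0" unfolding \<delta>_def using ne by simp
  \<comment> \<open>The two errors add up to 2 c^2 e t^2; this e makes 2 c^2 e smaller than
    \<delta>, and the added 1 covers c = 0.\<close>
  define e where "e = \<delta> / (4 * c\<^sup>2 + 1)"
  have c4: "4 * c\<^sup>2 + 1 > 0" using zero_le_power2[of c] by linarith
  have e: "e > 0" unfolding e_def by (rule divide_pos_pos[OF \<delta> c4])
  obtain d1 where d1: "d1 > 0" "\<And>t. 0 \<le> t \<Longrightarrow> t < d1 \<Longrightarrow> norm (f (z + of_real t * u + of_real t * v) - f (z + of_real t * u)
        - (f (z + of_real t * v) - f z) - t\<^sup>2 *\<^sub>R D2 v u) \<le> 2 * e * (norm u + norm v) * norm u * t\<^sup>2"
    by (rule second_difference_bound[OF e, of u v]) (rule that)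
  obtain d2 where d2: "d2 > 0" "\<And>t. 0 \<le> t \<Longrightarrow> t < d2 \<Longrightarrow> norm (f (z + of_real t * v + of_real t * u) - f (z + of_real t * v)
        - (f (z + of_real t * u) - f z) - t\<^sup>2 *\<^sub>R D2 u v) \<le> 2 * e * (norm v + norm u) * norm v * t\<^sup>2"
    by (rule second_difference_bound[OF e, of v u]) (rule that)
  define t where "t = min d1 d2 / 2"
  have t: "0 < t" "t < d1" "t < d2" unfolding t_def using d1 d2 by auto
  define \<Delta> where "\<Delta> = f (z + of_real t * u + of_real t * v) - f (z + of_real t * u) - (f (z + of_real t * v) - f z)"
  have A: "norm (\<Delta> - t\<^sup>2 *\<^sub>R D2 v u) \<le> 2 * e * c * norm u * t\<^sup>2"
    unfolding \<Delta>_def c_def by (rule d1(2)) (use t in auto)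
  have "f (z + of_real t * v + of_real t * u) - f (z + of_real t * v) - (f (z + of_real t * u) - f z) = \<Delta>"
    unfolding \<Delta>_def by (simp add: algebra_simps)
  then have B: "norm (\<Delta> - t\<^sup>2 *\<^sub>R D2 u v) \<le> 2 * e * c * norm v * t\<^sup>2"
    using d2(2)[of t] t unfolding c_def by (simp add: add.commute)
  have C: "t\<^sup>2 *\<^sub>R (D2 u v - D2 v u) = (\<Delta> - t\<^sup>2 *\<^sub>R D2 v u) - (\<Delta> - t\<^sup>2 *\<^sub>R D2 u v)"
    by (simp add: algebra_simps)
  have "norm (t\<^sup>2 *\<^sub>R (D2 u v - D2 v u)) \<le> 2 * e * c * norm u * t\<^sup>2 + 2 * e * c * norm v * t\<^sup>2"
    unfolding C by (rule order.trans[OF norm_triangle_ineq4 add_mono[OF A B]])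
  also have "\<dots> = 2 * e * c * c * t\<^sup>2" unfolding c_def by (simp add: algebra_simps)
  finally have "t\<^sup>2 * \<delta> \<le> t\<^sup>2 * (2 * e * c * c)" unfolding \<delta>_def by (simp add: mult_ac)
  then have "\<delta> \<le> 2 * e * c * c" using t by simp
  also have "\<dots> = 2 * c\<^sup>2 * e" by (simp add: power2_eq_square)
  also have "\<dots> < (4 * c\<^sup>2 + 1) * e"
  proof (rule mult_strict_right_mono[OF _ e])
    have "0 \<le> c\<^sup>2" by simp
    then show "2 * c\<^sup>2 < 4 * c\<^sup>2 + 1" by linarith
  qed
  also have "\<dots> = \<delta>"
    using c4 unfolding e_def by simp
  finally show False by simp
qed

end

subsection \<open>Charts and second order contact\<close>

definition tangent_map :: "(complex \<Rightarrow> real^3) \<Rightarrow> complex \<Rightarrow> complex \<Rightarrow> real^3" where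
  "tangent_map \<phi> z h = Re h *\<^sub>R phi_u \<phi> z + Im h *\<^sub>R phi_v \<phi> z"

text \<open>The second differential of \<phi>. Using \<open>phi_uv\<close> for both mixed terms is
  justified on a chart by \<open>second_derivative_symmetric\<close>.\<close>

definition hess :: "(complex \<Rightarrow> real^3) \<Rightarrow> complex \<Rightarrow> complex \<Rightarrow> complex \<Rightarrow> real^3" where
  "hess \<phi> z h k = (Re h * Re k) *\<^sub>R phi_uu \<phi> z + (Re h * Im k + Im h * Re k) *\<^sub>R phi_uv \<phi> z +
     (Im h * Im k) *\<^sub>R phi_vv \<phi> z"

lemma tangent_map_simps [simp]: "tangent_map \<phi> z 1 = phi_u \<phi> z" "tangent_map \<phi> z \<i> = phi_v \<phi> z"
  unfolding tangent_map_def by auto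

lemma hess_simps [simp]:
  "hess \<phi> z 1 1 = phi_uu \<phi> z" "hess \<phi> z 1 \<i> = phi_uv \<phi> z" "hess \<phi> z \<i> 1 = phi_uv \<phi> z" "hess \<phi> z \<i> \<i> = phi_vv \<phi> z"
  unfolding hess_def by auto

lemma tangent_map_add: "tangent_map \<phi> z (h + k) = tangent_map \<phi> z h + tangent_map \<phi> z k"
  and tangent_map_scaleR: "tangent_map \<phi> z (c *\<^sub>R h) = c *\<^sub>R tangent_map \<phi> z h"
  unfolding tangent_map_def by (simp_all add: algebra_simps)

lemma linear_tangent_map: "linear (tangent_map \<phi> z)"
  by (rule linearI) (rule tangent_map_add tangent_map_scaleR)+

lemma hess_polar: "hess \<phi> z (h + k) (h + k) = hess \<phi> z h h + 2 *\<^sub>R hess \<phi> z h k + hess \<phi> z k k"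
  unfolding hess_def by (simp add: algebra_simps vec_eq_iff)

lemma hess_scaleR: "hess \<phi> z (c *\<^sub>R h) (c *\<^sub>R h) = c\<^sup>2 *\<^sub>R hess \<phi> z h h"
  unfolding hess_def by (simp add: algebra_simps vec_eq_iff power2_eq_square)

context
  fixes M :: "(real^3) set" and V :: "complex set" and \<phi> :: "complex \<Rightarrow> real^3"
  assumes ch: "chart M V \<phi>"
begin

lemma chart_open: "open V"
  using ch unfolding chart_def by (elim conjE)

text \<open>Links the operator-valued derivatives, of which \<open>C2_on\<close> asserts only the
  existence, to the directional derivatives \<open>pd\<close> in which the fundamental forms are
  written.\<close>

lemma chart_derivatives:
  obtains D D2 where "\<And>z. z \<in> V \<Longrightarrow> (\<phi> has_derivative blinfun_apply (D z)) (at z)"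
    "\<And>z. z \<in> V \<Longrightarrow> (D has_derivative blinfun_apply (D2 z)) (at z)"
    "continuous_on V D2"
    "\<And>z h. z \<in> V \<Longrightarrow> blinfun_apply (D z) h = tangent_map \<phi> z h"
    "\<And>z h k. z \<in> V \<Longrightarrow> blinfun_apply (blinfun_apply (D2 z) h) k = hess \<phi> z h k"
proof -
  obtain D D2 where D: "\<And>z. z \<in> V \<Longrightarrow> (\<phi> has_derivative blinfun_apply (D z)) (at z)"
    and D2: "\<And>z. z \<in> V \<Longrightarrow> (D has_derivative blinfun_apply (D2 z)) (at z)" and c: "continuous_on V D2"
  proof -
    have "C2_on V \<phi>" using ch unfolding chart_def by (elim conjE)
    then show ?thesis unfolding C2_on_def by (elim exE conjE) (rule that; blast)
  qed
  have pd1: "pd \<phi> w z = D z w" if "z \<in> V" for z w by (rule pd_eq[OF D[OF that]])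
  have pdd: "pd (pd \<phi> w) v z = D2 z v w" if z: "z \<in> V" for z v w
  proof (rule pd_eq)
    have "((\<lambda>x. D x w) has_derivative (\<lambda>h. D2 z h w)) (at z)"
      by (rule has_derivative_eq_rhs[OF blinfun.FDERIV[OF D2[OF z] has_derivative_const]]) simp
    then show "(pd \<phi> w has_derivative (\<lambda>h. D2 z h w)) (at z)"
      by (rule has_derivative_transform_within_open[OF _ chart_open z]) (simp add: pd1)
  qed
  have c2: "h = Re h *\<^sub>R 1 + Im h *\<^sub>R \<i>" for h by (simp add: complex_eq_iff)
  have e1: "blinfun_apply (D z) h = tangent_map \<phi> z h" if z: "z \<in> V" for z h
  proof -
    have "blinfun_apply (D z) h = D z (Re h *\<^sub>R 1 + Im h *\<^sub>R \<i>)"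
      by (rule arg_cong[where f = "blinfun_apply (D z)", OF c2])
    also have "\<dots> = tangent_map \<phi> z h"
      unfolding tangent_map_def phi_u_def phi_v_def pd1[OF z] by (simp only: blinfun.add_right blinfun.scaleR_right)
    finally show ?thesis .
  qed
  have e2: "blinfun_apply (blinfun_apply (D2 z) h) k = hess \<phi> z h k" if z: "z \<in> V" for z h k
  proof -
    have sym: "D2 z 1 \<i> = D2 z \<i> 1"
      by (rule second_derivative_symmetric[OF chart_open z D D2[OF z]])
    have "blinfun_apply (blinfun_apply (D2 z) h) k = D2 z (Re h *\<^sub>R 1 + Im h *\<^sub>R \<i>) (Re k *\<^sub>R 1 + Im k *\<^sub>R \<i>)"
      by (rule arg_cong2[where f = "\<lambda>h k. blinfun_apply (blinfun_apply (D2 z) h) k", OF c2 c2])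
    also have "\<dots> = hess \<phi> z h k"
      unfolding hess_def phi_uu_def phi_uv_def phi_vv_def pdd[OF z]
      by (simp only: blinfun.add_right blinfun.scaleR_right blinfun.add_left blinfun.scaleR_left sym)
         (simp add: algebra_simps)
    finally show ?thesis .
  qed
  show ?thesis by (rule that[OF D D2 c e1 e2])
qed

lemma chart_has_derivative:
  assumes "z \<in> V"
  shows "(\<phi> has_derivative tangent_map \<phi> z) (at z)"
proof (rule chart_derivatives)
  fix D D2 assume "\<And>z. z \<in> V \<Longrightarrow> (\<phi> has_derivative blinfun_apply (D z)) (at z)"
    "\<And>z h. z \<in> V \<Longrightarrow> blinfun_apply (D z) h = tangent_map \<phi> z h"
  then show ?thesis using assms by (metis ext)
qed

lemma chart_taylor:
  assumes "z \<in> V" "e > 0"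
  obtains d where "d > 0"
    "\<And>h. norm h < d \<Longrightarrow> norm (\<phi> (z + h) - \<phi> z - tangent_map \<phi> z h - (1/2) *\<^sub>R hess \<phi> z h h) \<le> e * (norm h)\<^sup>2"
proof -
  obtain D D2 where D: "\<And>z. z \<in> V \<Longrightarrow> (\<phi> has_derivative blinfun_apply (D z)) (at z)"
    "\<And>z. z \<in> V \<Longrightarrow> (D has_derivative blinfun_apply (D2 z)) (at z)"
    "\<And>z h. z \<in> V \<Longrightarrow> blinfun_apply (D z) h = tangent_map \<phi> z h"
    "\<And>z h k. z \<in> V \<Longrightarrow> blinfun_apply (blinfun_apply (D2 z) h) k = hess \<phi> z h k"
    by (rule chart_derivatives) (rule that)
  show ?thesis
  proof (rule second_order_taylor[OF chart_open assms(1) D(1) D(2)[OF assms(1)] assms(2)])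
    fix d assume "d > 0" "\<And>h. norm h < d \<Longrightarrow>
      norm (\<phi> (z + h) - \<phi> z - D z h - (1/2) *\<^sub>R D2 z h h) \<le> e * (norm h)\<^sup>2"
    then show thesis using that[of d] D(3,4)[OF assms(1)] by simp
  qed
qed

lemma phi_uv_has_derivative:
  assumes "z \<in> V"
  shows "(phi_u \<phi> has_derivative (\<lambda>h. hess \<phi> z h 1)) (at z)"
    and "(phi_v \<phi> has_derivative (\<lambda>h. hess \<phi> z h \<i>)) (at z)"
proof -
  obtain D D2 where D: "\<And>z. z \<in> V \<Longrightarrow> (D has_derivative blinfun_apply (D2 z)) (at z)"
    "\<And>z h. z \<in> V \<Longrightarrow> blinfun_apply (D z) h = tangent_map \<phi> z h"
    "\<And>z h k. z \<in> V \<Longrightarrow> blinfun_apply (blinfun_apply (D2 z) h) k = hess \<phi> z h k"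
    by (rule chart_derivatives) (rule that)
  have *: "((\<lambda>x. tangent_map \<phi> x w) has_derivative (\<lambda>h. hess \<phi> z h w)) (at z)" for w
  proof (rule has_derivative_transform_within_open[OF _ chart_open assms])
    have "((\<lambda>x. D x w) has_derivative (\<lambda>h. D2 z h w)) (at z)"
      by (rule has_derivative_eq_rhs[OF blinfun.FDERIV[OF D(1)[OF assms] has_derivative_const]]) simp
    then show "((\<lambda>x. D x w) has_derivative (\<lambda>h. hess \<phi> z h w)) (at z)" using D(3)[OF assms] by simp
  qed (rule D(2))
  show "(phi_u \<phi> has_derivative (\<lambda>h. hess \<phi> z h 1)) (at z)" using *[of 1] by simp
  show "(phi_v \<phi> has_derivative (\<lambda>h. hess \<phi> z h \<i>)) (at z)" using *[of \<i>] by simp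
qed

lemma continuous_on_chart:
  "continuous_on V \<phi>" "continuous_on V (phi_u \<phi>)" "continuous_on V (phi_v \<phi>)"
  "continuous_on V (phi_uu \<phi>)" "continuous_on V (phi_uv \<phi>)" "continuous_on V (phi_vv \<phi>)"
proof -
  show "continuous_on V \<phi>" "continuous_on V (phi_u \<phi>)" "continuous_on V (phi_v \<phi>)"
    using chart_has_derivative phi_uv_has_derivative
    by (meson continuous_at_imp_continuous_on has_derivative_continuous)+
  obtain D2 :: "complex \<Rightarrow> complex \<Rightarrow>\<^sub>L complex \<Rightarrow>\<^sub>L (real^3)" where c: "continuous_on V D2"
    and e: "\<And>z h k. z \<in> V \<Longrightarrow> blinfun_apply (blinfun_apply (D2 z) h) k = hess \<phi> z h k"
    by (rule chart_derivatives) (rule that)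
  have "continuous_on V (\<lambda>z. hess \<phi> z h k)" for h k
  proof (rule continuous_on_eq)
    show "continuous_on V (\<lambda>z. blinfun_apply (blinfun_apply (D2 z) h) k)"
      using c by (intro continuous_intros)
  qed (rule e)
  from this[of 1 1] this[of 1 \<i>] this[of \<i> \<i>]
  show "continuous_on V (phi_uu \<phi>)" "continuous_on V (phi_uv \<phi>)" "continuous_on V (phi_vv \<phi>)" by simp_all
qed

lemma chart_cross_nz: "z \<in> V \<Longrightarrow> cross3 (phi_u \<phi> z) (phi_v \<phi> z) \<noteq> 0"
  using ch unfolding chart_def by (elim conjE) (rule bspec)

lemma inj_tangent_map:
  assumes "z \<in> V" shows "inj (tangent_map \<phi> z)"
proof -
  have "h = 0" if "tangent_map \<phi> z h = 0" for h
  proof -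
    let ?m = "cross3 (phi_u \<phi> z) (phi_v \<phi> z)"
    have "cross3 (tangent_map \<phi> z h) (phi_v \<phi> z) = Re h *\<^sub>R ?m"
      unfolding tangent_map_def by (simp add: cross_add_left cross_mult_left)
    moreover have "cross3 (phi_u \<phi> z) (tangent_map \<phi> z h) = Im h *\<^sub>R ?m"
      unfolding tangent_map_def by (simp add: cross_add_right cross_mult_right)
    ultimately have "Re h *\<^sub>R ?m = 0" "Im h *\<^sub>R ?m = 0" using that by simp_all
    then show ?thesis using chart_cross_nz[OF assms] by (simp add: complex_eq_iff)
  qed
  then show ?thesis using linear_injective_0[OF linear_tangent_map] by blast
qed

text \<open>A quantitative immersion property: it bounds displacements in the parameter plane by
  displacements in space.\<close>

lemma tangent_map_bounded_below:
  assumes "z \<in> V" obtains c where "c > 0" "\<And>h. c * norm h \<le> norm (tangent_map \<phi> z h)"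
  using linear_inj_bounded_below_pos[OF linear_tangent_map inj_tangent_map[OF assms]] by metis

end

text \<open>A vector orthogonal to the tangent plane sees only the second order contact with the plane,
  which can be read off in either chart along the curve x t; the chart change need not be differentiated.\<close>
lemma second_form_transfer:
  assumes \<phi>: "chart M V \<phi>" "z \<in> V" and \<psi>: "chart M W \<psi>" "y \<in> W" and p: "\<phi> z = \<psi> y"
    and n: "n \<bullet> phi_u \<phi> z = 0" "n \<bullet> phi_v \<phi> z = 0"
  obtains \<zeta> where "tangent_map \<psi> y \<omega> = tangent_map \<phi> z \<zeta>" "n \<bullet> hess \<psi> y \<omega> \<omega> = n \<bullet> hess \<phi> z \<zeta> \<zeta>"
proof -
  obtain c where c: "c > 0" "\<And>h. c * norm h \<le> norm (tangent_map \<phi> z h)"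
    using tangent_map_bounded_below[OF \<phi>] by metis
  define x where "x = (\<lambda>t::real. \<psi> (y + of_real t * \<omega>))"
  \<comment> \<open>The curve x read in the chart \<phi>, as a displacement from z. The
    homeomorphism property gives only that it tends to 0.\<close>
  define s where "s = (\<lambda>t. inv_into V \<phi> (x t) - z)"
  let ?F = "at_right (0::real)"
  have nd1: "n \<bullet> tangent_map \<phi> z h = 0" for h unfolding tangent_map_def using n by (simp add: inner_add_right)
  have xd: "(x has_vector_derivative tangent_map \<psi> y \<omega>) (at 0)"
    unfolding x_def by (rule has_vector_derivative_along) (use chart_has_derivative[OF \<psi>] in simp)
  have x0: "x 0 = \<phi> z" unfolding x_def using p by simp
  have xlim: "(x \<longlongrightarrow> \<phi> z) ?F"
    using has_vector_derivative_continuous[OF xd] x0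
    by (metis continuous_at filterlim_at_split isCont_def)
  have to0: "((\<lambda>t. t) \<longlongrightarrow> (0::real)) ?F" by (rule tendsto_ident_at)
  have tpos: "\<forall>\<^sub>F t in ?F. t > 0" by (simp add: eventually_at_right_less)
  obtain O' where O': "open O'" "\<phi> ` V = M \<inter> O'"
    using \<phi>(1) unfolding chart_def openin_open by blast
  have zO: "\<phi> z \<in> O'" using O' \<phi>(2) by blast
  have evO: "\<forall>\<^sub>F t in ?F. x t \<in> O'" using topological_tendstoD[OF xlim O'(1) zO] .
  have "((\<lambda>t. y + of_real t * \<omega>) \<longlongrightarrow> y + of_real 0 * \<omega>) ?F" by (intro tendsto_intros to0)
  then have "((\<lambda>t. y + of_real t * \<omega>) \<longlongrightarrow> y) ?F" by simp
  then have "\<forall>\<^sub>F t in ?F. y + of_real t * \<omega> \<in> W"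
    using topological_tendstoD chart_open[OF \<psi>(1)] \<psi>(2) by blast
  then have evM: "\<forall>\<^sub>F t in ?F. x t \<in> M"
    by eventually_elim (use \<psi>(1) in \<open>auto simp: chart_def x_def\<close>)
  have evV: "\<forall>\<^sub>F t in ?F. x t \<in> \<phi> ` V" using evO evM by eventually_elim (use O' in blast)
  have inv: "continuous_on (\<phi> ` V) (inv_into V \<phi>)" "inv_into V \<phi> (\<phi> z) = z"
    using \<phi> unfolding chart_def homeomorphism_def by auto
  have "((\<lambda>t. inv_into V \<phi> (x t)) \<longlongrightarrow> inv_into V \<phi> (\<phi> z)) ?F"
    by (rule continuous_on_tendsto_compose[OF inv(1) xlim _ evV]) (use \<phi>(2) in blast)
  then have slim: "(s \<longlongrightarrow> 0) ?F" unfolding s_def inv(2) by (simp add: LIM_zero)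
  have phis: "\<forall>\<^sub>F t in ?F. \<phi> (z + s t) = x t"
    using evV by eventually_elim (simp add: s_def f_inv_into_f)
  have quot: "((\<lambda>t. (1 / t) *\<^sub>R (x t - \<phi> z)) \<longlongrightarrow> tangent_map \<psi> y \<omega>) ?F"
  proof (rule tendstoI)
    fix e :: real assume e: "e > 0"
    then have e2: "e / 2 > 0" by simp
    obtain d where d: "d > 0" "\<And>t. norm (t - 0) < d \<Longrightarrow> norm (x t - x 0 - (t - 0) *\<^sub>R tangent_map \<psi> y \<omega>) \<le> e / 2 * norm (t - 0)"
      using xd e2 unfolding has_vector_derivative_def has_derivative_at_alt by blast
    have "\<forall>\<^sub>F t in ?F. t < d" using order_tendstoD(2)[OF to0 d(1)] .
    then show "\<forall>\<^sub>F t in ?F. dist ((1 / t) *\<^sub>R (x t - \<phi> z)) (tangent_map \<psi> y \<omega>) < e"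
      using tpos
    proof eventually_elim
      case (elim t)
      have "(1 / t) *\<^sub>R (x t - \<phi> z) - tangent_map \<psi> y \<omega> = (1 / t) *\<^sub>R (x t - \<phi> z - t *\<^sub>R tangent_map \<psi> y \<omega>)"
        using elim by (simp add: algebra_simps)
      then have "norm ((1 / t) *\<^sub>R (x t - \<phi> z) - tangent_map \<psi> y \<omega>) = (1 / t) * norm (x t - \<phi> z - t *\<^sub>R tangent_map \<psi> y \<omega>)"
        using elim by simp
      also have "\<dots> \<le> (1 / t) * (e / 2 * t)"
        using d(2)[of t] elim unfolding x0 by (intro mult_left_mono) auto
      also have "\<dots> < e" using elim e by simp
      finally show ?case by (simp add: dist_norm)
    qed
  qed
  have first: "\<forall>\<^sub>F t in ?F. norm (x t - \<phi> z - tangent_map \<phi> z (s t)) \<le> e * norm (s t)" if "e > 0" for e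
  proof -
    obtain d where d: "d > 0" "\<And>w. norm (w - z) < d \<Longrightarrow> norm (\<phi> w - \<phi> z - tangent_map \<phi> z (w - z)) \<le> e * norm (w - z)"
      using chart_has_derivative[OF \<phi>] \<open>e > 0\<close> unfolding has_derivative_at_alt by blast
    have "\<forall>\<^sub>F t in ?F. dist (s t) 0 < d" using tendstoD[OF slim d(1)] .
    then show ?thesis using phis
    proof eventually_elim
      case (elim t)
      then show ?case using d(2)[of "z + s t"] by simp
    qed
  qed
  \<comment> \<open>The immersion bound c |s| \<le> |d\<phi>(s)| together with a first-order error
    of at most (c / 2) |s|, absorbed on the left, makes s at most linear in t.\<close>
  obtain K where K: "\<forall>\<^sub>F t in ?F. norm (s t) \<le> K * t" "K > 0"
  proof -
    have "\<forall>\<^sub>F t in ?F. norm ((1 / t) *\<^sub>R (x t - \<phi> z)) < norm (tangent_map \<psi> y \<omega>) + 1"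
      using order_tendstoD(2)[OF tendsto_norm[OF quot]] by simp
    then have "\<forall>\<^sub>F t in ?F. norm (s t) \<le> (2 / c * (norm (tangent_map \<psi> y \<omega>) + 1)) * t"
      using first[OF half_gt_zero[OF c(1)]] tpos
    proof eventually_elim
      case (elim t)
      have "c * norm (s t) \<le> norm (tangent_map \<phi> z (s t))" by (rule c(2))
      also have "\<dots> \<le> norm (x t - \<phi> z) + norm (x t - \<phi> z - tangent_map \<phi> z (s t))"
        by (metis norm_triangle_sub norm_minus_commute)
      also have "\<dots> \<le> norm (x t - \<phi> z) + c / 2 * norm (s t)" using elim by simp
      finally have "norm (s t) \<le> 2 / c * norm (x t - \<phi> z)" using c(1) by (simp add: field_simps)
      also have "\<dots> \<le> 2 / c * ((norm (tangent_map \<psi> y \<omega>) + 1) * t)"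
      proof (rule mult_left_mono)
        have "norm ((1 / t) *\<^sub>R (x t - \<phi> z)) = norm (x t - \<phi> z) / t" using elim(3) by simp
        then have "norm (x t - \<phi> z) / t \<le> norm (tangent_map \<psi> y \<omega>) + 1" using elim(1) by linarith
        then show "norm (x t - \<phi> z) \<le> (norm (tangent_map \<psi> y \<omega>) + 1) * t" using elim(3) by (simp add: divide_le_eq)
      qed (use c(1) in simp)
      finally show ?case by (simp only: mult.assoc)
    qed
    then show ?thesis using that[of "2 / c * (norm (tangent_map \<psi> y \<omega>) + 1)"] c(1) by (simp add: add_nonneg_pos)
  qed
  have sec\<phi>: "((\<lambda>t. (1 / t\<^sup>2) * (n \<bullet> (x t - \<phi> z)) - (1/2) * (n \<bullet> hess \<phi> z ((1 / t) *\<^sub>R s t) ((1 / t) *\<^sub>R s t))) \<longlongrightarrow> 0) ?F"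
  proof (rule tendstoI)
    fix e :: real assume e: "e > 0"
    \<comment> \<open>The added 1 keeps the divisor positive when n = 0, a case that is used later
      for surjectivity.\<close>
    define P where "P = norm n + 1"
    define e' where "e' = e / (2 * P * K\<^sup>2)"
    have nn: "P > 0" "norm n \<le> P" unfolding P_def using norm_ge_zero[of n] by linarith+
    have e': "e' > 0" unfolding e'_def using e K(2) nn by simp
    obtain d where d: "d > 0" "\<And>h. norm h < d \<Longrightarrow> norm (\<phi> (z + h) - \<phi> z - tangent_map \<phi> z h - (1/2) *\<^sub>R hess \<phi> z h h) \<le> e' * (norm h)\<^sup>2"
      by (rule chart_taylor[OF \<phi> e']) (rule that)
    have "\<forall>\<^sub>F t in ?F. dist (s t) 0 < d" using tendstoD[OF slim d(1)] .
    then show "\<forall>\<^sub>F t in ?F. dist ((1 / t\<^sup>2) * (n \<bullet> (x t - \<phi> z)) - (1/2) * (n \<bullet> hess \<phi> z ((1 / t) *\<^sub>R s t) ((1 / t) *\<^sub>R s t))) 0 < e"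
      using phis K(1) tpos
    proof eventually_elim
      case (elim t)
      let ?r = "x t - \<phi> z - tangent_map \<phi> z (s t) - (1/2) *\<^sub>R hess \<phi> z (s t) (s t)"
      have r: "norm ?r \<le> e' * (norm (s t))\<^sup>2" using d(2)[of "s t"] elim by simp
      have "n \<bullet> ?r = n \<bullet> (x t - \<phi> z) - (1/2) * (n \<bullet> hess \<phi> z (s t) (s t))"
        by (simp add: inner_diff_right nd1)
      then have eq: "(1 / t\<^sup>2) * (n \<bullet> (x t - \<phi> z)) - (1/2) * (n \<bullet> hess \<phi> z ((1 / t) *\<^sub>R s t) ((1 / t) *\<^sub>R s t)) = (1 / t\<^sup>2) * (n \<bullet> ?r)"
        unfolding hess_scaleR by (simp add: power_divide algebra_simps)
      have "\<bar>n \<bullet> ?r\<bar> \<le> norm n * norm ?r" by (rule Cauchy_Schwarz_ineq2)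
      also have "\<dots> \<le> P * (e' * (K * t)\<^sup>2)"
        using r elim e' nn by (intro mult_mono order.trans[OF r] mult_left_mono power_mono) auto
      also have "\<dots> = e / 2 * t\<^sup>2" unfolding e'_def using nn K(2) by (simp add: power_mult_distrib field_simps)
      finally have "(1 / t\<^sup>2) * \<bar>n \<bullet> ?r\<bar> \<le> (1 / t\<^sup>2) * (e / 2 * t\<^sup>2)" by (intro mult_left_mono) auto
      also have "\<dots> = e / 2" using elim by simp
      also have "\<dots> < e" using e by simp
      finally show ?case unfolding eq dist_real_def by (simp add: abs_mult)
    qed
  qed
  \<comment> \<open>The quotients s t / t are bounded, so compactness yields a limit \<zeta> along a
    sequence. One sequence is enough, because the quantities in the chart \<psi> converge along all
    t.\<close>
  define tk where "tk = (\<lambda>k::nat. 1 / real (Suc k))"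
  have tk: "filterlim tk ?F sequentially"
    unfolding tk_def using LIMSEQ_inverse_real_of_nat
    by (auto intro!: tendsto_imp_filterlim_at_right simp: inverse_eq_divide)
  define \<sigma> where "\<sigma> = (\<lambda>t. (1 / t) *\<^sub>R s t)"
  have "\<forall>\<^sub>F t in ?F. \<sigma> t \<in> cball 0 K"
    using K(1) tpos by eventually_elim (simp add: \<sigma>_def divide_le_eq)
  then have "\<forall>\<^sub>F k in sequentially. \<sigma> (tk k) \<in> cball 0 K" by (rule eventually_compose_filterlim[OF _ tk])
  then obtain N where N: "\<And>k. k \<ge> N \<Longrightarrow> \<sigma> (tk k) \<in> cball 0 K" unfolding eventually_sequentially by blast
  have "\<forall>k. \<sigma> (tk (k + N)) \<in> cball 0 K" using N by simp
  then obtain \<zeta> r where r: "strict_mono r" "((\<lambda>k. \<sigma> (tk (k + N))) \<circ> r) \<longlonglongrightarrow> \<zeta>"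
    using compact_cball[of 0 K] unfolding compact_def by meson
  define u where "u = (\<lambda>k. tk (r k + N))"
  have u: "filterlim u ?F sequentially"
  proof -
    have "filterlim (\<lambda>k. r k + N) sequentially sequentially"
      by (rule filterlim_compose[OF filterlim_add_const_nat_at_top filterlim_subseq[OF r(1)]])
    then show ?thesis unfolding u_def using filterlim_compose[OF tk] by blast
  qed
  have \<sigma>u: "(\<lambda>k. \<sigma> (u k)) \<longlonglongrightarrow> \<zeta>" using r(2) unfolding u_def o_def .
  have contd1: "(\<lambda>k. tangent_map \<phi> z (\<sigma> (u k))) \<longlonglongrightarrow> tangent_map \<phi> z \<zeta>"
    unfolding tangent_map_def by (intro tendsto_intros \<sigma>u)
  have "((\<lambda>t. (1 / t) *\<^sub>R (x t - \<phi> z) - tangent_map \<phi> z (\<sigma> t)) \<longlongrightarrow> 0) ?F"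
  proof (rule tendstoI)
    fix e :: real assume e: "e > 0"
    then have "e / (2 * K) > 0" using K(2) by simp
    from first[OF this] show "\<forall>\<^sub>F t in ?F. dist ((1 / t) *\<^sub>R (x t - \<phi> z) - tangent_map \<phi> z (\<sigma> t)) 0 < e"
      using K(1) tpos
    proof eventually_elim
      case (elim t)
      have "(1 / t) *\<^sub>R (x t - \<phi> z) - tangent_map \<phi> z (\<sigma> t) = (1 / t) *\<^sub>R (x t - \<phi> z - tangent_map \<phi> z (s t))"
        unfolding \<sigma>_def tangent_map_scaleR by (simp add: algebra_simps)
      then have "norm ((1 / t) *\<^sub>R (x t - \<phi> z) - tangent_map \<phi> z (\<sigma> t)) = (1 / t) * norm (x t - \<phi> z - tangent_map \<phi> z (s t))"
        using elim by simp
      also have "\<dots> \<le> (1 / t) * (e / (2 * K) * (K * t))"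
        using elim e K(2) by (intro mult_left_mono order.trans[OF elim(1)]) auto
      also have "\<dots> = e / 2" using elim K(2) by simp
      also have "\<dots> < e" using e by simp
      finally show ?case by simp
    qed
  qed
  from tendsto_diff[OF quot this] have "((\<lambda>t. tangent_map \<phi> z (\<sigma> t)) \<longlongrightarrow> tangent_map \<psi> y \<omega>) ?F" by simp
  then have "(\<lambda>k. tangent_map \<phi> z (\<sigma> (u k))) \<longlonglongrightarrow> tangent_map \<psi> y \<omega>" by (rule filterlim_compose[OF _ u])
  then have d1eq: "tangent_map \<psi> y \<omega> = tangent_map \<phi> z \<zeta>" using contd1 by (rule LIMSEQ_unique)
  have lim1: "(\<lambda>k. (1 / (u k)\<^sup>2) * (n \<bullet> (x (u k) - \<phi> z))) \<longlonglongrightarrow> (1/2) * (n \<bullet> hess \<phi> z \<zeta> \<zeta>)"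
  proof -
    have a: "(\<lambda>k. (1 / (u k)\<^sup>2) * (n \<bullet> (x (u k) - \<phi> z)) - (1/2) * (n \<bullet> hess \<phi> z (\<sigma> (u k)) (\<sigma> (u k)))) \<longlonglongrightarrow> 0"
      using filterlim_compose[OF sec\<phi> u] unfolding \<sigma>_def .
    have b: "(\<lambda>k. (1/2) * (n \<bullet> hess \<phi> z (\<sigma> (u k)) (\<sigma> (u k)))) \<longlonglongrightarrow> (1/2) * (n \<bullet> hess \<phi> z \<zeta> \<zeta>)"
      unfolding hess_def by (intro tendsto_intros \<sigma>u)
    from tendsto_add[OF a b] show ?thesis by simp
  qed
  have lim2: "((\<lambda>t. (1 / t\<^sup>2) * (n \<bullet> (x t - \<phi> z))) \<longlongrightarrow> (1/2) * (n \<bullet> hess \<psi> y \<omega> \<omega>)) ?F"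
  proof (rule LIM_zero_cancel, rule tendstoI)
    fix e :: real assume e: "e > 0"
    define C where "C = (norm n + 1) * ((norm \<omega>)\<^sup>2 + 1)"
    have C: "C > 0" unfolding C_def by (intro mult_pos_pos add_nonneg_pos) auto
    define e' where "e' = e / (2 * C)"
    have e': "e' > 0" unfolding e'_def using e C by simp
    obtain d where d: "d > 0" "\<And>h. norm h < d \<Longrightarrow> norm (\<psi> (y + h) - \<psi> y - tangent_map \<psi> y h - (1/2) *\<^sub>R hess \<psi> y h h) \<le> e' * (norm h)\<^sup>2"
      by (rule chart_taylor[OF \<psi> e']) (rule that)
    have "((\<lambda>t. of_real t * \<omega>) \<longlongrightarrow> of_real 0 * \<omega>) ?F" by (intro tendsto_intros to0)
    then have "((\<lambda>t. of_real t * \<omega>) \<longlongrightarrow> 0) ?F" by simp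
    from tendstoD[OF this d(1)]
    show "\<forall>\<^sub>F t in ?F. dist ((1 / t\<^sup>2) * (n \<bullet> (x t - \<phi> z)) - (1/2) * (n \<bullet> hess \<psi> y \<omega> \<omega>)) 0 < e"
      using tpos
    proof eventually_elim
      case (elim t)
      have tw: "of_real t * \<omega> = t *\<^sub>R \<omega>" by (simp add: scaleR_conv_of_real)
      let ?r = "x t - \<phi> z - t *\<^sub>R tangent_map \<psi> y \<omega> - (t\<^sup>2 / 2) *\<^sub>R hess \<psi> y \<omega> \<omega>"
      have r: "norm ?r \<le> e' * (t * norm \<omega>)\<^sup>2"
        using d(2)[of "of_real t * \<omega>"] elim p unfolding tw tangent_map_scaleR hess_scaleR x_def by simp
      have "n \<bullet> ?r = n \<bullet> (x t - \<phi> z) - (t\<^sup>2 / 2) * (n \<bullet> hess \<psi> y \<omega> \<omega>)"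
        unfolding d1eq by (simp add: inner_diff_right nd1)
      then have eq: "(1 / t\<^sup>2) * (n \<bullet> (x t - \<phi> z)) - (1/2) * (n \<bullet> hess \<psi> y \<omega> \<omega>) = (1 / t\<^sup>2) * (n \<bullet> ?r)"
        using elim by (simp add: right_diff_distrib)
      have "\<bar>n \<bullet> ?r\<bar> \<le> norm n * norm ?r" by (rule Cauchy_Schwarz_ineq2)
      also have "\<dots> \<le> (norm n + 1) * (e' * (t\<^sup>2 * ((norm \<omega>)\<^sup>2 + 1)))"
        using r e' by (intro mult_mono order.trans[OF r] mult_left_mono) (auto simp: power_mult_distrib intro!: mult_left_mono)
      also have "\<dots> = C * e' * t\<^sup>2" unfolding C_def by (simp only: mult_ac)
      also have "\<dots> = e / 2 * t\<^sup>2" unfolding e'_def using C by simp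
      finally have "(1 / t\<^sup>2) * \<bar>n \<bullet> ?r\<bar> \<le> (1 / t\<^sup>2) * (e / 2 * t\<^sup>2)" by (intro mult_left_mono) auto
      also have "\<dots> = e / 2" using elim by simp
      also have "\<dots> < e" using e by simp
      finally show ?case unfolding eq dist_real_def by (simp add: abs_mult)
    qed
  qed
  have "(1/2) * (n \<bullet> hess \<psi> y \<omega> \<omega>) = (1/2) * (n \<bullet> hess \<phi> z \<zeta> \<zeta>)"
    by (rule LIMSEQ_unique[OF filterlim_compose[OF lim2 u] lim1])
  then show ?thesis using that[OF d1eq] by simp
qed

subsection \<open>Jordan curves\<close>

lemma Arg2pi_circ:
  assumes "r > 0" "0 \<le> t" "t < 1"
  shows "Arg2pi (circ r t) = 2 * pi * t"
proof (rule Arg2pi_unique)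
  show "of_real r * exp (\<i> * of_real (2 * pi * t)) = circ r t"
    unfolding circ_def by (simp only: mult.commute)
qed (use assms in auto)

text \<open>A logarithm along the parametrisation with equal end values descends to the circle,
  since \<open>circ r\<close> maps compact sets to compact sets. Tietze's theorem then extends it to
  the plane.\<close>

lemma circle_logarithm:
  assumes r: "r > 0" and t: "turns (\<lambda>t. q (circ r t)) 0"
  obtains Q where "continuous_on UNIV Q" "\<And>z. norm z = r \<Longrightarrow> q z = exp (Q z :: complex)"
proof -
  obtain l where l: "continuous_on {0..1} l" "\<forall>t\<in>{0..1}. q (circ r t) = exp (l t)" "l 1 = l 0"
    using t unfolding turns_def by auto
  define P where "P = (\<lambda>z. l (Arg2pi z / (2 * pi)))"
  have P: "P (circ r t) = l t" if t: "t \<in> {0..1}" for t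
  proof (cases "t = 1")
    case True
    have "Arg2pi (circ r 1) = 0" using Arg2pi_circ[OF r, of 0] by (simp add: circ_closed)
    then show ?thesis using True l(3) unfolding P_def by simp
  next
    case False
    then show ?thesis using Arg2pi_circ[OF r, of t] t unfolding P_def by simp
  qed
  have "continuous_on (sphere 0 r) P"
    unfolding continuous_on_closed_vimage[OF closed_sphere]
  proof (intro allI impI)
    fix B :: "complex set" assume "closed B"
    then have "closed ({0..1} \<inter> l -` B)" by (intro continuous_closed_preimage[OF l(1)]) auto
    then have "compact ({0..1} \<inter> ({0..1} \<inter> l -` B))" by (intro compact_Int_closed) auto
    then have "compact (circ r ` ({0..1} \<inter> l -` B))"
      by (intro compact_continuous_image continuous_on_circ) simp
    moreover have "circ r ` ({0..1} \<inter> l -` B) = P -` B \<inter> sphere 0 r"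
    proof (intro set_eqI iffI)
      fix z assume "z \<in> circ r ` ({0..1} \<inter> l -` B)"
      then show "z \<in> P -` B \<inter> sphere 0 r" using P r by auto
    next
      fix z assume z: "z \<in> P -` B \<inter> sphere 0 r"
      then have "norm z = r" by simp
      then obtain t where t: "t \<in> {0..1}" "circ r t = z" by (rule circ_surj)
      then have "l t \<in> B" using P[OF t(1)] z by simp
      then show "z \<in> circ r ` ({0..1} \<inter> l -` B)" using t by blast
    qed
    ultimately show "closed (P -` B \<inter> sphere 0 r)" by (simp add: compact_imp_closed)
  qed
  then obtain Q where Q: "continuous_on UNIV Q" "\<And>z. z \<in> sphere 0 r \<Longrightarrow> Q z = P z"
    by (rule Tietze_unbounded[where U = UNIV]) auto
  show ?thesis
  proof (rule that[OF Q(1)])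
    fix z :: complex assume z: "norm z = r"
    then obtain t where t: "t \<in> {0..1}" "circ r t = z" by (rule circ_surj)
    then show "q z = exp (Q z)" using l(2) P[OF t(1)] Q(2)[of z] z by auto
  qed
qed

text \<open>Borsuk's criterion: in the plane, nonvanishing functions on a compact set have
  logarithms when its complement is connected.\<close>

lemma nonseparating_logarithm:
  fixes K :: "complex set" and f :: "complex \<Rightarrow> complex"
  assumes "compact K" "connected (- K)" "continuous_on K f" "\<And>z. z \<in> K \<Longrightarrow> f z \<noteq> 0"
  obtains L where "continuous_on K L" "\<And>z. z \<in> K \<Longrightarrow> f z = exp (L z)"
proof -
  have B: "Borsukian K" using assms(1,2) by (simp add: Borsukian_separation_compact)
  have F: "f \<in> K \<rightarrow> - {0}" using assms(4) by auto
  have "\<exists>g. continuous_on K g \<and> (\<forall>x\<in>K. f x = exp (g x))"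
    using B F assms(3) unfolding Borsukian_continuous_logarithm by blast
  then obtain g where "continuous_on K g" "\<forall>x\<in>K. f x = exp (g x)" by blast
  then show ?thesis by (intro that[of g]) auto
qed

lemma turns_nonseparating:
  fixes K :: "complex set" and f :: "complex \<Rightarrow> complex"
  assumes K: "compact K" "connected (- K)" and f: "continuous_on K f" "\<And>z. z \<in> K \<Longrightarrow> f z \<noteq> 0"
    and c: "continuous_on {0..1} c" "c ` {0..1} \<subseteq> K" "c 0 = c 1"
  shows "turns (\<lambda>t. f (c t)) 0"
proof -
  obtain L where L: "continuous_on K L" "\<And>z. z \<in> K \<Longrightarrow> f z = exp (L z)"
    by (rule nonseparating_logarithm[OF K f(1)], erule f(2)) (rule that)
  have "turns (\<lambda>t. exp (L (c t))) 0"
    by (rule turns_exp[OF continuous_on_compose2[OF L(1) c(1,2)]]) (simp add: c(3))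
  then show ?thesis
  proof (rule turns_cong)
    fix t :: real assume "t \<in> {0..1}"
    then have "c t \<in> K" using c(2) by blast
    then show "exp (L (c t)) = f (c t)" using L(2) by simp
  qed
qed

lemma turns_path:
  assumes "path c" "z0 \<notin> path_image c" "pathfinish c = pathstart c" "winding_number c z0 = of_real n"
  shows "turns (\<lambda>t. c t - z0) n"
proof -
  obtain q where q: "path q" "pathfinish q - pathstart q = 2 * of_real pi * \<i> * winding_number c z0"
    "\<And>t. t \<in> {0..1} \<Longrightarrow> c t = z0 + exp (q t)"
    by (rule winding_number_as_continuous_log[OF assms(1,2)]) (rule that)
  show ?thesis unfolding turns_def
    by (intro exI[of _ q]) (use q assms(4) in \<open>auto simp: path_def pathfinish_def pathstart_def\<close>)
qed

text \<open>Dividing out a power of z - z0 leaves a function without turns on the small circle, which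
  therefore extends without zeros over the disc; the filled Jordan curve does not separate the plane.\<close>
lemma turns_jordan:
  fixes c :: "real \<Rightarrow> complex" and \<sigma> :: "complex \<Rightarrow> complex"
  assumes c: "path c" "pathfinish c = pathstart c" "winding_number c z0 = 1"
    and K: "K = path_image c \<union> inside (path_image c)"
    and r: "r > 0" "cball z0 r \<subseteq> inside (path_image c)"
    and \<sigma>: "continuous_on (K - {z0}) \<sigma>" "\<And>z. z \<in> K - {z0} \<Longrightarrow> \<sigma> z \<noteq> 0"
    and n: "turns (\<lambda>t. \<sigma> (z0 + circ r t)) n"
  shows "turns (\<lambda>t. \<sigma> (c t)) n"
proof -
  have bd: "bounded (path_image c)" using c(1) by (rule bounded_path_image)
  have Kcomp: "compact K"
    unfolding compact_eq_bounded_closed K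
    using closed_path_image_Un_inside[OF c(1)] bd bounded_inside[OF bd] by simp
  have "- K = outside (path_image c)" unfolding K by (simp add: union_with_inside)
  then have Kcon: "connected (- K)" using connected_outside[OF bd] by simp
  have cbK: "cball z0 r \<subseteq> K" using r unfolding K by blast
  have off: "norm (c t - z0) > r" if "t \<in> {0..1}" for t
  proof (rule ccontr)
    assume "\<not> norm (c t - z0) > r"
    then have "c t \<in> inside (path_image c)" using r(2) by (auto simp: dist_norm norm_minus_commute subset_iff)
    moreover have "c t \<in> path_image c" using that unfolding path_image_def by blast
    ultimately show False using inside_no_overlap by blast
  qed
  have circK: "z0 + circ r t \<in> K - {z0}" for t
    using cbK r(1) by (auto simp: dist_norm subset_iff)
  have c1: "continuous_on {0..1} (\<lambda>t. \<sigma> (z0 + circ r t))"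
    by (rule continuous_on_compose2[OF \<sigma>(1)]) (use circK in \<open>auto intro: continuous_on_add continuous_on_const continuous_on_circ\<close>)
  obtain j :: int where "turns (\<lambda>t. \<sigma> (z0 + circ r t)) j"
    by (rule turns_exists[OF c1 \<sigma>(2)[OF circK]]) (simp only: circ_closed, rule that)
  then have j: "n = j" using turns_unique[OF n] by blast
  define q where "q = (\<lambda>z. \<sigma> z / (z - z0) powi j)"
  have "turns (\<lambda>t. \<sigma> (z0 + circ r t) / circ r t powi j) (n - of_int j * 1)"
    by (intro turns_divide n turns_power_int turns_circ) (use r in simp)
  then have "turns (\<lambda>t. q (z0 + circ r t)) 0" unfolding q_def j by simp
  then obtain Q where Q: "continuous_on UNIV Q" "\<And>z. norm z = r \<Longrightarrow> q (z0 + z) = exp (Q z)"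
    by (rule circle_logarithm[OF r(1)]) (rule that)
  \<comment> \<open>Inside the small disc q is replaced by the exponential of the extended
    logarithm; on the circle both agree, and the Jordan curve stays in the region where f is
    q.\<close>
  define f where "f = (\<lambda>z. if norm (z - z0) \<le> r then exp (Q (z - z0)) else q z)"
  have fcont: "continuous_on K f"
    unfolding f_def
  proof (rule continuous_on_cases_le)
    show "continuous_on {x \<in> K. norm (x - z0) \<le> r} (\<lambda>z. exp (Q (z - z0)))"
      by (intro continuous_on_exp continuous_on_compose2[OF Q(1)]) (auto intro: continuous_intros)
    show "continuous_on {x \<in> K. r \<le> norm (x - z0)} q"
      unfolding q_def
      by (intro continuous_intros continuous_on_subset[OF \<sigma>(1)]) (use r in auto)
    show "continuous_on K (\<lambda>z. norm (z - z0))" by (intro continuous_intros)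
    fix x assume "x \<in> K" "norm (x - z0) = r"
    then show "exp (Q (x - z0)) = q x" using Q(2)[of "x - z0"] by simp
  qed
  have fnz: "f z \<noteq> 0" if "z \<in> K" for z
  proof (cases "norm (z - z0) \<le> r")
    case False
    then have "z \<noteq> z0" using r by auto
    then show ?thesis using False \<sigma>(2)[of z] that unfolding f_def q_def by simp
  qed (simp add: f_def)
  have cK: "c ` {0..1} \<subseteq> K" unfolding K path_image_def by blast
  have c01: "c 0 = c 1" using c(2) by (simp add: pathfinish_def pathstart_def)
  have cc: "continuous_on {0..1} c" using c(1) by (simp add: path_def)
  have t1: "turns (\<lambda>t. f (c t)) 0" by (rule turns_nonseparating[OF Kcomp Kcon fcont fnz cc cK c01])
  have "z0 \<in> inside (path_image c)" using r by (simp add: subset_iff)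
  then have "z0 \<notin> path_image c" using inside_no_overlap[of "path_image c"] by blast
  then have "turns (\<lambda>t. c t - z0) 1" using turns_path[OF c(1) _ c(2), of z0 1] c(3) by simp
  \<comment> \<open>The factor f contributes no turns, and c turns once around z0, so the power j
    accounts for all of them.\<close>
  from turns_mult[OF t1 turns_power_int[OF this, of j]]
  have "turns (\<lambda>t. f (c t) * (c t - z0) powi j) n" by (simp add: j)
  then show ?thesis
  proof (rule turns_cong)
    fix t :: real assume "t \<in> {0..1}"
    then have "norm (c t - z0) > r" by (rule off)
    moreover from this have "c t \<noteq> z0" using r by auto
    ultimately show "f (c t) * (c t - z0) powi j = \<sigma> (c t)" unfolding f_def q_def by simp
  qed
qed

subsection \<open>Second fundamental form and principal directions\<close>

abbreviation nrm :: "(complex \<Rightarrow> real^3) \<Rightarrow> complex \<Rightarrow> real^3" where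
  "nrm \<phi> z \<equiv> cross3 (phi_u \<phi> z) (phi_v \<phi> z)"

lemma orthogonal_multiple_cross:
  fixes a b n :: "real^3"
  assumes "cross3 a b \<noteq> 0" "n \<bullet> a = 0" "n \<bullet> b = 0"
  obtains s where "n = s *\<^sub>R cross3 a b"
proof -
  define m where "m = cross3 a b"
  have m: "m \<noteq> 0" "m \<bullet> a = 0" "m \<bullet> b = 0"
    using assms(1) unfolding m_def by (auto simp: dot_cross_self)
  \<comment> \<open>Without its component along the cross product m, n is orthogonal to both
    factors, which makes \<open>cross3 v m\<close> vanish. Being also orthogonal to m, the remainder
    is zero.\<close>
  define v where "v = n - ((n \<bullet> m) / (m \<bullet> m)) *\<^sub>R m"
  have "v \<bullet> a = 0" "v \<bullet> b = 0" unfolding v_def using assms m by (simp_all add: inner_diff_left)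
  then have "cross3 v m = 0" unfolding m_def by (simp add: Lagrange)
  moreover have "v \<bullet> m = 0" unfolding v_def using m by (simp add: inner_diff_left)
  ultimately have "v = 0" using norm_and_cross_eq_0[of v m] m(1) by blast
  then have "n = ((n \<bullet> m) / (m \<bullet> m)) *\<^sub>R m" unfolding v_def by simp
  then show ?thesis using that unfolding m_def by blast
qed

text \<open>Coordinates of a tangent vector w in the basis phi_u, phi_v (Cramer's rule on the Gram matrix).\<close>
definition coords :: "(complex \<Rightarrow> real^3) \<Rightarrow> complex \<Rightarrow> real^3 \<Rightarrow> complex" where
  "coords \<phi> z w = Complex
     (((w \<bullet> phi_u \<phi> z) * fG \<phi> z - (w \<bullet> phi_v \<phi> z) * fF \<phi> z) / (nrm \<phi> z \<bullet> nrm \<phi> z))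
     (((w \<bullet> phi_v \<phi> z) * fE \<phi> z - (w \<bullet> phi_u \<phi> z) * fF \<phi> z) / (nrm \<phi> z \<bullet> nrm \<phi> z))"

lemma gram_determinant: "nrm \<phi> z \<bullet> nrm \<phi> z = fE \<phi> z * fG \<phi> z - (fF \<phi> z)\<^sup>2"
proof -
  have "(norm (nrm \<phi> z))\<^sup>2 + (fF \<phi> z)\<^sup>2 = (norm (phi_u \<phi> z))\<^sup>2 * (norm (phi_v \<phi> z))\<^sup>2"
    unfolding fF_def norm_cross_dot by (rule power_mult_distrib)
  then show ?thesis unfolding fE_def fG_def power2_norm_eq_inner by simp
qed

lemma tangent_map_coords:
  assumes nz: "nrm \<phi> z \<noteq> 0" and w: "w \<bullet> nrm \<phi> z = 0"
  shows "tangent_map \<phi> z (coords \<phi> z w) = w"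
proof -
  let ?a = "phi_u \<phi> z" and ?b = "phi_v \<phi> z" and ?m = "nrm \<phi> z"
  have D: "?m \<bullet> ?m \<noteq> 0" using nz by simp
  have e: "fE \<phi> z = ?a \<bullet> ?a" "fF \<phi> z = ?a \<bullet> ?b" "fG \<phi> z = ?b \<bullet> ?b" by (simp_all add: fE_def fF_def fG_def)
  define v where "v = w - tangent_map \<phi> z (coords \<phi> z w)"
  define P where "P = w \<bullet> ?a"
  define Q where "Q = w \<bullet> ?b"
  define d where "d = ?m \<bullet> ?m"
  have gd: "d = fE \<phi> z * fG \<phi> z - (fF \<phi> z)\<^sup>2" unfolding d_def by (rule gram_determinant)
  have d0: "d \<noteq> 0" using D unfolding d_def .
  have cw: "tangent_map \<phi> z (coords \<phi> z w) = ((P * fG \<phi> z - Q * fF \<phi> z) / d) *\<^sub>R ?a + ((Q * fE \<phi> z - P * fF \<phi> z) / d) *\<^sub>R ?b"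
    unfolding tangent_map_def coords_def P_def Q_def d_def by simp
  have "tangent_map \<phi> z (coords \<phi> z w) \<bullet> ?a = ((P * fG \<phi> z - Q * fF \<phi> z) * fE \<phi> z + (Q * fE \<phi> z - P * fF \<phi> z) * fF \<phi> z) / d"
    unfolding cw e by (simp add: inner_add_left inner_commute[of ?b ?a] add_divide_distrib)
  also have "\<dots> = P * d / d" unfolding gd by (simp add: algebra_simps power2_eq_square)
  finally have "v \<bullet> ?a = 0" unfolding v_def P_def using d0 by (simp add: inner_diff_left)
  have "tangent_map \<phi> z (coords \<phi> z w) \<bullet> ?b = ((P * fG \<phi> z - Q * fF \<phi> z) * fF \<phi> z + (Q * fE \<phi> z - P * fF \<phi> z) * fG \<phi> z) / d"
    unfolding cw e by (simp add: inner_add_left inner_commute[of ?b ?a] add_divide_distrib)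
  also have "\<dots> = Q * d / d" unfolding gd by (simp add: algebra_simps power2_eq_square)
  finally have "v \<bullet> ?b = 0" unfolding v_def Q_def using d0 by (simp add: inner_diff_left)
  obtain s where s: "v = s *\<^sub>R ?m"
    by (rule orthogonal_multiple_cross[OF nz \<open>v \<bullet> ?a = 0\<close> \<open>v \<bullet> ?b = 0\<close>]) (rule that)
  have "v \<bullet> ?m = 0" unfolding v_def tangent_map_def using w by (simp add: inner_diff_left inner_add_left dot_cross_self)
  then have "s = 0" using s D by simp
  then show ?thesis using s unfolding v_def by simp
qed

lemma cross_tangent_map: "cross3 (tangent_map \<phi> z h) (tangent_map \<phi> z k) = (Re h * Im k - Im h * Re k) *\<^sub>R nrm \<phi> z"
  unfolding tangent_map_def
  by (simp add: cross_add_left cross_add_right cross_mult_left cross_mult_right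
      cross_skew[of "phi_v \<phi> z" "phi_u \<phi> z"] algebra_simps)

lemma nrm_eq: "nrm \<phi> z = norm (nrm \<phi> z) *\<^sub>R unit_normal \<phi> z"
  unfolding unit_normal_def by simp

lemma unit_normal_orthogonal [simp]:
  "unit_normal \<phi> z \<bullet> phi_u \<phi> z = 0" "unit_normal \<phi> z \<bullet> phi_v \<phi> z = 0"
  unfolding unit_normal_def by (auto simp: dot_cross_self)

definition II :: "(complex \<Rightarrow> real^3) \<Rightarrow> complex \<Rightarrow> complex \<Rightarrow> complex \<Rightarrow> real" where
  "II \<phi> z h k = unit_normal \<phi> z \<bullet> hess \<phi> z h k"

lemma II_eq: "II \<phi> z h k = Re h * Re k * sL \<phi> z + (Re h * Im k + Im h * Re k) * sM \<phi> z + Im h * Im k * sN \<phi> z"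
  unfolding II_def hess_def sL_def sM_def sN_def by (simp add: inner_add_right inner_commute)

text \<open>The coefficient equations say that II(h, .) is a multiple of the metric product with h.
  In this form the property can be carried from one chart to another.\<close>

lemma principal_dir_chart_iff:
  "principal_dir_chart \<phi> z w \<longleftrightarrow>
     w \<noteq> 0 \<and> (\<exists>h \<kappa>. w = tangent_map \<phi> z h \<and> (\<forall>k. II \<phi> z h k = \<kappa> * (tangent_map \<phi> z h \<bullet> tangent_map \<phi> z k)))"
proof -
  have *: "(\<forall>k. II \<phi> z (Complex a b) k = \<kappa> * (tangent_map \<phi> z (Complex a b) \<bullet> tangent_map \<phi> z k)) \<longleftrightarrow>
      sL \<phi> z * a + sM \<phi> z * b = \<kappa> * (fE \<phi> z * a + fF \<phi> z * b) \<and>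
      sM \<phi> z * a + sN \<phi> z * b = \<kappa> * (fF \<phi> z * a + fG \<phi> z * b)" (is "?l \<longleftrightarrow> ?r") for a b \<kappa>
  proof
    assume ?l
    from this[rule_format, of 1] this[rule_format, of \<i>] show ?r
      unfolding II_eq fE_def fF_def fG_def
      by (simp add: tangent_map_def inner_add_left inner_commute[of "phi_v \<phi> z" "phi_u \<phi> z"] mult_ac)
  next
    assume r: ?r
    show ?l
    proof
      fix k
      have "II \<phi> z (Complex a b) k = Re k * (sL \<phi> z * a + sM \<phi> z * b) + Im k * (sM \<phi> z * a + sN \<phi> z * b)"
        unfolding II_eq by (simp add: algebra_simps)
      also have "\<dots> = Re k * (\<kappa> * (fE \<phi> z * a + fF \<phi> z * b)) + Im k * (\<kappa> * (fF \<phi> z * a + fG \<phi> z * b))"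
        using r by simp
      also have "\<dots> = \<kappa> * (tangent_map \<phi> z (Complex a b) \<bullet> tangent_map \<phi> z k)"
        unfolding fE_def fF_def fG_def
        by (simp add: tangent_map_def inner_add_left inner_add_right inner_commute[of "phi_v \<phi> z" "phi_u \<phi> z"] algebra_simps)
      finally show "II \<phi> z (Complex a b) k = \<kappa> * (tangent_map \<phi> z (Complex a b) \<bullet> tangent_map \<phi> z k)" .
    qed
  qed
  have w: "w = a *\<^sub>R phi_u \<phi> z + b *\<^sub>R phi_v \<phi> z \<longleftrightarrow> w = tangent_map \<phi> z (Complex a b)" for a b
    unfolding tangent_map_def by simp
  show ?thesis unfolding principal_dir_chart_def w *[symmetric]
    by (metis complex.collapse)
qed

text \<open>The index is computed in one chart, whereas \<open>principal_dir\<close> may use a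
  different chart at every point.\<close>

lemma principal_dir_chart_transfer:
  assumes \<phi>: "chart M V \<phi>" "z \<in> V" and \<psi>: "chart M W \<psi>" "y \<in> W" and p: "\<phi> z = \<psi> y"
    and w: "principal_dir_chart \<psi> y w"
  shows "principal_dir_chart \<phi> z w"
proof -
  define n where "n = unit_normal \<phi> z"
  have n: "n \<bullet> phi_u \<phi> z = 0" "n \<bullet> phi_v \<phi> z = 0" unfolding n_def by simp_all
  have "\<exists>\<zeta>. tangent_map \<psi> y \<omega> = tangent_map \<phi> z \<zeta> \<and> n \<bullet> hess \<psi> y \<omega> \<omega> = n \<bullet> hess \<phi> z \<zeta> \<zeta>" for \<omega>
    by (rule second_form_transfer[OF \<phi> \<psi> p n, of \<omega>]) blast
  then obtain T where T: "\<And>\<omega>. tangent_map \<psi> y \<omega> = tangent_map \<phi> z (T \<omega>)" "\<And>\<omega>. n \<bullet> hess \<psi> y \<omega> \<omega> = n \<bullet> hess \<phi> z (T \<omega>) (T \<omega>)"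
    by metis
  have inj: "h = k" if "tangent_map \<phi> z h = tangent_map \<phi> z k" for h k
    using inj_tangent_map[OF \<phi>] that by (rule injD)
  have Tadd: "T (h + k) = T h + T k" for h k
    by (rule inj) (simp add: T(1)[symmetric] tangent_map_add)
  \<comment> \<open>Contact with the plane determines only the quadratic form; additivity of T
    allows the bilinear form to be recovered by polarisation.\<close>
  have Tpol: "n \<bullet> hess \<psi> y h k = n \<bullet> hess \<phi> z (T h) (T k)" for h k
    using T(2)[of "h + k"] T(2)[of h] T(2)[of k]
    unfolding Tadd hess_polar by (simp add: inner_add_right)
  \<comment> \<open>The transfer in the opposite direction with normal 0, of which only the
    statement about tangent vectors is used.\<close>
  have surj: "\<exists>k. T k = k'" for k'
  proof (rule second_form_transfer[OF \<psi> \<phi> p[symmetric], of 0 k'])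
    fix k assume "tangent_map \<phi> z k' = tangent_map \<psi> y k"
    then show ?thesis using T(1)[of k] inj by metis
  qed simp_all
  have no: "n \<bullet> tangent_map \<psi> y h = 0" for h
    unfolding T(1) tangent_map_def[of \<phi>] using n by (simp add: inner_add_right)
  obtain s' where s': "n = s' *\<^sub>R nrm \<psi> y"
    by (rule orthogonal_multiple_cross[OF chart_cross_nz[OF \<psi>]]) (use no[of 1] no[of \<i>] that in simp_all)
  \<comment> \<open>The charts may orient the normal differently; the scalar s, sign included, is
    absorbed into the principal curvature.\<close>
  define s where "s = s' * norm (nrm \<psi> y)"
  have s: "n = s *\<^sub>R unit_normal \<psi> y" unfolding s_def s' by (subst nrm_eq) simp
  obtain h \<kappa> where h: "w \<noteq> 0" "w = tangent_map \<psi> y h" "\<And>k. II \<psi> y h k = \<kappa> * (tangent_map \<psi> y h \<bullet> tangent_map \<psi> y k)"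
    using w unfolding principal_dir_chart_iff by blast
  have "II \<phi> z (T h) k' = (s * \<kappa>) * (tangent_map \<phi> z (T h) \<bullet> tangent_map \<phi> z k')" for k'
  proof -
    obtain k where k: "T k = k'" using surj by blast
    have "II \<phi> z (T h) k' = n \<bullet> hess \<psi> y h k" by (simp only: II_def n_def[symmetric] Tpol k)
    also have "\<dots> = s * II \<psi> y h k" unfolding s II_def by simp
    also have "\<dots> = (s * \<kappa>) * (tangent_map \<psi> y h \<bullet> tangent_map \<psi> y k)" unfolding h(3) by simp
    finally show ?thesis unfolding T(1) k .
  qed
  then show ?thesis unfolding principal_dir_chart_iff using h(1,2) T(1)[of h] by metis
qed

lemma continuous_on_second_form:
  assumes "chart M V \<phi>"
  shows "continuous_on V (sL \<phi>)" "continuous_on V (sM \<phi>)" "continuous_on V (sN \<phi>)"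
    "continuous_on V (nrm \<phi>)"
proof -
  interpret cross: bounded_bilinear cross3
    using bilinear_cross by (simp add: bilinear_conv_bounded_bilinear)
  note c = continuous_on_chart[OF assms]
  show n: "continuous_on V (nrm \<phi>)" by (rule cross.continuous_on[OF c(2,3)])
  have "continuous_on V (unit_normal \<phi>)"
    unfolding unit_normal_def[abs_def] using chart_cross_nz[OF assms]
    by (intro continuous_intros n) auto
  then show "continuous_on V (sL \<phi>)" "continuous_on V (sM \<phi>)" "continuous_on V (sN \<phi>)"
    unfolding sL_def[abs_def] sM_def[abs_def] sN_def[abs_def] by (intro continuous_intros c; assumption)+
qed

lemma continuous_on_coords:
  assumes "chart M V \<phi>" "S \<subseteq> V" "continuous_on S w"
  shows "continuous_on S (\<lambda>z. coords \<phi> z (w z))"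
proof -
  note c = continuous_on_subset[OF continuous_on_chart(2)[OF assms(1)] assms(2)]
    continuous_on_subset[OF continuous_on_chart(3)[OF assms(1)] assms(2)]
    continuous_on_subset[OF continuous_on_second_form(4)[OF assms(1)] assms(2)]
  show ?thesis
    unfolding coords_def fE_def fF_def fG_def Complex_eq
    using chart_cross_nz[OF assms(1)] assms(2)
    by (intro continuous_intros c assms(3)) auto
qed

section \<open>Indefinite binary forms and positively oriented bases\<close>

lemma Im_of_real_mult_left: "Im (of_real a * z) = a * Im z"
  by simp

text \<open>With \<tau> a quotient of complex numbers encoding a positively oriented basis, L + M
  \<tau> is the pivot of two segments that miss 0. One leads to L + i M, the case of the coordinate
  basis. The other leads to L + 2 M \<tau> + N \<tau>^2, which for \<tau> = i is the trace-free part
  (L - N) + 2 i M.\<close>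

lemma upper_half_plane_combination:
  fixes L M N :: real and \<tau> :: complex
  assumes neg: "L * N < M\<^sup>2" and \<tau>: "Im \<tau> > 0"
  shows "of_real L + of_real M * \<tau> \<noteq> 0"
    and "(of_real L + \<i> * of_real M) / (of_real L + of_real M * \<tau>) \<notin> \<real>\<^sub>\<le>\<^sub>0"
    and "(of_real L + 2 * of_real M * \<tau> + of_real N * \<tau>\<^sup>2) / (of_real L + of_real M * \<tau>) \<notin> \<real>\<^sub>\<le>\<^sub>0"
proof -
  let ?P = "of_real L + of_real M * \<tau> :: complex"
  have "\<not> (L = 0 \<and> M = 0)" using neg by auto
  show P0: "?P \<noteq> 0"
  proof
    assume z: "?P = 0"
    then have "Im ?P = 0" by simp
    then have "M = 0" using \<tau> by simp
    then show False using z \<open>\<not> (L = 0 \<and> M = 0)\<close> by simp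
  qed
  have real_quotient: "\<exists>x\<ge>0. w + of_real x * ?P = 0" if w: "w / ?P \<in> \<real>\<^sub>\<le>\<^sub>0" for w
  proof -
    obtain x where "x \<le> 0" "w / ?P = of_real x" using w by (auto elim!: nonpos_Reals_cases)
    then have "w + of_real (- x) * ?P = 0" using P0 by (simp add: divide_eq_eq)
    then show ?thesis using \<open>x \<le> 0\<close> by (intro exI[of _ "- x"]) simp
  qed
  show "(of_real L + \<i> * of_real M) / ?P \<notin> \<real>\<^sub>\<le>\<^sub>0"
  proof
    assume "(of_real L + \<i> * of_real M) / ?P \<in> \<real>\<^sub>\<le>\<^sub>0"
    then obtain x where x: "x \<ge> 0" "of_real L + \<i> * of_real M + of_real x * ?P = 0"
      using real_quotient by blast
    then have "Im (of_real L + \<i> * of_real M + of_real x * ?P) = 0" "Re (of_real L + \<i> * of_real M + of_real x * ?P) = 0"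
      by simp_all
    then have im: "M * (1 + x * Im \<tau>) = 0" and re: "L + x * (L + M * Re \<tau>) = 0" by (simp_all add: algebra_simps)
    have "x * Im \<tau> \<ge> 0" using x \<tau> by simp
    then have "1 + x * Im \<tau> \<noteq> 0" by linarith
    then have M: "M = 0" using im by simp
    then have "L * (1 + x) = 0" using re by (simp add: algebra_simps)
    then have "L = 0" using x by auto
    then show False using M \<open>\<not> (L = 0 \<and> M = 0)\<close> by simp
  qed
  show "(of_real L + 2 * of_real M * \<tau> + of_real N * \<tau>\<^sup>2) / ?P \<notin> \<real>\<^sub>\<le>\<^sub>0"
  proof
    assume "(of_real L + 2 * of_real M * \<tau> + of_real N * \<tau>\<^sup>2) / ?P \<in> \<real>\<^sub>\<le>\<^sub>0"
    then obtain x where x: "x \<ge> 0" "of_real L + 2 * of_real M * \<tau> + of_real N * \<tau>\<^sup>2 + of_real x * ?P = 0"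
      using real_quotient by blast
    then have e: "of_real (1 + x) * ?P = - \<tau> * (of_real M + of_real N * \<tau>)"
      by (simp add: algebra_simps power2_eq_square add_eq_0_iff2)
    \<comment> \<open>Multiplying the relation by cnj P and cnj \<tau> makes imaginary parts
      comparable: the left one is nonpositive, the right one is positive because L N < M^2.\<close>
    have "of_real (1 + x) * (?P * cnj ?P) * cnj \<tau> = (of_real (1 + x) * ?P) * cnj ?P * cnj \<tau>"
      by (simp only: mult_ac)
    also have "\<dots> = - (\<tau> * cnj \<tau>) * ((of_real M + of_real N * \<tau>) * cnj ?P)"
      unfolding e by (simp only: mult_ac mult_minus_left mult_minus_right)
    finally have "of_real ((1 + x) * (norm ?P)\<^sup>2) * cnj \<tau> = of_real (- ((norm \<tau>)\<^sup>2)) * ((of_real M + of_real N * \<tau>) * cnj ?P)"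
      by (simp only: complex_norm_square[symmetric] of_real_mult of_real_minus)
    then have "Im (of_real ((1 + x) * (norm ?P)\<^sup>2) * cnj \<tau>) = Im (of_real (- ((norm \<tau>)\<^sup>2)) * ((of_real M + of_real N * \<tau>) * cnj ?P))"
      by simp
    moreover have "Im (of_real ((1 + x) * (norm ?P)\<^sup>2) * cnj \<tau>) = - ((1 + x) * (norm ?P)\<^sup>2 * Im \<tau>)"
      by (simp only: Im_of_real_mult_left cnj.simps(2) mult_minus_right)
    moreover have "Im ((of_real M + of_real N * \<tau>) * cnj ?P) = (L * N - M\<^sup>2) * Im \<tau>"
      by (simp add: algebra_simps power2_eq_square)
    then have "Im (of_real (- ((norm \<tau>)\<^sup>2)) * ((of_real M + of_real N * \<tau>) * cnj ?P)) = - ((norm \<tau>)\<^sup>2) * ((L * N - M\<^sup>2) * Im \<tau>)"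
      by (simp only: Im_of_real_mult_left)
    ultimately have "- ((1 + x) * (norm ?P)\<^sup>2 * Im \<tau>) = (norm \<tau>)\<^sup>2 * ((M\<^sup>2 - L * N) * Im \<tau>)"
      by (simp add: algebra_simps)
    moreover have "(1 + x) * (norm ?P)\<^sup>2 * Im \<tau> \<ge> 0" using x \<tau> by simp
    moreover have "\<tau> \<noteq> 0" using \<tau> by auto
    then have "(norm \<tau>)\<^sup>2 * ((M\<^sup>2 - L * N) * Im \<tau>) > 0" using neg \<tau> by simp
    ultimately show False by linarith
  qed
qed

text \<open>g is the gradient map of the surface seen as a graph over its tangent plane at phi z0: the
  central projection of the normal. Its differential is the second fundamental form up to the
  tangential change of basis beta, which is positively oriented near z0.\<close>
lemma second_form_turns:
  assumes ch: "chart M V \<phi>" and z0: "z0 \<in> V" and e: "e > 0"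
    and neg: "\<And>z. z \<in> V \<Longrightarrow> z \<noteq> z0 \<Longrightarrow> sL \<phi> z * sN \<phi> z < (sM \<phi> z)\<^sup>2"
  obtains r n where "0 < r" "r < e" "turns (\<lambda>t. of_real (sL \<phi> (z0 + circ r t)) + \<i> * of_real (sM \<phi> (z0 + circ r t))) n"
    "n \<le> 0"
proof -
  interpret cross: bounded_bilinear cross3
    using bilinear_cross by (simp add: bilinear_conv_bounded_bilinear)
  define m where "m = nrm \<phi>"
  define \<mu> where "\<mu> = (\<lambda>z. m z \<bullet> m z0)"
  \<comment> \<open>The quotient rule makes w b the vector whose product with dm is the differential
    of m.b / \<mu>. It is orthogonal to m, hence tangent, and has coordinates \<beta>.\<close>
  define w where "w = (\<lambda>b z. (1 / (\<mu> z)\<^sup>2) *\<^sub>R (\<mu> z *\<^sub>R b - (m z \<bullet> b) *\<^sub>R m z0))"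
  define \<beta> where "\<beta> = (\<lambda>b z. coords \<phi> z (w b z))"
  define b1 where "b1 = phi_u \<phi> z0"
  define b2 where "b2 = phi_v \<phi> z0"
  define dm where "dm = (\<lambda>z h. cross3 (phi_u \<phi> z) (hess \<phi> z h \<i>) + cross3 (hess \<phi> z h 1) (phi_v \<phi> z))"
  define g where "g = (\<lambda>z. of_real (m z \<bullet> b1 / \<mu> z) + \<i> * of_real (m z \<bullet> b2 / \<mu> z))"
  define G where "G = (\<lambda>z h. of_real (dm z h \<bullet> w b1 z) + \<i> * of_real (dm z h \<bullet> w b2 z))"
  \<comment> \<open>The first coordinates of the two tangent vectors form one complex number, the
    second coordinates another. The differential of g then is -|m| (B1 II(h, 1) + B2 II(h, i)), with
    Jacobian |m|^2 (L N - M^2) \<Delta>.\<close>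
  define B1 where "B1 = (\<lambda>z. of_real (Re (\<beta> b1 z)) + \<i> * of_real (Re (\<beta> b2 z)))"
  define B2 where "B2 = (\<lambda>z. of_real (Im (\<beta> b1 z)) + \<i> * of_real (Im (\<beta> b2 z)))"
  define \<Delta> where "\<Delta> = (\<lambda>z. Im (cnj (B1 z) * B2 z))"
  have m0: "m z \<noteq> 0" if "z \<in> V" for z using chart_cross_nz[OF ch that] unfolding m_def .
  note cont = continuous_on_chart[OF ch] continuous_on_second_form[OF ch, folded m_def]
  have c\<mu>: "continuous_on V \<mu>" unfolding \<mu>_def by (intro continuous_intros cont)
  define V1 where "V1 = V \<inter> \<mu> -` {0<..}"
  have V1: "open V1" "V1 \<subseteq> V" "z0 \<in> V1" "\<And>z. z \<in> V1 \<Longrightarrow> \<mu> z > 0"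
    unfolding V1_def using chart_open[OF ch] z0 m0[OF z0] c\<mu>
    by (auto intro!: continuous_open_preimage simp: \<mu>_def)
  note cont1 = cont[THEN continuous_on_subset, OF V1(2)]
  have cw: "continuous_on V1 (w b)" for b
    unfolding w_def using V1(4) by (intro continuous_intros cont1 continuous_on_subset[OF c\<mu> V1(2)]) force
  have c\<beta>: "continuous_on V1 (\<beta> b)" for b
    unfolding \<beta>_def by (rule continuous_on_coords[OF ch V1(2) cw])
  have cB: "continuous_on V1 B1" "continuous_on V1 B2" unfolding B1_def B2_def
    by (intro continuous_intros c\<beta>)+
  have c\<Delta>: "continuous_on V1 \<Delta>" unfolding \<Delta>_def by (intro continuous_intros cB)
  have wm: "w b z \<bullet> m z = 0" for b z
    unfolding w_def \<mu>_def by (simp add: inner_diff_left inner_diff_right inner_commute)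
  have w\<beta>: "w b z = tangent_map \<phi> z (\<beta> b z)" if "z \<in> V" for b z
    unfolding \<beta>_def by (rule tangent_map_coords[symmetric]) (use m0[OF that] wm in \<open>auto simp: m_def\<close>)
  have \<Delta>0: "\<Delta> z0 > 0"
  proof -
    have mb: "m z0 \<bullet> b1 = 0" "m z0 \<bullet> b2 = 0" unfolding m_def b1_def b2_def by (simp_all add: dot_cross_self)
    have \<mu>0: "\<mu> z0 > 0" using V1(3,4) by blast
    have "tangent_map \<phi> z0 (\<beta> b1 z0) = tangent_map \<phi> z0 (of_real (1 / \<mu> z0))"
      unfolding w\<beta>[OF z0, symmetric] w_def mb using \<mu>0 by (simp add: tangent_map_def b1_def power2_eq_square)
    then have 1: "\<beta> b1 z0 = of_real (1 / \<mu> z0)" by (rule injD[OF inj_tangent_map[OF ch z0]])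
    have "tangent_map \<phi> z0 (\<beta> b2 z0) = tangent_map \<phi> z0 (\<i> * of_real (1 / \<mu> z0))"
      unfolding w\<beta>[OF z0, symmetric] w_def mb using \<mu>0 by (simp add: tangent_map_def b2_def power2_eq_square)
    then have 2: "\<beta> b2 z0 = \<i> * of_real (1 / \<mu> z0)" by (rule injD[OF inj_tangent_map[OF ch z0]])
    show ?thesis unfolding \<Delta>_def B1_def B2_def 1 2 using \<mu>0 by simp
  qed
  have "open (V1 \<inter> \<Delta> -` {0<..})" by (intro continuous_open_preimage c\<Delta> V1(1)) auto
  moreover have "z0 \<in> V1 \<inter> \<Delta> -` {0<..}" using V1(3) \<Delta>0 by simp
  ultimately obtain R0 where R0: "R0 > 0" "cball z0 R0 \<subseteq> V1 \<inter> \<Delta> -` {0<..}" by (meson open_contains_cball)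
  define R where "R = min R0 (e / 2)"
  have R: "R > 0" "R < e" "cball z0 R \<subseteq> V1" "\<And>z. z \<in> cball z0 R \<Longrightarrow> \<Delta> z > 0"
    using R0 e unfolding R_def by (auto simp: subset_iff)
  have RV: "z \<in> V" if "z \<in> cball z0 R" for z using that R(3) V1(2) by blast
  \<comment> \<open>The Weingarten relation for the unnormalised normal m, obtained from triple
    products.\<close>
  have dmd1: "dm z h \<bullet> tangent_map \<phi> z k = - norm (m z) * II \<phi> z h k" for z h k
  proof -
    have t: "cross3 x v \<bullet> u = - (cross3 u v \<bullet> x)" "cross3 u y \<bullet> v = - (cross3 u v \<bullet> y)" for x y u v :: "real^3"
      by (simp_all add: cross3_simps)
    have "dm z h \<bullet> tangent_map \<phi> z k = - (m z \<bullet> (Re k *\<^sub>R hess \<phi> z h 1 + Im k *\<^sub>R hess \<phi> z h \<i>))"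
      unfolding dm_def m_def tangent_map_def
      by (simp add: inner_add_left inner_add_right dot_cross_self t(1)[of _ "phi_v \<phi> z" "phi_u \<phi> z"] t(2)[of "phi_u \<phi> z" _ "phi_v \<phi> z"])
    also have "Re k *\<^sub>R hess \<phi> z h 1 + Im k *\<^sub>R hess \<phi> z h \<i> = hess \<phi> z h k"
      unfolding hess_def by (simp add: algebra_simps)
    also have "m z \<bullet> hess \<phi> z h k = norm (m z) * II \<phi> z h k"
      unfolding m_def II_def by (subst nrm_eq) simp
    finally show ?thesis by simp
  qed
  have G: "G z h = - of_real (norm (m z)) * (B1 z * of_real (II \<phi> z h 1) + B2 z * of_real (II \<phi> z h \<i>))" if z: "z \<in> V" for z h
  proof -
    have "II \<phi> z h k = Re k * II \<phi> z h 1 + Im k * II \<phi> z h \<i>" for k unfolding II_eq by (simp add: algebra_simps)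
    then have dw: "dm z h \<bullet> w b z = - norm (m z) * (Re (\<beta> b z) * II \<phi> z h 1 + Im (\<beta> b z) * II \<phi> z h \<i>)" for b
      unfolding w\<beta>[OF z] dmd1 by metis
    show ?thesis unfolding G_def B1_def B2_def dw by (simp add: algebra_simps)
  qed
  have II: "II \<phi> z 1 1 = sL \<phi> z" "II \<phi> z 1 \<i> = sM \<phi> z" "II \<phi> z \<i> 1 = sM \<phi> z" "II \<phi> z \<i> \<i> = sN \<phi> z" for z
    unfolding II_eq by simp_all
  obtain r n where r: "0 < r" "r < R" "turns (\<lambda>t. G (z0 + circ r t) 1) n" "n \<le> 0"
  proof (rule turns_derivative_nonpos[OF R(1), of z0 g G])
    fix z assume z: "z \<in> cball z0 R"
    have zV: "z \<in> V" and \<mu>z: "\<mu> z \<noteq> 0" using z R(3) V1(2,4) by force+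
    have md: "(m has_derivative dm z) (at z)"
      unfolding m_def dm_def
      by (rule cross.FDERIV[OF phi_uv_has_derivative[OF ch zV]])
    have q: "((\<lambda>z. m z \<bullet> b / \<mu> z) has_derivative (\<lambda>h. dm z h \<bullet> w b z)) (at z)" for b
    proof -
      have 1: "((\<lambda>z. m z \<bullet> b) has_derivative (\<lambda>h. dm z h \<bullet> b)) (at z)" for b
        using md by (auto intro!: derivative_eq_intros)
      have "((\<lambda>z. m z \<bullet> b / \<mu> z) has_derivative (\<lambda>h. ((dm z h \<bullet> b) * \<mu> z - (m z \<bullet> b) * (dm z h \<bullet> m z0)) / (\<mu> z * \<mu> z))) (at z)"
        by (rule has_derivative_divide'[OF 1 1[of "m z0", folded \<mu>_def] \<mu>z])
      moreover have "((dm z h \<bullet> b) * \<mu> z - (m z \<bullet> b) * (dm z h \<bullet> m z0)) / (\<mu> z * \<mu> z) = dm z h \<bullet> w b z" for h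
        unfolding w_def by (simp add: inner_diff_right power2_eq_square mult_ac)
      ultimately show ?thesis by simp
    qed
    show "(g has_derivative G z) (at z)"
      unfolding g_def G_def
      by (intro has_derivative_add has_derivative_mult_right has_derivative_of_real q)
    assume ne: "z \<noteq> z0"
    have "Im (cnj (G z 1) * G z \<i>) = (norm (m z))\<^sup>2 * (sL \<phi> z * sN \<phi> z - (sM \<phi> z)\<^sup>2) * \<Delta> z"
      unfolding G[OF zV] II \<Delta>_def by (simp add: algebra_simps power2_eq_square)
    also have "\<dots> < 0"
      using neg[OF zV ne] R(4)[OF z] m0[OF zV] by (intro mult_neg_pos mult_pos_neg) auto
    finally show "Im (cnj (G z 1) * G z \<i>) < 0" .
  next
    have cG: "continuous_on V1 (\<lambda>z. G z 1)" "continuous_on V1 (\<lambda>z. G z \<i>)"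
      unfolding G_def dm_def hess_simps by (intro continuous_intros cross.continuous_on cont1 cw)+
    show "continuous_on (cball z0 R) (\<lambda>z. G z 1)" "continuous_on (cball z0 R) (\<lambda>z. G z \<i>)"
      by (rule cG[THEN continuous_on_subset, OF R(3)])+
  qed (rule that)
  let ?z = "\<lambda>t. z0 + circ r t"
  have zr: "?z t \<in> cball z0 R" "?z t \<noteq> z0" for t using r by (auto simp: dist_norm)
  have inR: "z0 + x \<in> cball z0 R" if "x \<in> cball 0 r" for x using that r by (simp add: dist_norm)
  have B1nz: "B1 z \<noteq> 0" if "z \<in> cball z0 R" for z using R(4)[OF that] unfolding \<Delta>_def by auto
  \<comment> \<open>This factor is nonzero on the whole disc, including z0, so dividing by it
    changes no turns and leaves L + M \<tau>.\<close>
  define D where "D = (\<lambda>z. - of_real (norm (m z)) * B1 z)"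
  have Dnz: "D z \<noteq> 0" if "z \<in> cball z0 R" for z
    using B1nz[OF that] m0[OF RV[OF that]] unfolding D_def by simp
  have "turns (\<lambda>t. D (?z t)) 0"
  proof (rule turns_on_cball[where f = "\<lambda>x. D (z0 + x)"])
    have cD: "continuous_on V1 D" unfolding D_def by (intro continuous_intros cont1 cB)
    have "continuous_on (cball 0 r) (\<lambda>x. z0 + x)" by (intro continuous_intros)
    moreover have "(\<lambda>x. z0 + x) ` cball 0 r \<subseteq> V1" using inR R(3) by blast
    ultimately show "continuous_on (cball 0 r) (\<lambda>x. D (z0 + x))" by (rule continuous_on_compose2[OF cD])
    show "D (z0 + x) \<noteq> 0" if "x \<in> cball 0 r" for x by (rule Dnz[OF inR[OF that]])
  qed (rule r)
  from turns_divide[OF r(3) this]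
  have "turns (\<lambda>t. G (?z t) 1 / D (?z t)) n" by simp
  moreover define \<tau> where "\<tau> = (\<lambda>z. B2 z / B1 z)"
  define P where "P = (\<lambda>z. of_real (sL \<phi> z) + of_real (sM \<phi> z) * \<tau> z)"
  have "G z 1 / D z = P z" if z: "z \<in> cball z0 R" for z
    unfolding G[OF RV[OF z]] II D_def P_def \<tau>_def using B1nz[OF z] m0[OF RV[OF z]] by (simp add: field_simps)
  then have "G (?z t) 1 / D (?z t) = P (?z t)" for t using zr(1) by blast
  ultimately have tP: "turns (\<lambda>t. P (?z t)) n" by simp
  have cz: "continuous_on {0..1} ?z" by (intro continuous_intros continuous_on_circ)
  have zV1: "?z ` {0..1} \<subseteq> V1" using zr(1) R(3) by blast
  \<comment> \<open>\<tau> is moved to i, which removes the dependence on the basis chosen at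
    z0.\<close>
  have "turns (\<lambda>t. of_real (sL \<phi> (?z t)) + \<i> * of_real (sM \<phi> (?z t))) n"
  proof (rule turns_linear[OF _ _ tP])
    have "continuous_on V1 (\<lambda>z. of_real (sL \<phi> z) + \<i> * of_real (sM \<phi> z) :: complex)"
      by (intro continuous_intros cont1)
    then show "continuous_on {0..1} (\<lambda>t. of_real (sL \<phi> (?z t)) + \<i> * of_real (sM \<phi> (?z t)) :: complex)"
      by (rule continuous_on_compose2[OF _ cz zV1])
    have "continuous_on (cball z0 R) P"
      unfolding P_def \<tau>_def using B1nz
      by (intro continuous_intros cont1[THEN continuous_on_subset, OF R(3)] cB[THEN continuous_on_subset, OF R(3)]) auto
    then show "continuous_on {0..1} (\<lambda>t. P (?z t))"
      by (rule continuous_on_compose2[OF _ cz]) (use zr(1) in blast)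
    fix t :: real
    have "Im (\<tau> (?z t)) > 0"
    proof -
      have "\<tau> (?z t) = cnj (B1 (?z t)) * B2 (?z t) / of_real ((norm (B1 (?z t)))\<^sup>2)"
        unfolding \<tau>_def complex_norm_square using B1nz[OF zr(1)] by simp
      then have "Im (\<tau> (?z t)) = \<Delta> (?z t) / (norm (B1 (?z t)))\<^sup>2"
        unfolding \<Delta>_def by (simp only: Im_divide_of_real)
      then show ?thesis using R(4)[OF zr(1)] B1nz[OF zr(1)] by simp
    qed
    then show "(of_real (sL \<phi> (?z t)) + \<i> * of_real (sM \<phi> (?z t))) / P (?z t) \<notin> \<real>\<^sub>\<le>\<^sub>0"
      unfolding P_def by (rule upper_half_plane_combination(2)[OF neg[OF RV[OF zr(1)] zr(2)]])
  qed (simp_all only: circ_closed)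
  then show ?thesis using that r R(2) by simp
qed

subsection \<open>The index of a principal line field\<close>

lemma gauss_curvature_neg_iff:
  assumes "chart M V \<phi>" "z \<in> V"
  shows "gauss_curv_chart \<phi> z < 0 \<longleftrightarrow> sL \<phi> z * sN \<phi> z < (sM \<phi> z)\<^sup>2"
proof -
  have "nrm \<phi> z \<bullet> nrm \<phi> z > 0" using chart_cross_nz[OF assms] by simp
  then show ?thesis unfolding gauss_curv_chart_def gram_determinant by (simp add: divide_less_0_iff)
qed

text \<open>Principality of the direction at angle \<theta> says that II vanishes on this direction and its
  normal, i.e. that the trace-free part of II has argument 2 \<theta> up to sign.\<close>
lemma principal_angle:
  assumes nz: "nrm \<phi> z \<noteq> 0"
    and E: "tangent_map \<phi> z E1 \<bullet> tangent_map \<phi> z E2 = 0" "norm (tangent_map \<phi> z E1) = 1" "norm (tangent_map \<phi> z E2) = 1"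
    and inj: "inj (tangent_map \<phi> z)"
    and w: "principal_dir_chart \<phi> z w" "span {cos \<theta> *\<^sub>R tangent_map \<phi> z E1 + sin \<theta> *\<^sub>R tangent_map \<phi> z E2} = span {w}"
  shows "(II \<phi> z E1 E1 - II \<phi> z E2 E2) * sin (2 * \<theta>) = 2 * II \<phi> z E1 E2 * cos (2 * \<theta>)"
proof -
  let ?c = "cos \<theta>" and ?s = "sin \<theta>"
  define x where "x = ?c *\<^sub>R E1 + ?s *\<^sub>R E2"
  define y where "y = ?c *\<^sub>R E2 - ?s *\<^sub>R E1"
  have cs: "?c * ?c + ?s * ?s = 1" using sin_cos_squared_add[of \<theta>] by (simp add: power2_eq_square)
  have EE: "tangent_map \<phi> z E1 \<bullet> tangent_map \<phi> z E1 = 1" "tangent_map \<phi> z E2 \<bullet> tangent_map \<phi> z E2 = 1" "tangent_map \<phi> z E2 \<bullet> tangent_map \<phi> z E1 = 0"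
    using E by (simp_all add: norm_eq_1 inner_commute)
  have dx: "tangent_map \<phi> z x = ?c *\<^sub>R tangent_map \<phi> z E1 + ?s *\<^sub>R tangent_map \<phi> z E2"
    unfolding x_def by (simp only: tangent_map_add tangent_map_scaleR)
  have "y = ?c *\<^sub>R E2 + (- ?s) *\<^sub>R E1" unfolding y_def by simp
  then have dy: "tangent_map \<phi> z y = ?c *\<^sub>R tangent_map \<phi> z E2 + (- ?s) *\<^sub>R tangent_map \<phi> z E1"
    by (simp only: tangent_map_add tangent_map_scaleR)
  have xy: "tangent_map \<phi> z x \<bullet> tangent_map \<phi> z y = 0"
    unfolding dx dy using E(1) EE by (simp add: inner_add_left inner_diff_right)
  have xx: "tangent_map \<phi> z x \<bullet> tangent_map \<phi> z x = 1"
    unfolding dx using E(1) EE cs by (simp add: inner_add_left inner_add_right)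
  obtain h \<kappa> where h: "w \<noteq> 0" "w = tangent_map \<phi> z h" "\<And>k. II \<phi> z h k = \<kappa> * (tangent_map \<phi> z h \<bullet> tangent_map \<phi> z k)"
    using w(1) unfolding principal_dir_chart_iff by blast
  have "tangent_map \<phi> z x \<in> span {w}" using w(2) unfolding dx by (metis insertI1 span_base)
  then obtain a where a: "tangent_map \<phi> z x = a *\<^sub>R w" by (auto simp: span_singleton)
  then have "tangent_map \<phi> z x = tangent_map \<phi> z (a *\<^sub>R h)" by (simp add: tangent_map_scaleR h(2))
  then have xh: "x = a *\<^sub>R h" using inj by (simp add: inj_eq)
  have "II \<phi> z x y = a * II \<phi> z h y" unfolding xh II_eq by (simp add: algebra_simps)
  also have "\<dots> = \<kappa> * (tangent_map \<phi> z x \<bullet> tangent_map \<phi> z y)" unfolding h(3) a h(2) by simp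
  finally have "II \<phi> z x y = 0" using xy by simp
  moreover have "II \<phi> z x y = (?c\<^sup>2 - ?s\<^sup>2) * II \<phi> z E1 E2 - ?s * ?c * (II \<phi> z E1 E1 - II \<phi> z E2 E2)"
    unfolding x_def y_def II_eq by (simp add: algebra_simps power2_eq_square)
  ultimately show ?thesis unfolding sin_double cos_double by (simp add: algebra_simps)
qed

theorem theorem1:
  fixes M :: "(real^3) set" and q :: "real^3" and \<eta> :: "real^3 \<Rightarrow> (real^3) set"
  assumes "C2_surface M"
    and "q \<in> M"
    and "\<forall>p\<in>M - {q}. \<forall>K. has_gauss_curvature M p K \<longrightarrow> K < 0"
    and "principal_line_field M (M - {q}) \<eta>"
  shows "\<forall>k. ph_index M q \<eta> k \<longrightarrow> k \<le> 0"
proof (intro allI impI)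
  fix k assume "ph_index M q \<eta> k"
  then obtain V \<phi> U e1 e2 c z0 \<theta> where ch: "chart M V \<phi>" and U: "open U" "q \<in> U"
    and ce: "continuous_on (U \<inter> M) e1" "continuous_on (U \<inter> M) e2"
    and fr: "\<forall>z\<in>V. \<phi> z \<in> U \<longrightarrow>
          norm (e1 (\<phi> z)) = 1 \<and> norm (e2 (\<phi> z)) = 1 \<and> e1 (\<phi> z) \<bullet> e2 (\<phi> z) = 0 \<and>
          e1 (\<phi> z) \<in> span {phi_u \<phi> z, phi_v \<phi> z} \<and>
          e2 (\<phi> z) \<in> span {phi_u \<phi> z, phi_v \<phi> z} \<and>
          cross3 (e1 (\<phi> z)) (e2 (\<phi> z)) \<bullet> cross3 (phi_u \<phi> z) (phi_v \<phi> z) > 0"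
    and c: "simple_path c" "pathfinish c = pathstart c"
    and KV: "path_image c \<union> inside (path_image c) \<subseteq> V"
    and KU: "\<phi> ` (path_image c \<union> inside (path_image c)) \<subseteq> U"
    and z0: "z0 \<in> V" "\<phi> z0 = q" "z0 \<in> inside (path_image c)" and wn: "winding_number c z0 = 1"
    and c\<theta>: "continuous_on {0..1} \<theta>"
    and ang: "\<forall>t\<in>{0..1}. \<eta> (\<phi> (c t)) =
           span {cos (\<theta> t) *\<^sub>R e1 (\<phi> (c t)) + sin (\<theta> t) *\<^sub>R e2 (\<phi> (c t))}"
    and k: "k = (\<theta> 1 - \<theta> 0) / (2 * pi)"
    unfolding ph_index_def by (elim exE conjE) (rule that)
  define K where "K = path_image c \<union> inside (path_image c)"
  note KV = KV[folded K_def] and KU = KU[folded K_def]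
  have pc: "path c" using c(1) by (rule simple_path_imp_path)
  have \<phi>inj: "inj_on \<phi> V" and \<phi>M: "\<phi> ` V \<subseteq> M" using ch unfolding chart_def by simp_all
  have notq: "\<phi> z \<in> M - {q}" if "z \<in> V" "z \<noteq> z0" for z
  proof -
    have "\<phi> z \<noteq> q"
    proof
      assume "\<phi> z = q"
      then have "z = z0" using inj_onD[OF \<phi>inj _ that(1) z0(1)] z0(2) by simp
      then show False using that(2) by simp
    qed
    moreover have "\<phi> z \<in> M" using \<phi>M that(1) by (auto simp: image_subset_iff)
    ultimately show ?thesis by simp
  qed
  have neg: "sL \<phi> z * sN \<phi> z < (sM \<phi> z)\<^sup>2" if z: "z \<in> V" "z \<noteq> z0" for z
  proof -
    have "has_gauss_curvature M (\<phi> z) (gauss_curv_chart \<phi> z)"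
      unfolding has_gauss_curvature_def
      by (intro exI[of _ V] exI[of _ \<phi>] exI[of _ z] conjI ch z(1) refl)
    then have "gauss_curv_chart \<phi> z < 0" by (rule assms(3)[rule_format, OF notq[OF z]])
    then show ?thesis by (simp only: gauss_curvature_neg_iff[OF ch z(1)])
  qed
  define \<sigma> where "\<sigma> = (\<lambda>z. of_real (sL \<phi> z) + \<i> * of_real (sM \<phi> z) :: complex)"
  have \<sigma>nz: "\<sigma> z \<noteq> 0" if "z \<in> V" "z \<noteq> z0" for z
    using upper_half_plane_combination(1)[OF neg[OF that], of \<i>] unfolding \<sigma>_def by (simp add: mult.commute)
  have "open (inside (path_image c))" by (rule open_inside[OF closed_path_image[OF pc]])
  then obtain e where e: "e > 0" "cball z0 e \<subseteq> inside (path_image c)"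
    using z0(3) by (meson open_contains_cball)
  obtain r n where r: "0 < r" "r < e" and n: "turns (\<lambda>t. \<sigma> (z0 + circ r t)) n" "n \<le> 0"
    unfolding \<sigma>_def by (rule second_form_turns[OF ch z0(1) e(1) neg]) (use that in blast)+
  note cV = continuous_on_chart[OF ch] continuous_on_second_form[OF ch]
  note cK = cV[THEN continuous_on_subset, OF KV]
  have t\<sigma>: "turns (\<lambda>t. \<sigma> (c t)) n"
  proof (rule turns_jordan[OF pc c(2) wn K_def r(1) _ _ _ n(1)])
    show "cball z0 r \<subseteq> inside (path_image c)" using e(2) r by (auto simp: subset_iff)
    show "continuous_on (K - {z0}) \<sigma>" unfolding \<sigma>_def
      by (intro continuous_intros cK[THEN continuous_on_subset]) auto
    show "\<sigma> z \<noteq> 0" if "z \<in> K - {z0}" for z using \<sigma>nz KV that by blast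
  qed
  have cin: "c t \<in> K" "c t \<noteq> z0" if "t \<in> {0..1}" for t
  proof -
    have "c t \<in> path_image c" using that unfolding path_image_def by blast
    then show "c t \<in> K" "c t \<noteq> z0" using z0(3) inside_no_overlap[of "path_image c"] unfolding K_def by blast+
  qed
  have cc: "continuous_on {0..1} c" using pc by (simp add: path_def)
  have c01: "c 0 = c 1" using c(2) by (simp add: pathfinish_def pathstart_def)
  have cim: "c ` {0..1} \<subseteq> K" using cin(1) by blast
  have bd: "bounded (path_image c)" using pc by (rule bounded_path_image)
  have Kcomp: "compact K"
    unfolding compact_eq_bounded_closed K_def
    using closed_path_image_Un_inside[OF pc] bd bounded_inside[OF bd] by simp
  have "- K = outside (path_image c)" unfolding K_def by (simp add: union_with_inside)
  then have Kcon: "connected (- K)" using connected_outside[OF bd] by simp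
  have \<phi>K: "continuous_on K \<phi>" by (rule cK(1))
  have \<phi>UM: "\<phi> ` K \<subseteq> U \<inter> M" using KU KV \<phi>M by blast
  define E1 where "E1 = (\<lambda>z. coords \<phi> z (e1 (\<phi> z)))"
  define E2 where "E2 = (\<lambda>z. coords \<phi> z (e2 (\<phi> z)))"
  have cE: "continuous_on K E1" "continuous_on K E2"
    unfolding E1_def E2_def
    by (intro continuous_on_coords[OF ch KV] continuous_on_compose2[OF ce(1) \<phi>K \<phi>UM]
          continuous_on_compose2[OF ce(2) \<phi>K \<phi>UM])+
  have frz: "norm (e1 (\<phi> z)) = 1" "norm (e2 (\<phi> z)) = 1" "e1 (\<phi> z) \<bullet> e2 (\<phi> z) = 0"
          "e1 (\<phi> z) \<in> span {phi_u \<phi> z, phi_v \<phi> z}" "e2 (\<phi> z) \<in> span {phi_u \<phi> z, phi_v \<phi> z}"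
          "cross3 (e1 (\<phi> z)) (e2 (\<phi> z)) \<bullet> nrm \<phi> z > 0" if "z \<in> K" for z
    using fr that KV KU by blast+
  have tangent: "tangent_map \<phi> z (coords \<phi> z w) = w" if "z \<in> V" "w \<in> span {phi_u \<phi> z, phi_v \<phi> z}" for z w
  proof (rule tangent_map_coords[OF chart_cross_nz[OF ch that(1)]])
    have "orthogonal (nrm \<phi> z) w"
      by (rule orthogonal_to_span[OF that(2)]) (auto simp: orthogonal_def dot_cross_self)
    then show "w \<bullet> nrm \<phi> z = 0" by (simp add: orthogonal_def inner_commute)
  qed
  have dE: "tangent_map \<phi> z (E1 z) = e1 (\<phi> z)" "tangent_map \<phi> z (E2 z) = e2 (\<phi> z)" if "z \<in> K" for z
    unfolding E1_def E2_def using tangent frz(4,5)[OF that] KV that by blast+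
  \<comment> \<open>The same encoding as for the gradient map, now for the orthonormal frame; the
    orientation condition on the frame is what puts B / A in the upper half plane.\<close>
  define A where "A = (\<lambda>z. of_real (Re (E1 z)) + \<i> * of_real (Re (E2 z)))"
  define B where "B = (\<lambda>z. of_real (Im (E1 z)) + \<i> * of_real (Im (E2 z)))"
  have AB: "Im (cnj (A z) * B z) > 0" if z: "z \<in> K" for z
  proof -
    have "(Re (E1 z) * Im (E2 z) - Im (E1 z) * Re (E2 z)) * (nrm \<phi> z \<bullet> nrm \<phi> z) > 0"
      using frz(6)[OF z] unfolding dE[OF z, symmetric] cross_tangent_map by simp
    then have "Re (E1 z) * Im (E2 z) - Im (E1 z) * Re (E2 z) > 0"
      by (rule zero_less_mult_pos2) (use chart_cross_nz[OF ch] KV z in auto)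
    then show ?thesis unfolding A_def B_def by (simp add: algebra_simps)
  qed
  have Anz: "A z \<noteq> 0" if "z \<in> K" for z using AB[OF that] by auto
  have cA: "continuous_on K A" "continuous_on K B" unfolding A_def B_def by (intro continuous_intros cE)+
  define \<tau> where "\<tau> = (\<lambda>z. B z / A z)"
  have \<tau>: "Im (\<tau> z) > 0" if z: "z \<in> K" for z
  proof -
    have "\<tau> z = cnj (A z) * B z / of_real ((norm (A z))\<^sup>2)"
      unfolding \<tau>_def complex_norm_square using Anz[OF z] by simp
    then have "Im (\<tau> z) = Im (cnj (A z) * B z) / (norm (A z))\<^sup>2" by (simp only: Im_divide_of_real)
    then show ?thesis using AB[OF z] Anz[OF z] by simp
  qed
  have c\<tau>: "continuous_on K \<tau>" unfolding \<tau>_def using Anz by (intro continuous_intros cA) auto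
  define P where "P = (\<lambda>z. of_real (sL \<phi> z) + of_real (sM \<phi> z) * \<tau> z)"
  define Q where "Q = (\<lambda>z. of_real (sL \<phi> z) + 2 * of_real (sM \<phi> z) * \<tau> z + of_real (sN \<phi> z) * (\<tau> z)\<^sup>2)"
  have cPQ: "continuous_on K P" "continuous_on K Q" "continuous_on K \<sigma>"
    unfolding P_def Q_def \<sigma>_def by (intro continuous_intros cK c\<tau>)+
  note along = continuous_on_compose2[OF _ cc cim]
  have ct: "c t \<in> V" "c t \<noteq> z0" "c t \<in> K" if "t \<in> {0..1}" for t using cin[OF that] KV by auto
  have comb: "P (c t) \<noteq> 0" "\<sigma> (c t) / P (c t) \<notin> \<real>\<^sub>\<le>\<^sub>0" "Q (c t) / P (c t) \<notin> \<real>\<^sub>\<le>\<^sub>0" if t: "t \<in> {0..1}" for t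
    using upper_half_plane_combination[OF neg[OF ct(1,2)[OF t]] \<tau>[OF ct(3)[OF t]]]
    unfolding P_def Q_def \<sigma>_def by blast+
  obtain m :: int where m: "turns (\<lambda>t. P (c t)) m"
    by (rule turns_exists[OF along[OF cPQ(1)]]) (use comb(1) c01 that in auto)
  have "turns (\<lambda>t. \<sigma> (c t)) m"
    by (rule turns_linear[OF along[OF cPQ(3)] _ m along[OF cPQ(1)] _ comb(2)]) (simp_all add: c01)
  then have mn: "m = n" using turns_unique[OF t\<sigma>] by simp
  have tQ: "turns (\<lambda>t. Q (c t)) n"
    unfolding mn[symmetric]
    by (rule turns_linear[OF along[OF cPQ(2)] _ m along[OF cPQ(1)] _ comb(3)]) (simp_all add: c01)
  \<comment> \<open>The frame is defined on the whole filled curve, including q, so its rotation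
    against the coordinates contributes no turns.\<close>
  have tA: "turns (\<lambda>t. A (c t)) 0" by (rule turns_nonseparating[OF Kcomp Kcon cA(1) Anz cc cim c01])
  \<comment> \<open>A^2 Q = L A^2 + 2 M A B + N B^2 is the trace-free part of II in the frame;
    \<open>S_eq\<close> reads off its real and imaginary parts.\<close>
  define S where "S = (\<lambda>z. (A z)\<^sup>2 * Q z)"
  have tS: "turns (\<lambda>t. S (c t)) n"
    using turns_mult[OF turns_power[OF tA, of 2] tQ] unfolding S_def by simp
  have S_eq: "S z = Complex (II \<phi> z (E1 z) (E1 z) - II \<phi> z (E2 z) (E2 z)) (2 * II \<phi> z (E1 z) (E2 z))" if z: "z \<in> K" for z
  proof -
    have "S z = of_real (sL \<phi> z) * (A z)\<^sup>2 + 2 * of_real (sM \<phi> z) * A z * B z + of_real (sN \<phi> z) * (B z)\<^sup>2"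
      unfolding S_def Q_def \<tau>_def using Anz[OF z] by (simp add: field_simps power2_eq_square)
    also have "\<dots> = Complex (II \<phi> z (E1 z) (E1 z) - II \<phi> z (E2 z) (E2 z)) (2 * II \<phi> z (E1 z) (E2 z))"
      unfolding A_def B_def II_eq by (simp add: complex_eq_iff power2_eq_square algebra_simps)
    finally show ?thesis .
  qed
  \<comment> \<open>By \<open>principal_angle\<close>, S is a real multiple \<rho> of cis (2
    \<theta>). Squaring removes the unknown sign of \<rho> and yields an explicit logarithm with
    imaginary part 4 \<theta>.\<close>
  have S2: "(S (c t))\<^sup>2 = exp (of_real (2 * ln (norm (S (c t)))) + \<i> * of_real (4 * \<theta> t))" if t: "t \<in> {0..1}" for t
  proof -
    let ?z = "c t"
    note z = ct[OF t]
    obtain w where w: "principal_dir M (\<phi> ?z) w" "\<eta> (\<phi> ?z) = span {w}"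
      using assms(4) notq[OF z(1,2)] unfolding principal_line_field_def by blast
    then have wch: "principal_dir_chart \<phi> ?z w"
      unfolding principal_dir_def using principal_dir_chart_transfer[OF ch z(1)] by metis
    have "(II \<phi> ?z (E1 ?z) (E1 ?z) - II \<phi> ?z (E2 ?z) (E2 ?z)) * sin (2 * \<theta> t) = 2 * II \<phi> ?z (E1 ?z) (E2 ?z) * cos (2 * \<theta> t)"
    proof (rule principal_angle[OF chart_cross_nz[OF ch z(1)] _ _ _ inj_tangent_map[OF ch z(1)] wch])
      show "span {cos (\<theta> t) *\<^sub>R tangent_map \<phi> ?z (E1 ?z) + sin (\<theta> t) *\<^sub>R tangent_map \<phi> ?z (E2 ?z)} = span {w}"
        using ang t w(2) unfolding dE[OF z(3)] by simp
    qed (simp_all add: dE[OF z(3)] frz[OF z(3)])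
    then have im: "Im (S ?z * cis (- (2 * \<theta> t))) = 0" unfolding S_eq[OF z(3)] by simp
    define \<rho> where "\<rho> = Re (S ?z * cis (- (2 * \<theta> t)))"
    have "S ?z * cis (- (2 * \<theta> t)) = of_real \<rho>" using im unfolding \<rho>_def by (simp add: complex_eq_iff)
    then have "S ?z * (cis (- (2 * \<theta> t)) * cis (2 * \<theta> t)) = of_real \<rho> * cis (2 * \<theta> t)"
      by (simp only: mult.assoc[symmetric])
    then have S\<rho>: "S ?z = of_real \<rho> * cis (2 * \<theta> t)" by (simp add: cis_mult)
    have Snz: "S ?z \<noteq> 0" using turns_nonzero[OF tS t] .
    have n\<rho>: "norm (S ?z) = \<bar>\<rho>\<bar>" unfolding S\<rho> by (simp add: norm_mult)
    have "exp (of_real (2 * ln (norm (S ?z))) + \<i> * of_real (4 * \<theta> t)) = of_real (exp (2 * ln (norm (S ?z)))) * cis (4 * \<theta> t)"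
      by (simp only: exp_add exp_of_real cis_conv_exp)
    also have "exp (2 * ln (norm (S ?z))) = (norm (S ?z))\<^sup>2"
      using Snz by (simp add: exp_double)
    also have "(norm (S ?z))\<^sup>2 = \<rho>\<^sup>2" unfolding n\<rho> by simp
    also have "of_real (\<rho>\<^sup>2) * cis (4 * \<theta> t) = (S ?z)\<^sup>2"
      unfolding S\<rho> power_mult_distrib by (simp add: power2_eq_square cis_mult)
    finally show ?thesis by simp
  qed
  have cS: "continuous_on {0..1} (\<lambda>t. S (c t))"
    by (rule along) (unfold S_def, intro continuous_intros cA cPQ)
  have "turns (\<lambda>t. (S (c t))\<^sup>2) (4 * k)"
    unfolding turns_def
  proof (intro exI[of _ "\<lambda>t. of_real (2 * ln (norm (S (c t)))) + \<i> * of_real (4 * \<theta> t)"] conjI ballI S2)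
    show "continuous_on {0..1} (\<lambda>t. of_real (2 * ln (norm (S (c t)))) + \<i> * of_real (4 * \<theta> t) :: complex)"
      using turns_nonzero[OF tS] by (intro continuous_intros cS c\<theta>) auto
    show "of_real (2 * ln (norm (S (c 1)))) + \<i> * of_real (4 * \<theta> 1) - (of_real (2 * ln (norm (S (c 0)))) + \<i> * of_real (4 * \<theta> 0)) =
        of_real (2 * pi * (4 * k)) * \<i>"
    proof -
      have "2 * pi * (4 * k) = 4 * \<theta> 1 - 4 * \<theta> 0" unfolding k by (simp add: field_simps)
      then show ?thesis unfolding c01 by (simp only: of_real_diff) (simp add: algebra_simps)
    qed
  qed
  moreover have "turns (\<lambda>t. (S (c t))\<^sup>2) (2 * n)" using turns_power[OF tS, of 2] by simp
  \<comment> \<open>The left side comes from 4 \<theta>, which grows by 2 pi (4 k), and the right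
    side from squaring S, which turns n times.\<close>
  ultimately have "4 * k = 2 * n" by (rule turns_unique)
  then show "k \<le> 0" using n(2) by simp
qed

end
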